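(* Let $p$ be a prime, $h\ge1$ and $n\ge p^{h+1}$ integers, and $H$ a formal group law over $\mathbb F_p$ with $[p]_H(T)=T^{p^h}$. Then the group scheme $\mathcal{A}ut(H^{(n)})$ is smooth of dimension $h$ over $\operatorname{Spec}\mathbb F_p$.
   Context: Formal group laws are commutative and 1-parameter; $[1]_F(T)=T$, $[m+1]_F(T)=F([m]_F(T),T)$. A formal group law $H$ over $\mathbb F_p$ with $[p]_H(T)=T^{p^h}$ exists and is fixed; $H^{(n)}\in\mathbb F_p[T_1,T_2]/(T_1,T_2)^{n+1}$ is obtained from $H$ by discarding terms of degree $\ge n+1$. $\mathcal{A}ut(H^{(n)})$ is the presheaf of groups on $\mathbb F_p$-schemes sending $S$ to the group, under composition, of truncated polynomials $f=a_1T+\dots+a_nT^n\in\Gamma(S,\mathcal O_S)[T]/(T)^{n+1}$ with $a_1$ a unit and $f(H^{(n)}(T_1,T_2))=H^{(n)}(f(T_1),f(T_2))$ in $\Gamma(S,\mathcal O_S)[T_1,T_2]/(T_1,T_2)^{n+1}$. It is represented by a closed subgroup scheme of $\operatorname{Spec}\mathbb F_p[a_1,a_1^{-1},a_2,\dots,a_n]$ (the group scheme of all such $f$ under composition, without the condition on $H^{(n)}$). *)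

theory Defs
  imports
    "HOL-Library.Poly_Mapping"
    "HOL-Computational_Algebra.Formal_Power_Series"
    "HOL-Algebra.Algebraic_Closure_Type"
    "Jordan_Normal_Form.Determinant"
    "Berlekamp_Zassenhaus.Finite_Field"
begin

section \<open>Multivariate polynomials\<close>

type_synonym 'a mpoly = "(nat \<Rightarrow>\<^sub>0 nat) \<Rightarrow>\<^sub>0 'a"

definition mconst :: "'a \<Rightarrow> 'a::comm_ring_1 mpoly" where
  "mconst c = Poly_Mapping.single 0 c"

definition mvar :: "nat \<Rightarrow> 'a::comm_ring_1 mpoly" where
  "mvar i = Poly_Mapping.single (Poly_Mapping.single i 1) 1"

definition mvars :: "'a::comm_ring_1 mpoly \<Rightarrow> nat set" where
  "mvars p = (\<Union>m\<in>Poly_Mapping.keys p. Poly_Mapping.keys m)"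

definition total_deg :: "(nat \<Rightarrow>\<^sub>0 nat) \<Rightarrow> nat" where
  "total_deg m = (\<Sum>i\<in>Poly_Mapping.keys m. Poly_Mapping.lookup m i)"

text \<open>Congruence modulo the \<open>(n+1)\<close>-st power of the ideal generated by all variables.\<close>
definition eq_upto_deg :: "nat \<Rightarrow> 'a::comm_ring_1 mpoly \<Rightarrow> 'a mpoly \<Rightarrow> bool" where
  "eq_upto_deg n p q \<longleftrightarrow>
     (\<forall>m. total_deg m \<le> n \<longrightarrow> Poly_Mapping.lookup p m = Poly_Mapping.lookup q m)"

text \<open>The partial derivative with respect to the \<open>i\<close>-th variable. Monomials not containing
  that variable get the coefficient \<open>of_nat 0\<close>.\<close>
definition mpderiv :: "nat \<Rightarrow> 'a::comm_ring_1 mpoly \<Rightarrow> 'a mpoly" where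
  "mpderiv i p = (\<Sum>m\<in>Poly_Mapping.keys p.
     Poly_Mapping.single (m - Poly_Mapping.single i 1)
       (of_nat (Poly_Mapping.lookup m i) * Poly_Mapping.lookup p m))"

definition mpoly_ring :: "nat set \<Rightarrow> ('a::comm_ring_1 mpoly) ring" where
  "mpoly_ring V = ring_of_type_algebra\<lparr>carrier := {p. mvars p \<subseteq> V}\<rparr>"

text \<open>The algebra \<open>k[x\<^sub>i : i \<in> V] / (G)\<close>, and the class in it of a polynomial.\<close>
definition presented_ring :: "nat set \<Rightarrow> 'a::comm_ring_1 mpoly set \<Rightarrow> ('a mpoly set) ring" where
  "presented_ring V G = mpoly_ring V Quot genideal (mpoly_ring V) G"

definition presented_class ::
    "nat set \<Rightarrow> 'a::comm_ring_1 mpoly set \<Rightarrow> 'a mpoly \<Rightarrow> 'a mpoly set" where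
  "presented_class V G p = genideal (mpoly_ring V) G +>\<^bsub>mpoly_ring V\<^esub> p"


section \<open>Smooth algebras over a field\<close>

text \<open>The homomorphism \<open>\<psi> : B \<rightarrow> C\<close> is a localization of \<open>B\<close> away from \<open>b\<close>,
  i.e. it induces an isomorphism from \<open>B[1/b]\<close> to \<open>C\<close>.\<close>
definition localization_away ::
    "('b, 'm) ring_scheme \<Rightarrow> 'b \<Rightarrow> ('c, 'n) ring_scheme \<Rightarrow> ('b \<Rightarrow> 'c) \<Rightarrow> bool" where
  "localization_away B b C \<psi> \<longleftrightarrow>
     \<psi> \<in> Ring.ring_hom B C \<and>
     \<psi> b \<in> Units C \<and>
     (\<forall>y\<in>carrier C. \<exists>x\<in>carrier B. \<exists>k::nat. y \<otimes>\<^bsub>C\<^esub> (\<psi> b [^]\<^bsub>C\<^esub> k) = \<psi> x) \<and>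
     (\<forall>x\<in>carrier B. \<psi> x = \<zero>\<^bsub>C\<^esub> \<longrightarrow> (\<exists>k::nat. (b [^]\<^bsub>B\<^esub> k) \<otimes>\<^bsub>B\<^esub> x = \<zero>\<^bsub>B\<^esub>))"

definition jacobian_det :: "nat \<Rightarrow> (nat \<Rightarrow> 'k::comm_ring_1 mpoly) \<Rightarrow> 'k mpoly" where
  "jacobian_det c f = det (mat c c (\<lambda>(i, j). mpderiv j (f i)))"

text \<open>Let \<open>B\<close> be an algebra over a field \<open>k\<close> with structure map \<open>\<phi>\<close>. The morphism
  \<open>Spec B \<rightarrow> Spec k\<close> is smooth of relative dimension \<open>d\<close> if every point \<open>P\<close> of \<open>Spec B\<close> has a
  principal open neighbourhood \<open>D(b)\<close> isomorphic over \<open>k\<close> to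
  \<open>Spec k[x\<^sub>0,\<dots>,x\<^bsub>d+c-1\<^esub>] / (f\<^sub>0,\<dots>,f\<^bsub>c-1\<^esub>)\<close> such that the Jacobian determinant of
  \<open>f\<^sub>0,\<dots>,f\<^bsub>c-1\<^esub>\<close> with respect to the first \<open>c\<close> variables is an invertible function there
  (Vakil, The Rising Sea, definition of a smooth morphism of relative dimension \<open>d\<close>;
  Goertz-Wedhorn, Algebraic Geometry I, Def. 6.14). In these sources one has an open subscheme
  of such a spectrum; a principal open subscheme \<open>g \<noteq> 0\<close> is of the same form, with one more
  variable \<open>y\<close> and one more equation \<open>y g = 1\<close>.\<close>
definition smooth_of_relative_dimension ::
    "('b, 'm) ring_scheme \<Rightarrow> ('k::field \<Rightarrow> 'b) \<Rightarrow> nat \<Rightarrow> bool" where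
  "smooth_of_relative_dimension B \<phi> d \<longleftrightarrow>
     cring B \<and> \<phi> \<in> Ring.ring_hom ring_of_type_algebra B \<and>
     (\<forall>P. primeideal P B \<longrightarrow>
       (\<exists>b\<in>carrier B - P. \<exists>c. \<exists>f :: nat \<Rightarrow> 'k mpoly. \<exists>\<psi>.
          (\<forall>i<c. mvars (f i) \<subseteq> {..<d + c}) \<and>
          localization_away B b (presented_ring {..<d + c} (f ` {..<c})) \<psi> \<and>
          (\<forall>t. \<psi> (\<phi> t) = presented_class {..<d + c} (f ` {..<c}) (mconst t)) \<and>
          presented_class {..<d + c} (f ` {..<c}) (jacobian_det c f)
            \<in> Units (presented_ring {..<d + c} (f ` {..<c}))))"


section \<open>Formal group laws\<close>

text \<open>An element \<open>F\<close> of \<open>k[[X,Y]]\<close> is represented as a \<open>'k fps fps\<close>, where the coefficient of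
  \<open>X\<^sup>i Y\<^sup>j\<close> is \<open>fps_nth (fps_nth F i) j\<close>. The following is the value at \<open>(u,v)\<close> of \<open>F\<^bsup>(n)\<^esup>\<close>, the
  polynomial obtained from \<open>F\<close> by discarding the terms of degree \<open>\<ge> n+1\<close>; \<open>\<iota>\<close> is applied to
  the coefficients.\<close>
definition trunc_subst ::
    "('k \<Rightarrow> 'r) \<Rightarrow> nat \<Rightarrow> 'k::comm_ring_1 fps fps \<Rightarrow> 'r \<Rightarrow> 'r \<Rightarrow> 'r::comm_ring_1" where
  "trunc_subst \<iota> n F u v =
     (\<Sum>i\<le>n. \<Sum>j\<le>n - i. \<iota> (fps_nth (fps_nth F i) j) * u ^ i * v ^ j)"

text \<open>The last conjunct is \<open>F(F(X,Y),Z) = F(X,F(Y,Z))\<close>, stated modulo \<open>(X,Y,Z)\<^bsup>n+1\<^esup>\<close> for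
  all \<open>n\<close>; since \<open>F\<close> has no constant term, truncations suffice to compute these residues.\<close>
definition formal_group_law :: "'k::comm_ring_1 fps fps \<Rightarrow> bool" where
  "formal_group_law F \<longleftrightarrow>
     (\<forall>i. fps_nth (fps_nth F i) 0 = (if i = 1 then 1 else 0)) \<and>
     (\<forall>j. fps_nth (fps_nth F 0) j = (if j = 1 then 1 else 0)) \<and>
     (\<forall>i j. fps_nth (fps_nth F i) j = fps_nth (fps_nth F j) i) \<and>
     (\<forall>n. let F_n = trunc_subst mconst n F in
       eq_upto_deg n (F_n (F_n (mvar 1) (mvar 2)) (mvar 3))
                     (F_n (mvar 1) (F_n (mvar 2) (mvar 3))))"

text \<open>\<open>F(u,v)\<close> for power series \<open>u\<close>, \<open>v\<close> in one variable without constant term.\<close>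
definition fps_subst2 :: "'k::comm_ring_1 fps fps \<Rightarrow> 'k fps \<Rightarrow> 'k fps \<Rightarrow> 'k fps" where
  "fps_subst2 F u v = Abs_fps (\<lambda>n. fps_nth (trunc_subst fps_const n F u v) n)"

fun fgl_mult :: "'k::comm_ring_1 fps fps \<Rightarrow> nat \<Rightarrow> 'k fps" where
  "fgl_mult F 0 = 0"
| "fgl_mult F (Suc 0) = fps_X"
| "fgl_mult F (Suc (Suc m)) = fps_subst2 F (fgl_mult F (Suc m)) fps_X"


section \<open>The automorphism group scheme of a truncated formal group law\<close>

text \<open>\<open>f(u)\<close> for \<open>f = a\<^sub>1 T + \<dots> + a\<^sub>n T\<^sup>n\<close>.\<close>
definition curve_subst :: "nat \<Rightarrow> (nat \<Rightarrow> 'a::comm_ring_1) \<Rightarrow> 'a mpoly \<Rightarrow> 'a mpoly" where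
  "curve_subst n a u = (\<Sum>i=1..n. mconst (a i) * u ^ i)"

text \<open>\<open>f(H\<^bsup>(n)\<^esup>(T\<^sub>1,T\<^sub>2)) - H\<^bsup>(n)\<^esup>(f(T\<^sub>1),f(T\<^sub>2))\<close>, to be considered modulo
  \<open>(T\<^sub>1,T\<^sub>2)\<^bsup>n+1\<^esup>\<close>.\<close>
definition aut_defect ::
    "('k::comm_ring_1 \<Rightarrow> 'a::comm_ring_1) \<Rightarrow> nat \<Rightarrow> 'k fps fps \<Rightarrow> (nat \<Rightarrow> 'a) \<Rightarrow> 'a mpoly" where
  "aut_defect \<iota> n H a =
     (let H_n = trunc_subst (\<lambda>t. mconst (\<iota> t)) n H; f = curve_subst n a in
        f (H_n (mvar 1) (mvar 2)) - H_n (f (mvar 1)) (f (mvar 2)))"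

text \<open>The set of points of the automorphism presheaf over a \<open>k\<close>-algebra with structure map \<open>\<iota>\<close>.\<close>
definition aut_points ::
    "('k::comm_ring_1 \<Rightarrow> 'a::comm_ring_1) \<Rightarrow> nat \<Rightarrow> 'k fps fps \<Rightarrow> (nat \<Rightarrow> 'a) set" where
  "aut_points \<iota> n H =
     {a. (\<forall>i. i \<notin> {1..n} \<longrightarrow> a i = 0) \<and> a 1 dvd 1 \<and> eq_upto_deg n (aut_defect \<iota> n H a) 0}"

text \<open>The coordinate ring is the quotient of \<open>k[a\<^sub>1,a\<^sub>1\<inverse>,a\<^sub>2,\<dots>,a\<^sub>n]\<close> by the condition of being an
  automorphism of \<open>H\<^bsup>(n)\<^esup>\<close>. Here \<open>a\<^sub>i\<close> is \<open>mvar i\<close>, and \<open>mvar 0\<close> is the inverse of \<open>a\<^sub>1\<close>.\<close>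
definition aut_relations :: "nat \<Rightarrow> 'k::comm_ring_1 fps fps \<Rightarrow> 'k mpoly set" where
  "aut_relations n H =
     insert (mvar 0 * mvar 1 - 1)
       {Poly_Mapping.lookup (aut_defect mconst n H mvar) m |m. total_deg m \<le> n}"

definition aut_ring :: "nat \<Rightarrow> 'k::comm_ring_1 fps fps \<Rightarrow> ('k mpoly set) ring" where
  "aut_ring n H = presented_ring {0..n} (aut_relations n H)"

definition aut_class :: "nat \<Rightarrow> 'k::comm_ring_1 fps fps \<Rightarrow> 'k mpoly \<Rightarrow> 'k mpoly set" where
  "aut_class n H = presented_class {0..n} (aut_relations n H)"


section \<open>The coordinate ring represents the presheaf\<close>

definition mpoly_eval ::
    "('k::comm_ring_1 \<Rightarrow> 'a::comm_ring_1) \<Rightarrow> (nat \<Rightarrow> 'a) \<Rightarrow> 'k mpoly \<Rightarrow> 'a" where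
  "mpoly_eval \<iota> x p = (\<Sum>m\<in>Poly_Mapping.keys p.
     \<iota> (Poly_Mapping.lookup p m) * (\<Prod>i\<in>Poly_Mapping.keys m. x i ^ Poly_Mapping.lookup m i))"

abbreviation is_type_hom :: "('a::comm_ring_1 \<Rightarrow> 'b::comm_ring_1) \<Rightarrow> bool" where
  "is_type_hom \<iota> \<equiv> \<iota> \<in> Ring.ring_hom ring_of_type_algebra ring_of_type_algebra"

lemma type_homD:
  assumes "is_type_hom \<iota>"
  shows "\<iota> (x + y) = \<iota> x + \<iota> y" "\<iota> (x * y) = \<iota> x * \<iota> y" "\<iota> 1 = 1" "\<iota> 0 = 0"
    "\<iota> (- x) = - \<iota> x" "\<iota> (x - y) = \<iota> x - \<iota> y"
proof -
  show add: "\<iota> (x + y) = \<iota> x + \<iota> y" for x y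
    using ring_hom_add[OF assms, of x y] by (simp add: ring_of_type_algebra_def)
  show "\<iota> (x * y) = \<iota> x * \<iota> y"
    using ring_hom_mult[OF assms, of x y] by (simp add: ring_of_type_algebra_def)
  show "\<iota> 1 = 1"
    using ring_hom_one[OF assms] by (simp add: ring_of_type_algebra_def)
  show zero: "\<iota> 0 = 0" using add[of 0 0] by simp
  show neg: "\<iota> (- x) = - \<iota> x" for x
    using add[of x "- x"] zero by (simp add: add_eq_0_iff)
  show "\<iota> (x - y) = \<iota> x - \<iota> y" using add[of x "- y"] neg[of y] by simp
qed

lemma type_homI:
  assumes "\<And>x y. \<iota> (x + y) = \<iota> x + \<iota> y" "\<And>x y. \<iota> (x * y) = \<iota> x * \<iota> y" "\<iota> 1 = 1"
  shows "is_type_hom \<iota>"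
  using assms by (auto intro!: ring_hom_memI simp: ring_of_type_algebra_def)

lemma type_hom_sum:
  assumes "is_type_hom \<iota>" shows "\<iota> (sum f A) = (\<Sum>i\<in>A. \<iota> (f i))"
  by (induction A rule: infinite_finite_induct) (auto simp: type_homD[OF assms])

lemma type_hom_power:
  assumes "is_type_hom \<iota>" shows "\<iota> (x ^ n) = \<iota> x ^ n"
  by (induction n) (auto simp: type_homD[OF assms])

lemma monom_eval_add:
  fixes x :: "nat \<Rightarrow> 'a::comm_ring_1"
  shows "(\<Prod>i\<in>Poly_Mapping.keys (m + m'). x i ^ Poly_Mapping.lookup (m + m') i) =
    (\<Prod>i\<in>Poly_Mapping.keys m. x i ^ Poly_Mapping.lookup m i) *
    (\<Prod>i\<in>Poly_Mapping.keys m'. x i ^ Poly_Mapping.lookup m' i)"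
proof -
  define K where "K = Poly_Mapping.keys m \<union> Poly_Mapping.keys m'"
  have *: "(\<Prod>i\<in>Poly_Mapping.keys q. x i ^ Poly_Mapping.lookup q i) =
      (\<Prod>i\<in>K. x i ^ Poly_Mapping.lookup q i)" if "Poly_Mapping.keys q \<subseteq> K" for q
    using that by (intro prod.mono_neutral_left) (auto simp: K_def in_keys_iff)
  have "Poly_Mapping.keys (m + m') \<subseteq> K" unfolding K_def by (rule keys_add)
  moreover have "Poly_Mapping.keys m \<subseteq> K" "Poly_Mapping.keys m' \<subseteq> K" by (auto simp: K_def)
  ultimately show ?thesis
    by (simp only: *[of "m + m'"] *[of m] *[of m'])
      (simp only: lookup_add power_add prod.distrib)
qed

lemma mpoly_eval_superset:
  assumes "is_type_hom \<iota>" "finite K" "Poly_Mapping.keys p \<subseteq> K"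
  shows "mpoly_eval \<iota> x p = (\<Sum>m\<in>K.
     \<iota> (Poly_Mapping.lookup p m) * (\<Prod>i\<in>Poly_Mapping.keys m. x i ^ Poly_Mapping.lookup m i))"
  unfolding mpoly_eval_def using assms
  by (intro sum.mono_neutral_left) (auto simp: in_keys_iff type_homD[OF assms(1)])

lemma mpoly_eval_add:
  assumes "is_type_hom \<iota>"
  shows "mpoly_eval \<iota> x (p + q) = mpoly_eval \<iota> x p + mpoly_eval \<iota> x q"
proof -
  define K where "K = Poly_Mapping.keys p \<union> Poly_Mapping.keys q"
  have "Poly_Mapping.keys (p + q) \<subseteq> K" unfolding K_def by (rule keys_add)
  then show ?thesis
    by (simp add: mpoly_eval_superset[OF assms, of K] K_def lookup_add type_homD[OF assms]
        distrib_right sum.distrib)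
qed

lemma mpoly_eval_zero [simp]: "mpoly_eval \<iota> x 0 = 0"
  by (simp add: mpoly_eval_def)

lemma mpoly_eval_sum:
  assumes "is_type_hom \<iota>"
  shows "mpoly_eval \<iota> x (sum f A) = (\<Sum>i\<in>A. mpoly_eval \<iota> x (f i))"
  by (induction A rule: infinite_finite_induct) (auto simp: mpoly_eval_add[OF assms])

lemma mpoly_eval_single:
  assumes "is_type_hom \<iota>"
  shows "mpoly_eval \<iota> x (Poly_Mapping.single m c) =
    \<iota> c * (\<Prod>i\<in>Poly_Mapping.keys m. x i ^ Poly_Mapping.lookup m i)"
  by (simp add: mpoly_eval_def type_homD[OF assms])

lemma mpoly_as_sum:
  fixes p :: "'a::comm_ring_1 mpoly"
  shows "p = (\<Sum>m\<in>Poly_Mapping.keys p. Poly_Mapping.single m (Poly_Mapping.lookup p m))"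
proof (rule poly_mapping_eqI)
  fix k
  have "(\<Sum>m\<in>Poly_Mapping.keys p. Poly_Mapping.lookup (Poly_Mapping.single m (Poly_Mapping.lookup p m)) k)
      = (\<Sum>m\<in>Poly_Mapping.keys p. if m = k then Poly_Mapping.lookup p k else 0)"
    by (intro sum.cong) (auto simp: lookup_single when_def)
  also have "\<dots> = Poly_Mapping.lookup p k"
    by (simp add: in_keys_iff)
  finally show "Poly_Mapping.lookup p k = Poly_Mapping.lookup
      (\<Sum>m\<in>Poly_Mapping.keys p. Poly_Mapping.single m (Poly_Mapping.lookup p m)) k"
    by (simp add: lookup_sum)
qed

lemma mpoly_eval_mult:
  assumes "is_type_hom \<iota>"
  shows "mpoly_eval \<iota> x (p * q) = mpoly_eval \<iota> x p * mpoly_eval \<iota> x q"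
proof -
  have "p * q = (\<Sum>m\<in>Poly_Mapping.keys p. \<Sum>m'\<in>Poly_Mapping.keys q.
      Poly_Mapping.single (m + m') (Poly_Mapping.lookup p m * Poly_Mapping.lookup q m'))"
    by (subst mpoly_as_sum[of p], subst mpoly_as_sum[of q])
      (simp add: sum_product mult_single)
  then have "mpoly_eval \<iota> x (p * q) = (\<Sum>m\<in>Poly_Mapping.keys p. \<Sum>m'\<in>Poly_Mapping.keys q.
      \<iota> (Poly_Mapping.lookup p m * Poly_Mapping.lookup q m') *
      (\<Prod>i\<in>Poly_Mapping.keys (m + m'). x i ^ Poly_Mapping.lookup (m + m') i))"
    by (simp only: mpoly_eval_sum[OF assms] mpoly_eval_single[OF assms])
  then show ?thesis
    by (simp only: monom_eval_add type_homD[OF assms] mpoly_eval_def sum_product mult_ac)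
qed

lemma mpoly_eval_mconst:
  assumes "is_type_hom \<iota>" shows "mpoly_eval \<iota> x (mconst c) = \<iota> c"
  by (simp add: mconst_def mpoly_eval_single[OF assms])

lemma mpoly_eval_mvar:
  assumes "is_type_hom \<iota>" shows "mpoly_eval \<iota> x (mvar i) = x i"
  by (simp add: mvar_def mpoly_eval_single[OF assms] type_homD[OF assms])

lemma mconst_1: "mconst 1 = 1"
  by (simp add: mconst_def)

lemma mpoly_eval_hom:
  assumes "is_type_hom \<iota>" shows "is_type_hom (mpoly_eval \<iota> x)"
  using assms mpoly_eval_mconst[OF assms, of x 1]
  by (intro type_homI) (auto simp: mpoly_eval_add mpoly_eval_mult mconst_1 type_homD[OF assms])

lemma mconst_hom: "is_type_hom mconst"
  by (intro type_homI) (auto simp: mconst_def single_add mult_single)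

lemma comp_hom:
  assumes "is_type_hom f" "is_type_hom g" shows "is_type_hom (\<lambda>t. g (f t))"
  using assms by (intro type_homI) (auto simp: type_homD)

lemma mpoly_single_eq:
  "(Poly_Mapping.single m c :: 'a::comm_ring_1 mpoly) =
     mconst c * (\<Prod>i\<in>Poly_Mapping.keys m. mvar i ^ Poly_Mapping.lookup m i)"
proof -
  have pow: "(mvar i ^ k :: 'a mpoly) = Poly_Mapping.single (Poly_Mapping.single i k) 1" for i k
    by (induction k) (auto simp: mvar_def mult_single single_add[symmetric])
  have fin: "finite A \<Longrightarrow> (\<Prod>i\<in>A. mvar i ^ e i :: 'a mpoly) =
      Poly_Mapping.single (\<Sum>i\<in>A. Poly_Mapping.single i (e i)) 1" for A e
    by (induction A rule: finite_induct) (auto simp: pow mult_single)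
  have "(\<Sum>i\<in>Poly_Mapping.keys m. Poly_Mapping.single i (Poly_Mapping.lookup m i)) = m"
  proof (rule poly_mapping_eqI)
    fix k
    have "(\<Sum>i\<in>Poly_Mapping.keys m. Poly_Mapping.lookup (Poly_Mapping.single i (Poly_Mapping.lookup m i)) k)
        = (\<Sum>i\<in>Poly_Mapping.keys m. if i = k then Poly_Mapping.lookup m k else 0)"
      by (intro sum.cong) (auto simp: lookup_single when_def)
    also have "\<dots> = Poly_Mapping.lookup m k" by (simp add: in_keys_iff)
    finally show "Poly_Mapping.lookup (\<Sum>i\<in>Poly_Mapping.keys m.
        Poly_Mapping.single i (Poly_Mapping.lookup m i)) k = Poly_Mapping.lookup m k"
      by (simp add: lookup_sum)
  qed
  then show ?thesis by (simp add: fin mconst_def mult_single)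
qed

lemma mpoly_eval_coeff:
  assumes "is_type_hom \<psi>"
  shows "Poly_Mapping.lookup (mpoly_eval (\<lambda>t. mconst (\<psi> t)) mvar P) m =
    \<psi> (Poly_Mapping.lookup P m)"
proof -
  have "mpoly_eval (\<lambda>t. mconst (\<psi> t)) mvar P =
      (\<Sum>m\<in>Poly_Mapping.keys P. Poly_Mapping.single m (\<psi> (Poly_Mapping.lookup P m)))"
    by (simp add: mpoly_eval_def mpoly_single_eq)
  then have "Poly_Mapping.lookup (mpoly_eval (\<lambda>t. mconst (\<psi> t)) mvar P) m =
      (\<Sum>m'\<in>Poly_Mapping.keys P. if m' = m then \<psi> (Poly_Mapping.lookup P m) else 0)"
    by (simp only: lookup_sum) (intro sum.cong, auto simp: lookup_single when_def)
  then show ?thesis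
    by (simp add: in_keys_iff type_homD[OF assms])
qed

lemma aut_defect_hom:
  assumes "is_type_hom \<psi>"
  shows "Poly_Mapping.lookup (aut_defect (\<lambda>t. \<psi> (\<iota> t)) n H (\<lambda>i. \<psi> (a i))) m =
    \<psi> (Poly_Mapping.lookup (aut_defect \<iota> n H a) m)"
proof -
  define E where "E = mpoly_eval (\<lambda>t. mconst (\<psi> t)) mvar"
  have h: "is_type_hom (\<lambda>t. mconst (\<psi> t))"
    using comp_hom[OF assms mconst_hom] .
  have E: "is_type_hom E" unfolding E_def by (rule mpoly_eval_hom[OF h])
  have Ec: "E (mconst c) = mconst (\<psi> c)" for c
    unfolding E_def by (rule mpoly_eval_mconst[OF h])
  have Ev: "E (mvar i) = mvar i" for i
    unfolding E_def by (rule mpoly_eval_mvar[OF h])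
  have "E (aut_defect \<iota> n H a) = aut_defect (\<lambda>t. \<psi> (\<iota> t)) n H (\<lambda>i. \<psi> (a i))"
    by (simp add: aut_defect_def Let_def curve_subst_def trunc_subst_def type_homD[OF E]
        type_hom_sum[OF E] type_hom_power[OF E] Ec Ev)
  then show ?thesis
    using mpoly_eval_coeff[OF assms, of "aut_defect \<iota> n H a" m] by (simp add: E_def)
qed


lemma mvars_add: "mvars (p + q) \<subseteq> mvars p \<union> mvars q"
  using keys_add[of p q] by (auto simp: mvars_def)

lemma mvars_mult: "mvars (p * q) \<subseteq> mvars p \<union> mvars q"
proof -
  have "Poly_Mapping.keys m \<subseteq> mvars p \<union> mvars q" if "m \<in> Poly_Mapping.keys (p * q)" for m
  proof -
    have "m \<in> {a + b |a b. a \<in> Poly_Mapping.keys p \<and> b \<in> Poly_Mapping.keys q}"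
      using that keys_mult[of p q] by (rule rev_subsetD)
    then obtain a b where "m = a + b" "a \<in> Poly_Mapping.keys p" "b \<in> Poly_Mapping.keys q"
      by fast
    then show ?thesis using keys_add[of a b] by (auto simp: mvars_def)
  qed
  then show ?thesis by (auto simp: mvars_def)
qed

lemma mvars_uminus [simp]: "mvars (- p) = mvars p"
  by (simp add: mvars_def in_keys_iff set_eq_iff)

lemma mvars_mconst [simp]: "mvars (mconst c) = {}"
  by (simp add: mvars_def mconst_def)

lemma mvars_0 [simp]: "mvars 0 = {}" and mvars_1 [simp]: "mvars 1 = {}"
  by (simp_all add: mvars_def)

lemma mvars_mvar: "mvars (mvar i) \<subseteq> {i}"
  by (simp add: mvars_def mvar_def)

lemma mpoly_ring_simps [simp]:
  "carrier (mpoly_ring V) = {p. mvars p \<subseteq> V}"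
  "p \<otimes>\<^bsub>mpoly_ring V\<^esub> q = p * q" "p \<oplus>\<^bsub>mpoly_ring V\<^esub> q = p + q"
  "\<one>\<^bsub>mpoly_ring V\<^esub> = 1" "\<zero>\<^bsub>mpoly_ring V\<^esub> = 0"
  by (simp_all add: mpoly_ring_def ring_of_type_algebra_def)

lemma mpoly_ring_cring: "cring (mpoly_ring V)"
proof (rule cringI)
  show "abelian_group (mpoly_ring V)"
  proof (rule abelian_groupI)
    fix p assume "p \<in> carrier (mpoly_ring V)"
    then show "\<exists>y\<in>carrier (mpoly_ring V). y \<oplus>\<^bsub>mpoly_ring V\<^esub> p = \<zero>\<^bsub>mpoly_ring V\<^esub>"
      by (intro bexI[of _ "- p"]) auto
  qed (use mvars_add in \<open>fastforce simp: ac_simps\<close>)+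
  show "comm_monoid (mpoly_ring V)"
    by (rule comm_monoidI) (use mvars_mult in \<open>fastforce simp: ac_simps\<close>)+
qed (simp add: algebra_simps)

lemma aut_relations_carrier:
  assumes "n \<ge> 1" shows "aut_relations n H \<subseteq> carrier (mpoly_ring {0..n})"
proof -
  define V where "V = {0..n}"
  define good :: "'a mpoly mpoly \<Rightarrow> bool"
    where "good P \<longleftrightarrow> (\<forall>m. mvars (Poly_Mapping.lookup P m) \<subseteq> V)" for P
  have add: "good (P + Q)" if "good P" "good Q" for P Q
    using that mvars_add unfolding good_def lookup_add by fast
  have neg: "good (- P)" if "good P" for P
    using that unfolding good_def by simp
  have diff: "good (P - Q)" if "good P" "good Q" for P Q
    using add[OF that(1) neg[OF that(2)]] by simp
  have good_single: "good (Poly_Mapping.single m c)" if "mvars c \<subseteq> V" for m c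
    using that by (auto simp: good_def lookup_single when_def)
  have sum_mon: "good (sum f A)" if "\<And>i. i \<in> A \<Longrightarrow> good (f i)" for f :: "(nat \<Rightarrow>\<^sub>0 nat) \<Rightarrow> _" and A
    using that
    by (induction A rule: infinite_finite_induct) (auto intro: add simp: good_def[of 0])
  have sum_nat: "good (sum f A)" if "\<And>i. i \<in> A \<Longrightarrow> good (f i)" for f :: "nat \<Rightarrow> _" and A
    using that
    by (induction A rule: infinite_finite_induct) (auto intro: add simp: good_def[of 0])
  have mult: "good (P * Q)" if "good P" "good Q" for P Q
  proof -
    have "P * Q = (\<Sum>m\<in>Poly_Mapping.keys P. \<Sum>m'\<in>Poly_Mapping.keys Q.
        Poly_Mapping.single (m + m') (Poly_Mapping.lookup P m * Poly_Mapping.lookup Q m'))"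
      by (subst mpoly_as_sum[of P], subst mpoly_as_sum[of Q]) (simp add: sum_product mult_single)
    moreover have "mvars (Poly_Mapping.lookup P m * Poly_Mapping.lookup Q m') \<subseteq> V" for m m'
      using that mvars_mult unfolding good_def by fast
    ultimately show ?thesis by (auto intro!: sum_mon good_single)
  qed
  have one: "good 1" by (metis good_single mvars_1 empty_subsetI single_one)
  have pow: "good (P ^ k)" if "good P" for P k
    using that by (induction k) (auto intro: mult one)
  have const: "good (mconst c)" if "mvars c \<subseteq> V" for c
    using that by (simp add: mconst_def good_single)
  have T: "good (mvar i)" for i
    by (simp add: mvar_def good_single)
  have v: "mvars (mvar i :: 'a mpoly) \<subseteq> V" if "i \<le> n" for i
    using mvars_mvar[of i] that by (auto simp: V_def)
  have H: "good (trunc_subst (\<lambda>t. mconst (mconst t)) n H P Q)" if "good P" "good Q" for P Q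
    unfolding trunc_subst_def using that by (intro sum_nat mult pow const) auto
  have f: "good (curve_subst n mvar P)" if "good P" for P
    unfolding curve_subst_def using that by (intro sum_nat mult pow const v) auto
  have "good (aut_defect mconst n H mvar)"
    unfolding aut_defect_def Let_def by (intro diff H f T)
  then have coeffs: "mvars (Poly_Mapping.lookup (aut_defect mconst n H mvar) m) \<subseteq> V" for m
    by (simp add: good_def)
  have "mvars (mvar 0 * mvar 1 + - 1 :: 'a mpoly) \<subseteq> V"
    using mvars_add[of "mvar 0 * mvar 1" "- 1 :: 'a mpoly"]
      mvars_mult[of "mvar 0" "mvar 1 :: 'a mpoly"] v[of 0] v[of 1] assms by auto
  then show ?thesis
    using coeffs by (auto simp: aut_relations_def V_def)
qed

lemma presented_ring_universal:
  fixes \<iota> :: "'k::comm_ring_1 \<Rightarrow> 'a::comm_ring_1"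
  assumes \<iota>: "is_type_hom \<iota>" and G: "G \<subseteq> carrier (mpoly_ring V)"
  shows "bij_betw (\<lambda>\<psi>. \<lambda>i\<in>V. \<psi> (presented_class V G (mvar i)))
    {\<psi> \<in> Ring.ring_hom (presented_ring V G) ring_of_type_algebra.
       \<psi> \<in> extensional (carrier (presented_ring V G)) \<and>
       (\<forall>t. \<psi> (presented_class V G (mconst t)) = \<iota> t)}
    {x \<in> extensional V. \<forall>g\<in>G. mpoly_eval \<iota> x g = 0}"
proof -
  define R where "R = (mpoly_ring V :: 'k mpoly ring)"
  define J where "J = genideal R G"
  define Q where "Q = presented_ring V G"
  define cl where "cl = presented_class V G"
  have carR: "p \<in> carrier R \<longleftrightarrow> mvars p \<subseteq> V" for p by (simp add: R_def)
  have Rs: "p \<otimes>\<^bsub>R\<^esub> q = p * q" "p \<oplus>\<^bsub>R\<^esub> q = p + q" "\<one>\<^bsub>R\<^esub> = 1" "\<zero>\<^bsub>R\<^esub> = 0" for p q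
    by (simp_all add: R_def)
  interpret R: cring R unfolding R_def by (rule mpoly_ring_cring)
  have J: "ideal J R" unfolding J_def using G by (intro R.genideal_ideal) (simp add: R_def)
  interpret J: ideal J R by (rule J)
  have cl: "cl p = J +>\<^bsub>R\<^esub> p" for p by (simp add: cl_def presented_class_def J_def R_def)
  have Q: "Q = R Quot J" by (simp add: Q_def presented_ring_def J_def R_def)
  have carQ: "carrier Q = cl ` carrier R"
    by (auto simp: Q FactRing_def A_RCOSETS_def' cl)
  have cl_mult: "cl p \<otimes>\<^bsub>Q\<^esub> cl q = cl (p * q)" if "p \<in> carrier R" "q \<in> carrier R" for p q
    using J.rcoset_mult_add[OF that] by (simp add: Q FactRing_def cl Rs)
  have cl_add: "cl p \<oplus>\<^bsub>Q\<^esub> cl q = cl (p + q)" if "p \<in> carrier R" "q \<in> carrier R" for p q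
    using J.a_rcos_sum[OF that] by (simp add: Q FactRing_def cl Rs)
  have cl_one: "\<one>\<^bsub>Q\<^esub> = cl 1" by (simp add: Q FactRing_def cl Rs)
  have cl_J: "cl p = cl 0" if "p \<in> J" for p
    using J.a_rcos_const[OF that] J.a_rcos_const[of 0] J.zero_closed by (simp add: cl Rs)
  have sub: "x \<in> carrier R \<Longrightarrow> y \<in> carrier R \<Longrightarrow> x * y \<in> carrier R \<and> x + y \<in> carrier R" for x y
    using R.m_closed[of x y] R.a_closed[of x y] by (simp add: Rs)
  have c_in: "mconst t \<in> carrier R" for t by (simp add: carR)
  have v_in: "mvar i \<in> carrier R" if "i \<in> V" for i using mvars_mvar[of i] that by (auto simp: carR)
  have zero_in: "0 \<in> carrier R" and one_in: "1 \<in> carrier R" by (simp_all add: carR)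

  let ?S = "{\<psi> \<in> Ring.ring_hom Q ring_of_type_algebra. \<psi> \<in> extensional (carrier Q) \<and>
       (\<forall>t. \<psi> (cl (mconst t)) = \<iota> t)}"
  let ?T = "{x \<in> extensional V. \<forall>g\<in>G. mpoly_eval \<iota> x g = 0}"
  let ?F = "\<lambda>\<psi>. \<lambda>i\<in>V. \<psi> (cl (mvar i))"

  have eval_cl: "\<psi> (cl p) = mpoly_eval \<iota> (?F \<psi>) p" if \<psi>: "\<psi> \<in> ?S" and p: "p \<in> carrier R" for \<psi> p
  proof -
    define \<theta> where "\<theta> p = \<psi> (cl p)" for p
    have hom: "\<psi> \<in> Ring.ring_hom Q ring_of_type_algebra" using \<psi> by simp
    have cq: "q \<in> carrier R \<Longrightarrow> cl q \<in> carrier Q" for q using carQ by simp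
    have t_add: "\<theta> (a + b) = \<theta> a + \<theta> b" and t_mult: "\<theta> (a * b) = \<theta> a * \<theta> b"
      if "a \<in> carrier R" "b \<in> carrier R" for a b
      using ring_hom_add[OF hom cq[OF that(1)] cq[OF that(2)]]
        ring_hom_mult[OF hom cq[OF that(1)] cq[OF that(2)]]
      by (simp_all add: \<theta>_def cl_add[OF that] cl_mult[OF that] ring_of_type_algebra_def)
    have t_one: "\<theta> 1 = 1"
      using ring_hom_one[OF hom] by (simp add: \<theta>_def cl_one ring_of_type_algebra_def)
    have t_zero: "\<theta> 0 = 0" using t_add[OF zero_in zero_in] by simp
    have t_pow: "a ^ k \<in> carrier R \<and> \<theta> (a ^ k) = \<theta> a ^ k" if "a \<in> carrier R" for a k
      using that by (induction k) (auto simp: t_one t_mult sub one_in)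
    have t_prod: "(\<Prod>i\<in>A. f i) \<in> carrier R \<and> \<theta> (\<Prod>i\<in>A. f i) = (\<Prod>i\<in>A. \<theta> (f i))"
      if "\<And>i. i \<in> A \<Longrightarrow> f i \<in> carrier R" for A and f :: "nat \<Rightarrow> _"
      using that by (induction A rule: infinite_finite_induct) (auto simp: t_one t_mult sub one_in)
    have t_sum: "(\<Sum>i\<in>A. f i) \<in> carrier R \<and> \<theta> (\<Sum>i\<in>A. f i) = (\<Sum>i\<in>A. \<theta> (f i))"
      if "\<And>i. i \<in> A \<Longrightarrow> f i \<in> carrier R" for A and f :: "(nat \<Rightarrow>\<^sub>0 nat) \<Rightarrow> _"
      using that by (induction A rule: infinite_finite_induct) (auto simp: t_zero t_add sub zero_in)
    have mon: "Poly_Mapping.single m c \<in> carrier R \<and> \<theta> (Poly_Mapping.single m c) =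
        \<iota> c * (\<Prod>i\<in>Poly_Mapping.keys m. (?F \<psi>) i ^ Poly_Mapping.lookup m i)"
      if m: "Poly_Mapping.keys m \<subseteq> V" for m c
    proof -
      have 1: "mvar i ^ Poly_Mapping.lookup m i \<in> carrier R \<and>
          \<theta> (mvar i ^ Poly_Mapping.lookup m i) = (?F \<psi>) i ^ Poly_Mapping.lookup m i"
        if "i \<in> Poly_Mapping.keys m" for i
        using t_pow[OF v_in, of i "Poly_Mapping.lookup m i"] that m by (auto simp: \<theta>_def)
      have 2: "(\<Prod>i\<in>Poly_Mapping.keys m. mvar i ^ Poly_Mapping.lookup m i) \<in> carrier R \<and>
          \<theta> (\<Prod>i\<in>Poly_Mapping.keys m. mvar i ^ Poly_Mapping.lookup m i) =
          (\<Prod>i\<in>Poly_Mapping.keys m. (?F \<psi>) i ^ Poly_Mapping.lookup m i)"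
        using t_prod[of "Poly_Mapping.keys m" "\<lambda>i. mvar i ^ Poly_Mapping.lookup m i"] 1
        by (simp cong: prod.cong)
      have "\<theta> (mconst c) = \<iota> c" using \<psi> by (simp add: \<theta>_def)
      then show ?thesis
        unfolding mpoly_single_eq using 2 t_mult[OF c_in[of c] conjunct1[OF 2]] sub[OF c_in[of c] conjunct1[OF 2]]
        by simp
    qed
    have keysV: "m \<in> Poly_Mapping.keys p \<Longrightarrow> Poly_Mapping.keys m \<subseteq> V" for m
      using p by (auto simp: carR mvars_def)
    have "\<theta> p = \<theta> (\<Sum>m\<in>Poly_Mapping.keys p. Poly_Mapping.single m (Poly_Mapping.lookup p m))"
      using mpoly_as_sum[of p] by simp
    also have "\<dots> = (\<Sum>m\<in>Poly_Mapping.keys p. \<theta> (Poly_Mapping.single m (Poly_Mapping.lookup p m)))"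
      using t_sum[of "Poly_Mapping.keys p" "\<lambda>m. Poly_Mapping.single m (Poly_Mapping.lookup p m)"]
        mon keysV by blast
    also have "\<dots> = mpoly_eval \<iota> (?F \<psi>) p"
      unfolding mpoly_eval_def using mon keysV by (intro sum.cong) blast+
    finally show ?thesis by (simp add: \<theta>_def)
  qed

  have "bij_betw ?F ?S ?T"
    unfolding bij_betw_def
  proof (intro conjI inj_onI equalityI subsetI)
    fix \<psi> \<psi>' assume *: "\<psi> \<in> ?S" "\<psi>' \<in> ?S" "?F \<psi> = ?F \<psi>'"
    have "\<psi> (cl p) = \<psi>' (cl p)" if "p \<in> carrier R" for p
      using eval_cl[OF *(1) that] eval_cl[OF *(2) that] *(3) by simp
    then have "\<psi> A = \<psi>' A" if "A \<in> carrier Q" for A using that carQ by auto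
    moreover have "\<psi> \<in> extensional (carrier Q)" "\<psi>' \<in> extensional (carrier Q)" using * by auto
    ultimately show "\<psi> = \<psi>'" by (intro extensionalityI)
  next
    fix x assume "x \<in> ?F ` ?S"
    then obtain \<psi> where \<psi>: "\<psi> \<in> ?S" and x: "x = ?F \<psi>" by blast
    have "mpoly_eval \<iota> x g = 0" if "g \<in> G" for g
    proof -
      have gR: "g \<in> carrier R" using G that by (auto simp: R_def)
      have gJ: "g \<in> J" unfolding J_def using R.genideal_self[of G] G that by (auto simp: R_def)
      have "mpoly_eval \<iota> x g = mpoly_eval \<iota> x 0"
        using eval_cl[OF \<psi> gR] eval_cl[OF \<psi> zero_in] cl_J[OF gJ] x by simp
      then show ?thesis by simp
    qed
    then show "x \<in> ?T" using x by auto
  next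
    fix x assume x: "x \<in> ?T"
    define E where "E = mpoly_eval \<iota> x"
    have E: "is_type_hom E" unfolding E_def by (rule mpoly_eval_hom[OF \<iota>])
    have "ideal {p \<in> carrier R. E p = 0} R"
    proof (rule idealI)
      show "subgroup {p \<in> carrier R. E p = 0} (add_monoid R)"
      proof
        fix p assume p: "p \<in> {p \<in> carrier R. E p = 0}"
        have "a_inv R p = - p"
          using p by (intro R.minus_equality) (auto simp: Rs carR)
        then show "inv\<^bsub>add_monoid R\<^esub> p \<in> {p \<in> carrier R. E p = 0}"
          using p by (simp add: a_inv_def carR type_homD[OF E])
      next
        fix p q assume "p \<in> {p \<in> carrier R. E p = 0}" "q \<in> {p \<in> carrier R. E p = 0}"
        then show "p \<otimes>\<^bsub>add_monoid R\<^esub> q \<in> {p \<in> carrier R. E p = 0}"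
          using sub[of p q] by (simp add: Rs type_homD[OF E])
      qed (simp_all add: Rs type_homD[OF E] carR subset_eq)
    qed (auto simp: Rs type_homD[OF E] sub R.ring_axioms)
    then have JE: "J \<subseteq> {p \<in> carrier R. E p = 0}"
      unfolding J_def using G x by (intro R.genideal_minimal) (auto simp: R_def E_def)
    define \<psi> where "\<psi> = (\<lambda>A\<in>carrier Q. the_elem (E ` A))"
    have \<psi>_cl: "\<psi> (cl p) = E p" if "p \<in> carrier R" for p
    proof -
      have "E y = E p" if "y \<in> cl p" for y
        using that JE by (auto simp: cl a_r_coset_def' Rs type_homD[OF E])
      moreover have "p \<in> cl p"
        using J.a_rcos_self[OF that] by (simp add: cl)
      ultimately have "E ` cl p = {E p}" by blast
      then show ?thesis using that by (simp add: \<psi>_def carQ)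
    qed
    have "\<psi> \<in> Ring.ring_hom Q ring_of_type_algebra"
    proof (rule ring_hom_memI)
      fix A B assume "A \<in> carrier Q" "B \<in> carrier Q"
      then obtain p q where *: "A = cl p" "B = cl q" "p \<in> carrier R" "q \<in> carrier R"
        using carQ by auto
      then show "\<psi> (A \<otimes>\<^bsub>Q\<^esub> B) = \<psi> A \<otimes>\<^bsub>ring_of_type_algebra\<^esub> \<psi> B"
          "\<psi> (A \<oplus>\<^bsub>Q\<^esub> B) = \<psi> A \<oplus>\<^bsub>ring_of_type_algebra\<^esub> \<psi> B"
        using sub[of p q]
        by (simp_all add: cl_mult cl_add \<psi>_cl type_homD[OF E] ring_of_type_algebra_def)
    qed (simp_all add: cl_one \<psi>_cl[OF one_in] type_homD[OF E] ring_of_type_algebra_def)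
    moreover have "\<psi> (cl (mconst t)) = \<iota> t" for t
      using \<psi>_cl[OF c_in] by (simp add: E_def mpoly_eval_mconst[OF \<iota>])
    ultimately have "\<psi> \<in> ?S" by (simp add: \<psi>_def)
    moreover have "?F \<psi> = x"
      using x \<psi>_cl[OF v_in] by (intro extensionalityI[of _ V]) (auto simp: E_def mpoly_eval_mvar[OF \<iota>])
    ultimately show "x \<in> ?F ` ?S" by blast
  qed
  then show ?thesis by (simp add: Q_def cl_def)
qed

text \<open>Points with values in a \<open>k\<close>-algebra correspond to \<open>k\<close>-algebra homomorphisms out of the
  coordinate ring.\<close>
lemma aut_ring_represents:
  fixes \<iota> :: "'k::comm_ring_1 \<Rightarrow> 'a::comm_ring_1"
  assumes \<iota>: "is_type_hom \<iota>" and n: "n \<ge> 1"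
  shows "bij_betw (\<lambda>\<psi> i. if i \<in> {1..n} then \<psi> (aut_class n H (mvar i)) else 0)
    {\<psi> \<in> Ring.ring_hom (aut_ring n H) ring_of_type_algebra.
       \<psi> \<in> extensional (carrier (aut_ring n H)) \<and>
       (\<forall>t. \<psi> (aut_class n H (mconst t)) = \<iota> t)}
    (aut_points \<iota> n H)"
proof -
  let ?T = "{x \<in> extensional {0..n}. \<forall>g\<in>aut_relations n H. mpoly_eval \<iota> x g = 0}"
  let ?G = "\<lambda>x i. if i \<in> {1..n} then x i else (0::'a)"
  have T: "x \<in> ?T \<longleftrightarrow> x \<in> extensional {0..n} \<and> x 0 * x 1 = 1 \<and>
      eq_upto_deg n (aut_defect \<iota> n H (?G x)) 0" for x
  proof -
    have E: "is_type_hom (mpoly_eval \<iota> x)" by (rule mpoly_eval_hom[OF \<iota>])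
    have "aut_defect (\<lambda>t. mpoly_eval \<iota> x (mconst t)) n H (\<lambda>i. mpoly_eval \<iota> x (mvar i))
        = aut_defect \<iota> n H (?G x)"
      by (simp add: aut_defect_def curve_subst_def Let_def mpoly_eval_mconst[OF \<iota>] mpoly_eval_mvar[OF \<iota>])
    then have "mpoly_eval \<iota> x (Poly_Mapping.lookup (aut_defect mconst n H mvar) m) =
        Poly_Mapping.lookup (aut_defect \<iota> n H (?G x)) m" for m
      using aut_defect_hom[OF E, of mconst n H mvar m] by simp
    then show ?thesis
      by (auto simp: aut_relations_def eq_upto_deg_def type_homD[OF E] mpoly_eval_mvar[OF \<iota>])
  qed
  have "bij_betw ?G ?T (aut_points \<iota> n H)"
    unfolding bij_betw_def
  proof (intro conjI inj_onI equalityI subsetI)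
    fix x y assume *: "x \<in> ?T" "y \<in> ?T" "?G x = ?G y"
    have 1: "x i = y i" if "i \<in> {1..n}" for i using fun_cong[OF *(3), of i] that by simp
    then have "x 0 * x 1 = 1" "y 0 * x 1 = 1" using * n T by auto
    then have "x 0 = y 0" by (metis mult.assoc mult.commute mult_1)
    then have "x i = y i" if "i \<in> {0..n}" for i using 1[of i] that by (cases "i = 0") auto
    then show "x = y"
      using * by (intro extensionalityI[of x "{0..n}" y]) auto
  next
    fix a assume "a \<in> ?G ` ?T"
    then obtain x where x: "x \<in> ?T" "a = ?G x" by blast
    have "x 1 dvd 1" using T[of x] x by (metis dvd_triv_right)
    then show "a \<in> aut_points \<iota> n H"
      using x T[of x] n by (auto simp: aut_points_def)
  next
    fix a assume a: "a \<in> aut_points \<iota> n H"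
    then obtain b where b: "1 = a 1 * b" by (auto simp: aut_points_def elim: dvdE)
    define x where "x = (\<lambda>i\<in>{0..n}. if i = 0 then b else a i)"
    have Gx: "?G x = a" using a by (auto simp: x_def aut_points_def fun_eq_iff)
    have "x \<in> ?T"
      unfolding T Gx using a b n by (auto simp: x_def aut_points_def mult.commute)
    then show "a \<in> ?G ` ?T" using Gx by blast
  qed
  from bij_betw_trans[OF presented_ring_universal[OF \<iota> aut_relations_carrier[OF n, of H]] this]
  have "bij_betw (?G \<circ> (\<lambda>\<psi>. \<lambda>i\<in>{0..n}. \<psi> (aut_class n H (mvar i))))
    {\<psi> \<in> Ring.ring_hom (aut_ring n H) ring_of_type_algebra.
       \<psi> \<in> extensional (carrier (aut_ring n H)) \<and>
       (\<forall>t. \<psi> (aut_class n H (mconst t)) = \<iota> t)} (aut_points \<iota> n H)"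
    unfolding aut_ring_def aut_class_def .
  moreover have "?G \<circ> (\<lambda>\<psi>. \<lambda>i\<in>{0..n}. \<psi> (aut_class n H (mvar i))) =
      (\<lambda>\<psi> i. if i \<in> {1..n} then \<psi> (aut_class n H (mvar i)) else 0)"
    by (auto simp: fun_eq_iff)
  ultimately show ?thesis by (simp only:)
qed

end

theory Submission
  imports Defs
begin

text \<open>Write \<open>q = p\<^sup>h\<close>. Over any \<open>\<F>\<^sub>p\<close>-algebra, if \<open>f\<close> respects \<open>H\<close> modulo degree \<open>d\<close>, then the degree
  \<open>d\<close> part of \<open>f(H(X,Y)) - H(f(X),f(Y))\<close> is a symmetric 2-cocycle. If \<open>d\<close> is not a power of \<open>p\<close>,
  such a cocycle vanishes as soon as one well-chosen coefficient does, and this coefficient is a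
  nonzero multiple of \<open>a\<^sub>d\<close> plus a polynomial in \<open>a\<^sub>1, \<dots>, a\<^bsub>d-1\<^esub>\<close>. If \<open>d > 1\<close> is a power of \<open>p\<close>, the
  cocycle is detected by the degree \<open>d\<close> coefficient of \<open>f([p](T)) - [p](f(T))\<close>, which for
  \<open>[p](T) = T\<^sup>q\<close> is \<open>a\<^sub>i - a\<^sub>i\<^sup>q\<close> when \<open>d = q i\<close>, and zero when \<open>q\<close> does not divide \<open>d\<close>. Hence the
  ideal of the automorphism scheme is generated by \<open>a\<^sub>1\<inverse> a\<^sub>1 - 1\<close>, one equation for each \<open>d \<le> n\<close> that
  is not a power of \<open>p\<close>, and \<open>a\<^sub>i\<^sup>q - a\<^sub>i\<close> for the powers \<open>i\<close> of \<open>p\<close> with \<open>q i \<le> n\<close>. The \<open>h\<close> largest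
  powers of \<open>p\<close> up to \<open>n\<close> index free variables, and the Jacobian matrix in the other variables is
  triangular with units on the diagonal, since \<open>a\<^sub>i\<^sup>q - a\<^sub>i\<close> has derivative \<open>-1\<close>.\<close>

section \<open>Binomial coefficients and power sums modulo a prime\<close>

text \<open>Points with values in fields do not see nilpotents, so the exact ideal is needed.
  Therefore "\<open>f\<close> respects \<open>H\<close> modulo degree \<open>d\<close>" is read
  modulo an ideal \<open>J\<close>: the defect coefficients in degrees below \<open>d\<close> lie in
  \<open>J\<close>. With \<open>J\<close> generated by the chosen equations, induction on
  \<open>d\<close> puts every relation into \<open>J\<close>; with \<open>J\<close> the ideal of all
  relations, the same computation returns the Frobenius equations. The obstacle is a degree
  \<open>d = p^(k+1)\<close>: there \<open>(X+Y)^d - X^d - Y^d\<close> is zero, so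
  \<open>a_d\<close> drops out of the degree \<open>d\<close> part and no equation can be solved for
  it. The remedy is that, in leading degree, \<open>f([p](T)) - [p](f(T))\<close> telescopes into
  the sum of the defects at \<open>(i T, T)\<close> for \<open>i < p\<close>. If \<open>c_s\<close>
  is the coefficient of \<open>X^s Y^(d-s)\<close>, this sum has coefficient
  \<open>sum_s c_s (sum_i i^s)\<close>, and power sums over the prime field single out the one
  exponent \<open>s = d - p^k\<close>. The cocycle identity lives in polynomials in three variables,
  the telescoping in power series in one; an abstract filtered ring serves both.\<close>

lemma prime_dvd_choose_prime_power:
  fixes p :: nat
  assumes "prime p" "0 < k" "k < p ^ a"
  shows "p dvd (p ^ a choose k)"
proof (rule ccontr)
  assume "\<not> p dvd (p ^ a choose k)"
  then have "coprime (p ^ a) (p ^ a choose k)"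
    using assms(1) by (simp add: prime_imp_coprime)
  moreover have "k * (p ^ a choose k) = p ^ a * ((p ^ a - 1) choose (k - 1))"
    using assms binomial_absorption[of "k - 1" "p ^ a"] by simp
  ultimately have "p ^ a dvd k"
    by (metis coprime_dvd_mult_left_iff dvd_triv_left)
  then show False using assms by (simp add: nat_dvd_not_less)
qed

text \<open>A case of Lucas' theorem, by subtracting \<open>p ^ a\<close> from \<open>s\<close>: in
  Vandermonde's sum only the two end terms survive modulo \<open>p\<close>, so each subtraction
  lowers the residue by one.\<close>

lemma choose_prime_power_mod:
  fixes p :: nat
  assumes "prime p"
  shows "(s choose p ^ a) mod p = (s div p ^ a) mod p"
proof (induction s rule: less_induct)
  case (less s)
  show ?case
  proof (cases "s < p ^ a")
    case True
    then show ?thesis by (simp add: binomial_eq_0)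
  next
    case False
    define t where "t = s - p ^ a"
    have pos: "0 < p ^ a" using assms prime_gt_0_nat by simp
    have s: "s = p ^ a + t" using False by (simp add: t_def)
    have "(s choose p ^ a) = (\<Sum>k\<le>p ^ a. (p ^ a choose k) * (t choose (p ^ a - k)))"
      unfolding s using vandermonde[of "p ^ a" t "p ^ a"] by simp
    also have "\<dots> = (\<Sum>k\<in>{0, p ^ a} \<union> {0<..<p ^ a}. (p ^ a choose k) * (t choose (p ^ a - k)))"
      using pos by (intro sum.cong) auto
    also have "\<dots> = (t choose p ^ a) + 1 +
        (\<Sum>k\<in>{0<..<p ^ a}. (p ^ a choose k) * (t choose (p ^ a - k)))"
      using pos by (subst sum.union_disjoint) auto
    finally have "(s choose p ^ a) mod p = ((t choose p ^ a) + 1 +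
        (\<Sum>k\<in>{0<..<p ^ a}. (p ^ a choose k) * (t choose (p ^ a - k)))) mod p" by simp
    moreover have "p dvd (\<Sum>k\<in>{0<..<p ^ a}. (p ^ a choose k) * (t choose (p ^ a - k)))"
      by (intro dvd_sum dvd_mult2 prime_dvd_choose_prime_power assms) auto
    ultimately have "(s choose p ^ a) mod p = ((t choose p ^ a) + 1) mod p"
      by auto
    also have "\<dots> = (t div p ^ a + 1) mod p"
      using less[of t] pos s by (metis less_add_same_cancel2 mod_add_left_eq)
    also have "t div p ^ a + 1 = s div p ^ a"
      unfolding s using pos by simp
    finally show ?thesis .
  qed
qed

text \<open>\<open>s div p ^ a\<close> is congruent modulo \<open>p\<close> to the
  base-\<open>p\<close> digit of \<open>s\<close> at place \<open>a\<close>, so this is the test for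
  a zero digit.\<close>

lemma prime_dvd_choose_iff:
  fixes p :: nat
  assumes "prime p"
  shows "p dvd (s choose p ^ a) \<longleftrightarrow> p dvd s div p ^ a"
  using choose_prime_power_mod[OF assms] by (simp add: dvd_eq_mod_eq_0)

lemma ex_nonzero_digit:
  fixes p :: nat
  assumes "prime p" "s > 0"
  shows "\<exists>a. p ^ a \<le> s \<and> \<not> p dvd s div p ^ a"
  using assms(2)
proof (induction s rule: less_induct)
  case (less s)
  show ?case
  proof (cases "p dvd s")
    case False
    then show ?thesis using less.prems by (intro exI[of _ 0]) auto
  next
    case True
    then obtain t where t: "s = p * t" by (elim dvdE)
    have p: "p > 1" using assms(1) prime_gt_1_nat by simp
    have "0 < t" "t < s" using t less.prems p by auto
    then obtain a where "p ^ a \<le> t" "\<not> p dvd t div p ^ a" using less.IH by blast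
    then show ?thesis using t p by (intro exI[of _ "Suc a"]) auto
  qed
qed

text \<open>Multiplication by a nonzero \<open>g\<close> permutes the field, hence scales the sum by
  \<open>g ^ t\<close> without changing it. Some such \<open>g\<close> has
  \<open>g ^ t \<noteq> 1\<close>, because a polynomial of degree \<open>t\<close>, smaller than the
  number of units, cannot vanish on all of them.\<close>

lemma power_sum_mod_ring:
  assumes "0 < t" "t < CARD('p::prime_card) - 1"
  shows "(\<Sum>x\<in>UNIV. (x::'p mod_ring) ^ t) = 0"
proof -
  let ?q = "monom 1 t - 1 :: 'p mod_ring poly"
  have deg: "degree ?q \<le> t" by (intro degree_diff_le) (auto simp: degree_monom_le)
  have "coeff ?q t = 1" using assms by simp
  then have "?q \<noteq> 0" by (metis coeff_0 zero_neq_one)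
  then have "card {x. poly ?q x = 0} \<le> t"
    using card_poly_roots_bound[of ?q] deg by simp
  moreover have "card (UNIV - {0 :: 'p mod_ring}) = CARD('p) - 1"
    by (simp add: card_Diff_subset)
  ultimately have "\<not> UNIV - {0} \<subseteq> {x. poly ?q x = 0}"
    using card_mono[of "{x. poly ?q x = 0}" "UNIV - {0}"] assms by auto
  then obtain g :: "'p mod_ring" where g: "g \<noteq> 0" "g ^ t \<noteq> 1"
    by (auto simp: poly_monom)
  have "(\<Sum>x\<in>UNIV. x ^ t) = (\<Sum>x\<in>UNIV. (g * x) ^ t)"
    by (rule sum.reindex_bij_witness[of _ "\<lambda>x. g * x" "\<lambda>x. x / g"]) (use g in auto)
  also have "\<dots> = g ^ t * (\<Sum>x\<in>UNIV. x ^ t)"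
    by (simp add: power_mult_distrib sum_distrib_left)
  finally have "(g ^ t - 1) * (\<Sum>x\<in>UNIV. x ^ t) = 0" by (simp add: algebra_simps)
  then show ?thesis using g by simp
qed

lemma sum_of_nat_power_mod_ring:
  assumes "t > 0"
  shows "(\<Sum>i=1..<CARD('p::prime_card). of_nat i ^ t) = (\<Sum>x\<in>UNIV. (x::'p mod_ring) ^ t)"
proof -
  have inj: "inj_on (of_nat :: nat \<Rightarrow> 'p mod_ring) {..<CARD('p)}"
  proof (rule inj_onI)
    fix x y assume *: "x \<in> {..<CARD('p)}" "y \<in> {..<CARD('p)}" "of_nat x = (of_nat y :: 'p mod_ring)"
    then have "[x = y] (mod CARD('p))"
      using of_nat_eq_iff_cong_CHAR[of x y, where 'a = "'p mod_ring"] by simp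
    then show "x = y" using * by (simp add: cong_def)
  qed
  have img: "of_nat ` {..<CARD('p)} = (UNIV :: 'p mod_ring set)"
    using surj_of_nat_mod_ring by blast
  have "(\<Sum>x\<in>UNIV. (x::'p mod_ring) ^ t) = (\<Sum>i<CARD('p). of_nat i ^ t)"
    unfolding img[symmetric] by (subst sum.reindex[OF inj]) simp
  also have "{..<CARD('p)} = insert 0 {1..<CARD('p)}" using prime_card[where 'a = 'p]
    by (auto dest: prime_gt_0_nat)
  finally show ?thesis using assms by simp
qed

text \<open>Raising to the power \<open>CARD('p) ^ k\<close> is the identity on the prime field,
  which reduces the exponent to \<open>t\<close>. This isolates a single coefficient of the defect
  in a degree that is a power of the characteristic.\<close>

lemma fermat_power_sum:
  assumes t: "0 < t" "t < CARD('p::prime_card)"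
  shows "(\<Sum>i=1..<CARD('p). of_nat i ^ (t * CARD('p) ^ k)) =
    (if t = CARD('p) - 1 then - 1 else (0::'p mod_ring))"
proof -
  have pw: "(x :: 'p mod_ring) ^ (CARD('p) ^ k) = x" for x
    by (rule finite_field_power_card_power_eq_same[where n = k]) simp
  have p: "prime CARD('p)" by (rule prime_card)
  have "(\<Sum>i=1..<CARD('p). of_nat i ^ (t * CARD('p) ^ k)) = (\<Sum>i=1..<CARD('p). (of_nat i :: 'p mod_ring) ^ t)"
    by (simp add: power_mult pw)
  also have "\<dots> = (if t = CARD('p) - 1 then - 1 else 0)"
  proof (cases "t = CARD('p) - 1")
    case True
    have "(of_nat i :: 'p mod_ring) ^ t = 1" if "i \<in> {1..<CARD('p)}" for i
    proof -
      have "(of_nat i :: 'p mod_ring) \<noteq> 0"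
        using that of_nat_0_mod_ring_dvd[of i, where 'a = 'p] by (auto simp: nat_dvd_not_less)
      moreover have "(of_nat i :: 'p mod_ring) * of_nat i ^ t = of_nat i"
        using pw[of "of_nat i"] True finite_field_power_card_eq_same[of "of_nat i :: 'p mod_ring"]
          prime_gt_0_nat[OF p] by (simp flip: power_Suc)
      ultimately show ?thesis by simp
    qed
    then have "(\<Sum>i=1..<CARD('p). (of_nat i :: 'p mod_ring) ^ t) = of_nat (CARD('p) - 1)" by simp
    also have "\<dots> = - 1" using prime_gt_0_nat[OF p] by (simp add: of_nat_diff)
    finally show ?thesis using True by simp
  next
    case False
    then show ?thesis using t sum_of_nat_power_mod_ring[OF t(1), where 'p = 'p]
        power_sum_mod_ring[OF t(1), where 'p = 'p] by simp
  qed
  finally show ?thesis .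
qed


section \<open>Symmetric 2-cocycles modulo an ideal\<close>

text \<open>Congruences are memberships in \<open>J\<close>, so that \<open>J\<close> can be the
  ideal of all relations or that of the chosen equations, with no quotient ring formed.\<close>

locale type_ideal =
  fixes J :: "'a::comm_ring_1 set"
  assumes zero [simp]: "0 \<in> J"
    and add: "x \<in> J \<Longrightarrow> y \<in> J \<Longrightarrow> x + y \<in> J"
    and mult: "x \<in> J \<Longrightarrow> r * x \<in> J"
begin

lemma mult_right: "x \<in> J \<Longrightarrow> x * r \<in> J"
  using mult[of x r] by (simp add: mult.commute)

lemma uminus_iff [simp]: "- x \<in> J \<longleftrightarrow> x \<in> J"
  using mult[of x "-1"] mult[of "- x" "-1"] by auto

lemma diff: "x \<in> J \<Longrightarrow> y \<in> J \<Longrightarrow> x - y \<in> J"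
  using add[of x "- y"] by simp

lemma sum: "(\<And>i. i \<in> A \<Longrightarrow> f i \<in> J) \<Longrightarrow> sum f A \<in> J"
  by (induction A rule: infinite_finite_induct) (auto intro: add)

lemma diff_commute: "x - y \<in> J \<longleftrightarrow> y - x \<in> J"
  using uminus_iff[of "x - y"] by simp

lemma cong_mem: "x - y \<in> J \<Longrightarrow> x \<in> J \<longleftrightarrow> y \<in> J"
  using add[of "x - y" y] diff[of x "x - y"] by auto

lemma cong_trans: "x - y \<in> J \<Longrightarrow> y - z \<in> J \<Longrightarrow> x - z \<in> J"
  using add[of "x - y" "y - z"] by simp

text \<open>\<open>u\<close> has an inverse \<open>w\<close> modulo \<open>p\<close>, and this
  congruence persists in the ring because its characteristic divides \<open>p\<close>.\<close>

lemma of_nat_mult_cancel: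
  assumes "prime p" "of_nat p = (0::'a)" "\<not> p dvd u" "of_nat u * x \<in> J"
  shows "x \<in> J"
proof -
  have "coprime u p" using assms by (simp add: prime_imp_coprime coprime_commute)
  then obtain w where "[u * w = 1] (mod p)" using cong_solve_coprime_nat[of u p] by auto
  then have "of_nat (u * w) = (of_nat 1 :: 'a)"
  proof -
    have "CHAR('a) dvd p" using assms(2) of_nat_eq_0_iff_char_dvd by blast
    then have "[u * w = 1] (mod CHAR('a))" using \<open>[u * w = 1] (mod p)\<close> cong_dvd_modulus_nat by blast
    then show ?thesis by (subst of_nat_eq_iff_cong_CHAR)
  qed
  then have "x = of_nat w * (of_nat u * x)"
    by (metis mult.assoc mult.commute mult_1 of_nat_1 of_nat_mult)
  then show ?thesis using mult[OF assms(4)] by metis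
qed

text \<open>This is the only part of Lazard's description of symmetric 2-cocycles that is needed: a
  homogeneous symmetric 2-cocycle \<open>\<Sum>\<^sub>s c\<^sub>s X\<^sup>s Y\<^bsup>d-s\<^esup>\<close> over an \<open>\<F>\<^sub>p\<close>-module is determined by the
  coefficient \<open>c\<^bsub>p^v\<^esub>\<close>. If the base-\<open>p\<close> digit \<open>s\<^sub>a\<close> is nonzero, then \<open>c\<^sub>s\<close> is a multiple of
  \<open>c\<^bsub>p^a\<^esub>\<close>, and applying this to \<open>s = d - p\<^sup>a\<close> relates the \<open>c\<^bsub>p^a\<^esub>\<close> to each other.\<close>

context
  fixes c :: "nat \<Rightarrow> 'a" and p d :: nat
  assumes p: "prime p" "of_nat p = (0::'a)"
    and sym: "\<And>s. 0 < s \<Longrightarrow> s < d \<Longrightarrow> c s - c (d - s) \<in> J"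
    and coc: "\<And>i s. 0 < i \<Longrightarrow> i \<le> s \<Longrightarrow> s < d \<Longrightarrow>
      of_nat (s choose i) * c s - of_nat ((d - i) choose (s - i)) * c i \<in> J"
begin

text \<open>A binomial coefficient prime to \<open>p\<close> can be cancelled, so the cocycle
  relation puts \<open>c s\<close> into \<open>J\<close> once its other term is there, be it through
  \<open>c i\<close> or through the other binomial coefficient.\<close>

lemma cocycle_step:
  assumes "0 < i" "i \<le> s" "s < d" "\<not> p dvd (s choose i)" "c i \<in> J \<or> p dvd ((d - i) choose (s - i))"
  shows "c s \<in> J"
proof -
  have "of_nat ((d - i) choose (s - i)) * c i \<in> J"
    using assms(5)
  proof
    assume "p dvd ((d - i) choose (s - i))"
    then have "of_nat ((d - i) choose (s - i)) = (0::'a)" using p(2) by auto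
    then show ?thesis by simp
  qed (rule mult)
  then have "of_nat (s choose i) * c s \<in> J"
    using cong_mem[OF coc[OF assms(1-3)]] by simp
  then show ?thesis using of_nat_mult_cancel[OF p assms(4)] by blast
qed

lemma cocycle_digit_step:
  assumes "p ^ a \<le> s" "s < d" "\<not> p dvd s div p ^ a" "c (p ^ a) \<in> J"
  shows "c s \<in> J"
  using cocycle_step[of "p ^ a" s] assms prime_gt_0_nat[OF p(1)] prime_dvd_choose_iff[OF p(1)] by simp

text \<open>By symmetry it is enough to treat \<open>c (d - p ^ a)\<close>. Some digit of
  \<open>d - p ^ a\<close> at a place \<open>b \<ge> v\<close> is nonzero, and in the cocycle
  relation for \<open>i = p ^ b\<close> the other binomial coefficient equals
  \<open>(d - p ^ b) choose p ^ a\<close>. It is zero modulo \<open>p\<close> because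
  \<open>p ^ Suc a\<close> divides \<open>d - p ^ b\<close>, so no value of \<open>c\<close> has to
  be known.\<close>

lemma cocycle_low:
  assumes v: "p ^ v dvd d" "d div p ^ v > 1" and "a < v"
  shows "c (p ^ a) \<in> J"
proof -
  have pos: "p ^ a > 0" for a using p prime_gt_0_nat by simp
  have p1: "p > 1" using p prime_gt_1_nat by blast
  define e where "e = d div p ^ v"
  have d: "d = p ^ v * e" using v(1) by (simp add: e_def)
  have "e > 1" using v(2) by (simp add: e_def)
  have lt: "p ^ a < p ^ v" using \<open>a < v\<close> p1 by (rule power_strict_increasing)
  also have "p ^ v \<le> d" using \<open>e > 1\<close> by (simp add: d)
  finally have a: "p ^ a < d" .
  \<comment> \<open>Subtracting \<open>p ^ a\<close> borrows one from \<open>e\<close>, so the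
    digits from place \<open>v\<close> on are those of \<open>e - 1\<close>.\<close>
  have "d - p ^ a = p ^ v * (e - 1) + (p ^ v - p ^ a)"
    using \<open>e > 1\<close> lt unfolding d by (cases e) auto
  moreover have "p ^ v * (e - 1) + (p ^ v - p ^ a) < p ^ v * Suc (e - 1)"
    using pos[of a] lt by (simp only: mult_Suc_right)
  ultimately have dv: "(d - p ^ a) div p ^ v = e - 1"
    by (intro div_nat_eqI) simp_all
  obtain a' where a': "p ^ a' \<le> e - 1" "\<not> p dvd (e - 1) div p ^ a'"
    using ex_nonzero_digit[OF p(1), of "e - 1"] \<open>e > 1\<close> by auto
  define b where "b = v + a'"
  have digit_b: "\<not> p dvd (d - p ^ a) div p ^ b"
    using a'(2) dv by (simp add: b_def power_add div_mult2_eq)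
  then have ble: "p ^ b \<le> d - p ^ a" by (metis div_less dvd_0_right not_le)
  have "p ^ Suc a dvd p ^ v" using \<open>a < v\<close> by (intro le_imp_power_dvd) simp
  then have "p ^ Suc a dvd d - p ^ b" unfolding d b_def by (simp add: power_add dvd_diff_nat dvd_mult2)
  then obtain r where "d - p ^ b = p ^ Suc a * r" by (elim dvdE)
  then have "d - p ^ b = p ^ a * (p * r)" by simp
  then have "(d - p ^ b) div p ^ a = p * r" using pos[of a] by simp
  then have "p dvd (d - p ^ b) div p ^ a" by simp
  then have "p dvd ((d - p ^ b) choose (p ^ a))" by (simp add: prime_dvd_choose_iff p)
  moreover have "((d - p ^ b) choose (d - p ^ a - p ^ b)) = ((d - p ^ b) choose (p ^ a))"
    using ble a by (subst binomial_symmetric) auto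
  ultimately have "c (d - p ^ a) \<in> J"
    using cocycle_step[of "p ^ b" "d - p ^ a"] pos[of b] pos[of a] a ble digit_b
      prime_dvd_choose_iff[OF p(1)] by simp
  then show ?thesis using cong_mem[OF sym[of "p ^ a"]] pos[of a] a by simp
qed

text \<open>Such an \<open>s\<close> has a nonzero digit at a place \<open>a < v\<close>, where
  \<open>cocycle_low\<close> applies. For \<open>d = p ^ Suc k\<close> and \<open>v = k\<close> only
  multiples of \<open>p ^ k\<close> remain.\<close>

lemma cocycle_vanishes_off_multiples:
  assumes v: "p ^ v dvd d" "d div p ^ v > 1" and s: "0 < s" "s < d" "\<not> p ^ v dvd s"
  shows "c s \<in> J"
proof -
  have "\<exists>a<v. \<not> p dvd s div p ^ a" using s(3)
  proof (induction v)
    case (Suc v)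
    show ?case
    proof (cases "p ^ v dvd s")
      case True
      then have "\<not> p dvd s div p ^ v"
        using Suc.prems by (auto elim!: dvdE simp: mult_ac)
      then show ?thesis by blast
    qed (use Suc.IH less_Suc_eq in blast)
  qed simp
  then obtain a where a: "a < v" "\<not> p dvd s div p ^ a" by blast
  then have "p ^ a \<le> s" by (metis div_less dvd_0_right not_le)
  then show ?thesis using cocycle_digit_step a(2) cocycle_low[OF v a(1)] s(2) by blast
qed

text \<open>Every \<open>s\<close> has a nonzero digit at some place \<open>a\<close>, so it
  suffices to reach each \<open>c (p ^ a)\<close>. Places below \<open>v\<close> are settled by
  \<open>cocycle_low\<close>. For \<open>a > v\<close> the number \<open>d - p ^ a\<close> still has
  a nonzero digit at place \<open>v\<close>, as \<open>d\<close> has, and symmetry leads back to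
  \<open>p ^ a\<close>; if \<open>d = p ^ Suc v\<close>, no such \<open>p ^ a\<close> lies below
  \<open>d\<close>.\<close>

lemma symmetric_cocycle_vanishes:
  assumes v: "p ^ v dvd d" "d div p ^ v > 1" "\<not> p dvd d div p ^ v \<or> d = p ^ Suc v"
    and cv: "c (p ^ v) \<in> J" and s: "0 < s" "s < d"
  shows "c s \<in> J"
proof -
  have pos: "p ^ a > 0" for a using p prime_gt_0_nat by simp
  have p1: "p > 1" using p prime_gt_1_nat by blast
  have low: "c (p ^ a) \<in> J" if a: "p ^ a < d" for a
  proof (cases a v rule: linorder_cases)
    case equal
    then show ?thesis using cv by simp
  next
    case less
    then show ?thesis by (rule cocycle_low[OF v(1,2)])
  next
    case greater
    define e where "e = d div p ^ v"
    have d: "d = p ^ v * e" using v(1) by (simp add: e_def)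
    have "\<not> p dvd e"
    proof
      assume "p dvd e"
      then have "d = p ^ Suc v" using v(3) by (simp add: e_def)
      then have "p ^ a < p ^ Suc v" using a by simp
      then have "a < Suc v" by (rule power_less_imp_less_exp[OF p1])
      then show False using greater by simp
    qed
    have pa: "p ^ a = p ^ v * p ^ (a - v)" using greater by (simp flip: power_add)
    have "d - p ^ a = p ^ v * (e - p ^ (a - v))" unfolding d pa by (simp add: right_diff_distrib')
    then have "(d - p ^ a) div p ^ v = e - p ^ (a - v)" using pos[of v] by simp
    moreover have "p dvd p ^ (a - v)" using greater by simp
    moreover have le: "p ^ (a - v) < e" using a unfolding d pa by simp
    ultimately have nd: "\<not> p dvd (d - p ^ a) div p ^ v" using \<open>\<not> p dvd e\<close>
      using dvd_diffD[of p e "p ^ (a - v)"] by auto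
    then have "p ^ v \<le> d - p ^ a" by (metis div_less dvd_0_right not_le)
    then have "c (d - p ^ a) \<in> J"
      using cocycle_digit_step[OF _ _ nd cv] pos[of a] a by simp
    then show ?thesis using cong_mem[OF sym[of "p ^ a"]] pos[of a] a by simp
  qed
  obtain a where a: "p ^ a \<le> s" "\<not> p dvd s div p ^ a"
    using ex_nonzero_digit[OF p(1) s(1)] by blast
  then show ?thesis using cocycle_digit_step low[of a] s by simp
qed

end

end

section \<open>Formal group laws in a filtered ring\<close>

text \<open>\<open>x - y \<in> F (Suc d)\<close> stands for equality modulo \<open>J\<close> and
  modulo terms of order above \<open>d\<close>; by \<open>F_const\<close> constants from
  \<open>J\<close> have infinite order. The two instances are polynomials filtered by degree and
  power series filtered by order.\<close>

locale mult_filtration =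
  fixes \<kappa> :: "'a::comm_ring_1 \<Rightarrow> 's::comm_ring_1" and J :: "'a set" and F :: "nat \<Rightarrow> 's set"
  assumes hom: "is_type_hom \<kappa>"
    and F_0 [simp]: "F 0 = UNIV"
    and F_zero: "0 \<in> F d"
    and F_add: "x \<in> F d \<Longrightarrow> y \<in> F d \<Longrightarrow> x + y \<in> F d"
    and F_mult: "x \<in> F d \<Longrightarrow> y \<in> F e \<Longrightarrow> x * y \<in> F (d + e)"
    and F_Suc: "x \<in> F (Suc d) \<Longrightarrow> x \<in> F d"
    and F_const: "c \<in> J \<Longrightarrow> \<kappa> c \<in> F d"
begin

sublocale F: type_ideal "F d" for d
proof
  show "0 \<in> F d" by (rule F_zero)
  show "x + y \<in> F d" if "x \<in> F d" "y \<in> F d" for x y using that by (rule F_add)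
  show "r * x \<in> F d" if "x \<in> F d" for x r using F_mult[of r 0 x d] that by simp
qed

lemma F_mono: "x \<in> F e \<Longrightarrow> d \<le> e \<Longrightarrow> x \<in> F d"
  by (rule inc_induct[where P = "\<lambda>d. x \<in> F d"]) (auto intro: F_Suc)

lemma F_power: "x \<in> F 1 \<Longrightarrow> x ^ k \<in> F k"
  by (induction k) (use F_mult[of x 1] in auto)

lemma F_mult_diff:
  assumes "x - x' \<in> F a" "x' \<in> F i" "y \<in> F j" "y - y' \<in> F b" "e \<le> a + j" "e \<le> i + b"
  shows "x * y - x' * y' \<in> F e"
proof -
  have "x * y - x' * y' = (x - x') * y + x' * (y - y')" by (simp add: algebra_simps)
  moreover have "(x - x') * y \<in> F e" using F_mult[OF assms(1,3)] assms(5) by (rule F_mono)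
  moreover have "x' * (y - y') \<in> F e" using F_mult[OF assms(2,4)] assms(6) by (rule F_mono)
  ultimately show ?thesis using F_add by simp
qed

lemma F_power_diff:
  assumes "x \<in> F 1" "y \<in> F 1" "x - y \<in> F (Suc d)"
  shows "x ^ k - y ^ k \<in> F (d + k)"
proof (induction k)
  case (Suc k)
  have "x * x ^ k - y * y ^ k \<in> F (d + Suc k)"
    by (rule F_mult_diff[OF assms(3,2) F_power[OF assms(1)] Suc]) auto
  then show ?case by simp
qed simp

lemma eval_monom_mem:
  assumes "\<And>i. x i \<in> F 1"
  shows "(\<Prod>i\<in>Poly_Mapping.keys m. x i ^ Poly_Mapping.lookup m i) \<in> F (total_deg m)"
proof -
  have "(\<Prod>i\<in>A. x i ^ e i) \<in> F (\<Sum>i\<in>A. e i)" if "finite A" for A e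
    using that by (induction A) (auto intro: F_mult F_power[OF assms])
  then show ?thesis by (simp add: total_deg_def)
qed

lemma eval_monom_diff:
  assumes "\<And>i. x i \<in> F 1" "\<And>i. y i \<in> F 1" "\<And>i. x i - y i \<in> F 2"
  shows "(\<Prod>i\<in>Poly_Mapping.keys m. x i ^ Poly_Mapping.lookup m i) -
    (\<Prod>i\<in>Poly_Mapping.keys m. y i ^ Poly_Mapping.lookup m i) \<in> F (Suc (total_deg m))"
proof -
  have 1: "(\<Prod>i\<in>A. x i ^ e i) \<in> F (\<Sum>i\<in>A. e i)" if "finite A" for A e
    using that by (induction A) (auto intro: F_mult F_power[OF assms(1)])
  have "(\<Prod>i\<in>A. x i ^ e i) - (\<Prod>i\<in>A. y i ^ e i) \<in> F (Suc (\<Sum>i\<in>A. e i))" if "finite A" for A e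
    using that
  proof (induction A)
    case (insert a A)
    have "x a ^ e a - y a ^ e a \<in> F (Suc (e a))"
      using F_power_diff[OF assms(1,2), where d = 1] assms(3)[of a] by (simp add: numeral_2_eq_2)
    then have "x a ^ e a * (\<Prod>i\<in>A. x i ^ e i) - y a ^ e a * (\<Prod>i\<in>A. y i ^ e i)
        \<in> F (Suc (e a + (\<Sum>i\<in>A. e i)))"
      by (rule F_mult_diff[OF _ F_power[OF assms(2)] 1[OF insert(1)] insert(3)]) auto
    then show ?case using insert by simp
  qed simp
  then show ?thesis by (simp add: total_deg_def)
qed

lemma eval_mem:
  assumes "\<And>m. total_deg m < d \<Longrightarrow> Poly_Mapping.lookup P m \<in> J" "\<And>i. x i \<in> F 1"
  shows "mpoly_eval \<kappa> x P \<in> F d"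
  unfolding mpoly_eval_def
proof (rule F.sum)
  fix m assume "m \<in> Poly_Mapping.keys P"
  show "\<kappa> (Poly_Mapping.lookup P m) * (\<Prod>i\<in>Poly_Mapping.keys m. x i ^ Poly_Mapping.lookup m i) \<in> F d"
  proof (cases "total_deg m < d")
    case True
    then show ?thesis by (intro F.mult_right F_const assms)
  next
    case False
    then show ?thesis by (intro F.mult F_mono[OF eval_monom_mem] assms) auto
  qed
qed

text \<open>Modulo \<open>J\<close> the polynomial starts in degree \<open>d\<close>, and a change
  of order 2 in a factor of order 1 raises the order of a monomial by one. This allows a formal sum
  inside the defect to be replaced by the ordinary sum.\<close>

lemma eval_diff:
  assumes "\<And>m. total_deg m < d \<Longrightarrow> Poly_Mapping.lookup P m \<in> J"
    and "\<And>i. x i \<in> F 1" "\<And>i. y i \<in> F 1" "\<And>i. x i - y i \<in> F 2"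
  shows "mpoly_eval \<kappa> x P - mpoly_eval \<kappa> y P \<in> F (Suc d)"
  unfolding mpoly_eval_def sum_subtractf[symmetric] right_diff_distrib[symmetric]
proof (rule F.sum)
  fix m assume "m \<in> Poly_Mapping.keys P"
  show "\<kappa> (Poly_Mapping.lookup P m) * ((\<Prod>i\<in>Poly_Mapping.keys m. x i ^ Poly_Mapping.lookup m i) -
      (\<Prod>i\<in>Poly_Mapping.keys m. y i ^ Poly_Mapping.lookup m i)) \<in> F (Suc d)"
  proof (cases "total_deg m < d")
    case True
    then show ?thesis by (intro F.mult_right F_const assms)
  next
    case False
    then show ?thesis by (intro F.mult F_mono[OF eval_monom_diff] assms) auto
  qed
qed

end

section \<open>Values of a truncated formal group law\<close>

lemma trunc_subst_hom:
  assumes "is_type_hom E"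
  shows "E (trunc_subst \<eta> n H u v) = trunc_subst (\<lambda>t. E (\<eta> t)) n H (E u) (E v)"
  by (simp add: trunc_subst_def type_homD[OF assms] type_hom_sum[OF assms] type_hom_power[OF assms])

lemma curve_subst_hom:
  assumes "is_type_hom E"
  shows "E (curve_subst n a u) = (\<Sum>i=1..n. E (mconst (a i)) * E u ^ i)"
  by (simp add: curve_subst_def type_homD[OF assms] type_hom_sum[OF assms] type_hom_power[OF assms])

text \<open>The axioms \<open>H(X,0) = X\<close> and \<open>H(0,Y) = Y\<close> leave, besides
  \<open>u + v\<close>, only terms that contain both arguments.\<close>

lemma formal_group_law_trunc_subst:
  assumes "formal_group_law H" "is_type_hom \<eta>" "n \<ge> 1"
  shows "trunc_subst \<eta> n H u v =
    u + v + (\<Sum>i=1..n. \<Sum>j=1..n-i. \<eta> (fps_nth (fps_nth H i) j) * u ^ i * v ^ j)"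
proof -
  have H0: "fps_nth (fps_nth H i) 0 = (if i = 1 then 1 else 0)"
    and H1: "fps_nth (fps_nth H 0) j = (if j = 1 then 1 else 0)" for i j
    using assms(1) by (auto simp: formal_group_law_def)
  have split: "sum g {..m} = g 0 + sum g {1..m}" for g :: "nat \<Rightarrow> 'b" and m
    by (simp add: atMost_atLeast0 sum.atLeast_Suc_atMost)
  have delta: "(\<Sum>j=1..n. \<eta> (if j = 1 then 1 else 0) * w ^ j) = w" for w
  proof -
    have "(\<Sum>j=1..n. \<eta> (if j = 1 then 1 else 0) * w ^ j) = (\<Sum>j=1..n. if j = 1 then w else 0)"
      by (intro sum.cong) (auto simp: type_homD[OF assms(2)])
    then show ?thesis using assms(3) by simp
  qed
  show ?thesis
    using delta[of u] delta[of v]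
    by (simp add: trunc_subst_def split H0 H1 type_homD[OF assms(2)] sum.distrib add_ac)
qed

lemma trunc_subst_commute:
  assumes "formal_group_law H"
  shows "trunc_subst \<eta> n H u v = trunc_subst \<eta> n H v u"
proof -
  have "trunc_subst \<eta> n H u v =
      (\<Sum>(i, j)\<in>{(i, j). i \<le> n \<and> j \<le> n - i}. \<eta> (fps_nth (fps_nth H i) j) * u ^ i * v ^ j)" for u v
    unfolding trunc_subst_def by (subst sum.Sigma) (auto intro!: sum.cong)
  moreover have "(\<Sum>(i, j)\<in>{(i, j). i \<le> n \<and> j \<le> n - i}. \<eta> (fps_nth (fps_nth H i) j) * u ^ i * v ^ j) =
      (\<Sum>(i, j)\<in>{(i, j). i \<le> n \<and> j \<le> n - i}. \<eta> (fps_nth (fps_nth H i) j) * v ^ i * u ^ j)"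
    using assms
    by (intro sum.reindex_bij_witness[of _ "\<lambda>(i, j). (j, i)" "\<lambda>(i, j). (j, i)"])
      (auto simp: formal_group_law_def)
  ultimately show ?thesis by simp
qed

section \<open>The deviation of a curve from an endomorphism\<close>

locale fgl_filtration = mult_filtration \<kappa> J F
  for \<kappa> :: "'a::comm_ring_1 \<Rightarrow> 's::comm_ring_1" and J :: "'a set" and F :: "nat \<Rightarrow> 's set" +
  fixes \<iota> :: "'k::comm_ring_1 \<Rightarrow> 'a" and H :: "'k fps fps" and n :: nat and a :: "nat \<Rightarrow> 'a"
  assumes \<iota>: "is_type_hom \<iota>" and H: "formal_group_law H" and n: "n \<ge> 1"
begin

abbreviation fadd (infixl "\<boxplus>" 65) where
  "u \<boxplus> v \<equiv> trunc_subst (\<lambda>t. \<kappa> (\<iota> t)) n H u v"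

definition curve :: "'s \<Rightarrow> 's" where
  "curve u = (\<Sum>i=1..n. \<kappa> (a i) * u ^ i)"

definition defect :: "'s \<Rightarrow> 's \<Rightarrow> 's" where
  "defect u v = curve (u \<boxplus> v) - (curve u \<boxplus> curve v)"

primrec fmult :: "nat \<Rightarrow> 's \<Rightarrow> 's" where
  "fmult 0 u = 0"
| "fmult (Suc m) u = fmult m u \<boxplus> u"

lemma \<kappa>\<iota>: "is_type_hom (\<lambda>t. \<kappa> (\<iota> t))"
  using \<iota> hom by (rule comp_hom)

lemmas fadd_eq = formal_group_law_trunc_subst[OF H \<kappa>\<iota> n]

lemma zero_fadd: "0 \<boxplus> v = v" and fadd_zero: "u \<boxplus> 0 = u"
  by (auto simp: fadd_eq power_0_left intro!: sum.neutral)

lemma eval_aut_defect: "mpoly_eval \<kappa> x (aut_defect \<iota> n H a) = defect (x 1) (x 2)"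
proof -
  have E: "is_type_hom (mpoly_eval \<kappa> x)" by (rule mpoly_eval_hom[OF hom])
  show ?thesis
    by (simp add: aut_defect_def Let_def type_homD[OF E] trunc_subst_hom[OF E] curve_subst_hom[OF E]
        mpoly_eval_mconst[OF hom] mpoly_eval_mvar[OF hom] curve_def defect_def)
qed

lemma curve_mem: "u \<in> F 1 \<Longrightarrow> curve u \<in> F 1"
  unfolding curve_def by (intro F.sum F.mult F_mono[OF F_power]) auto

lemma curve_diff:
  assumes "u \<in> F 1" "v \<in> F 1" "u - v \<in> F (Suc d)"
  shows "curve u - curve v \<in> F (Suc d)"
proof -
  have "curve u - curve v = (\<Sum>i=1..n. \<kappa> (a i) * (u ^ i - v ^ i))"
    by (simp add: curve_def sum_subtractf right_diff_distrib)
  also have "\<dots> \<in> F (Suc d)"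
    by (intro F.sum F.mult F_mono[OF F_power_diff[OF assms]]) auto
  finally show ?thesis .
qed

lemma fadd_approx:
  assumes "u \<in> F 1" "v \<in> F 1"
  shows "(u \<boxplus> v) - (u + v) \<in> F 2"
  unfolding fadd_eq add_diff_cancel_left'
proof (intro F.sum)
  fix i j assume *: "i \<in> {1..n}" "j \<in> {1..n-i}"
  have "u ^ i * v ^ j \<in> F (i + j)" using assms by (intro F_mult F_power)
  then have "u ^ i * v ^ j \<in> F 2" by (rule F_mono) (use * in auto)
  then show "\<kappa> (\<iota> (fps_nth (fps_nth H i) j)) * u ^ i * v ^ j \<in> F 2"
    unfolding mult.assoc by (rule F.mult)
qed

lemma fadd_mem:
  assumes "u \<in> F 1" "v \<in> F 1"
  shows "u \<boxplus> v \<in> F 1"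
proof -
  have "(u \<boxplus> v) - (u + v) \<in> F 1" using fadd_approx[OF assms] by (rule F_mono) simp
  then show ?thesis using F_add[OF _ F_add[OF assms], of "(u \<boxplus> v) - (u + v)"] by simp
qed

text \<open>In a mixed term of \<open>H\<close> the changed factor is accompanied by another factor
  of order 1, so a change of order \<open>d\<close> is felt only through the linear part
  \<open>u + v\<close>.\<close>

lemma fadd_diff:
  assumes "u \<in> F 1" "v \<in> F 1" "u' \<in> F 1" "v' \<in> F 1" "u' - u \<in> F d" "v' - v \<in> F d"
  shows "(u' \<boxplus> v') - (u \<boxplus> v) - ((u' - u) + (v' - v)) \<in> F (Suc d)"
proof (cases d)
  case 0
  have "(u' \<boxplus> v') - (u \<boxplus> v) - ((u' - u) + (v' - v)) \<in> F 1"
    using assms by (intro F.diff F_add fadd_mem)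
  then show ?thesis using 0 by simp
next
  case (Suc e)
  have "(u' \<boxplus> v') - (u \<boxplus> v) - ((u' - u) + (v' - v)) =
      (\<Sum>i=1..n. \<Sum>j=1..n-i. \<kappa> (\<iota> (fps_nth (fps_nth H i) j)) * (u' ^ i * v' ^ j - u ^ i * v ^ j))"
    by (simp add: fadd_eq right_diff_distrib sum_subtractf mult.assoc)
  also have "\<dots> \<in> F (Suc d)"
  proof (intro F.sum F.mult)
    fix i j assume *: "i \<in> {1..n}" "j \<in> {1..n-i}"
    show "u' ^ i * v' ^ j - u ^ i * v ^ j \<in> F (Suc d)"
      by (rule F_mult_diff[OF F_power_diff F_power F_power F_power_diff])
        (use assms Suc * in auto)
  qed
  finally show ?thesis .
qed

lemma fmult_mem: "u \<in> F 1 \<Longrightarrow> fmult m u \<in> F 1"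
  by (induction m) (use fadd_mem in auto)

lemma fmult_approx:
  assumes "u \<in> F 1"
  shows "fmult m u - of_nat m * u \<in> F 2"
proof (induction m)
  case (Suc m)
  from F_add[OF this fadd_approx[OF fmult_mem[OF assms, of m] assms]]
  show ?case by (simp add: algebra_simps)
qed simp

text \<open>Truncation at degree \<open>n\<close> spoils associativity only beyond degree
  \<open>n\<close>. The polynomial identity has coefficients in \<open>'k\<close>, which is why it
  is evaluated from there, with the zero ideal.\<close>

lemma fadd_assoc:
  assumes "u \<in> F 1" "v \<in> F 1" "w \<in> F 1"
  shows "((u \<boxplus> v) \<boxplus> w) - (u \<boxplus> (v \<boxplus> w)) \<in> F (Suc n)"
proof -
  interpret \<iota>: mult_filtration "\<lambda>t. \<kappa> (\<iota> t)" "{0}" F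
    by unfold_locales (auto simp: \<kappa>\<iota> F_add F_mult F_Suc type_homD[OF \<kappa>\<iota>])
  define x where "x i = (if i = 1 then u else if i = 2 then v else if i = 3 then w else 0)" for i :: nat
  define P where "P = (let G = trunc_subst mconst n H in
    G (G (mvar 1) (mvar 2)) (mvar 3) - G (mvar 1) (G (mvar 2) (mvar 3)))"
  have E: "is_type_hom (mpoly_eval (\<lambda>t. \<kappa> (\<iota> t)) x)" by (rule mpoly_eval_hom[OF \<kappa>\<iota>])
  have "mpoly_eval (\<lambda>t. \<kappa> (\<iota> t)) x P \<in> F (Suc n)"
  proof (rule \<iota>.eval_mem)
    fix m assume "total_deg m < Suc n"
    then show "Poly_Mapping.lookup P m \<in> {0}"
      using H by (simp add: P_def formal_group_law_def eq_upto_deg_def Let_def lookup_minus)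
  next
    show "x i \<in> F 1" for i using assms by (simp add: x_def)
  qed
  then show ?thesis
    by (simp add: P_def Let_def type_homD[OF E] trunc_subst_hom[OF E] mpoly_eval_mconst[OF \<kappa>\<iota>]
        mpoly_eval_mvar[OF \<kappa>\<iota>] x_def)
qed


lemma zero_defect: "defect 0 v = 0"
proof -
  have "curve 0 = 0" by (auto simp: curve_def power_0_left intro!: sum.neutral)
  then show ?thesis by (simp add: defect_def zero_fadd)
qed

lemma defect_commute: "defect u v = defect v u"
  by (simp add: defect_def trunc_subst_commute[OF H, of _ _ u v]
      trunc_subst_commute[OF H, of _ _ "curve u" "curve v"])

context
  fixes d :: nat
  assumes small: "\<And>m. total_deg m < d \<Longrightarrow> Poly_Mapping.lookup (aut_defect \<iota> n H a) m \<in> J"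
begin

lemma defect_mem:
  assumes "u \<in> F 1" "v \<in> F 1"
  shows "defect u v \<in> F d"
proof -
  define x where "x i = (if i = 1 then u else if i = 2 then v else 0)" for i :: nat
  have "x i \<in> F 1" for i using assms by (simp add: x_def)
  then have "mpoly_eval \<kappa> x (aut_defect \<iota> n H a) \<in> F d" using small by (intro eval_mem)
  then show ?thesis by (simp add: eval_aut_defect x_def)
qed

lemma defect_diff:
  assumes "u \<in> F 1" "v \<in> F 1" "u' \<in> F 1" "v' \<in> F 1" "u - u' \<in> F 2" "v - v' \<in> F 2"
  shows "defect u v - defect u' v' \<in> F (Suc d)"
proof -
  define x where "x i = (if i = 1 then u else if i = 2 then v else 0)" for i :: nat
  define y where "y i = (if i = 1 then u' else if i = 2 then v' else 0)" for i :: nat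
  have "mpoly_eval \<kappa> x (aut_defect \<iota> n H a) - mpoly_eval \<kappa> y (aut_defect \<iota> n H a) \<in> F (Suc d)"
    using small
  proof (rule eval_diff)
    show "x i \<in> F 1" "y i \<in> F 1" "x i - y i \<in> F 2" for i using assms by (simp_all add: x_def y_def)
  qed
  then show ?thesis by (simp add: eval_aut_defect x_def y_def)
qed

text \<open>Apply the curve to \<open>(u \<boxplus> v) \<boxplus> w\<close> and to
  \<open>u \<boxplus> (v \<boxplus> w)\<close>. By \<open>fadd_diff\<close> an inner defect passes
  linearly through the outer formal sum, so each side differs from a formal sum of the three curve
  values by two defects. The bracketings agree up to degree \<open>n\<close>, hence
  \<open>d \<le> n\<close>.\<close>

lemma defect_cocycle:
  assumes "d \<le> n" "u \<in> F 1" "v \<in> F 1" "w \<in> F 1"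
  shows "defect u v + defect (u + v) w - defect v w - defect u (v + w) \<in> F (Suc d)"
proof -
  have le: "Suc d \<le> Suc n" using assms(1) by simp
  define P where "P = curve (u \<boxplus> v) \<boxplus> curve w"
  define P0 where "P0 = (curve u \<boxplus> curve v) \<boxplus> curve w"
  define Q where "Q = curve u \<boxplus> curve (v \<boxplus> w)"
  define Q0 where "Q0 = curve u \<boxplus> (curve v \<boxplus> curve w)"
  define L where "L = curve ((u \<boxplus> v) \<boxplus> w)"
  define R where "R = curve (u \<boxplus> (v \<boxplus> w))"
  have L: "L = defect (u \<boxplus> v) w + P" and R: "R = defect u (v \<boxplus> w) + Q"
    by (simp_all add: L_def R_def P_def Q_def defect_def)
  \<comment> \<open>The \<open>0\<close> is the change in the second summand \<open>curve w\<close>,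
    which is the same on both sides.\<close>
  have A: "P - P0 - (defect u v + 0) \<in> F (Suc d)"
    unfolding P_def P0_def
    by (rule fadd_diff[of "curve u \<boxplus> curve v" "curve w" "curve (u \<boxplus> v)" "curve w" d,
          folded defect_def, unfolded diff_self])
      (intro curve_mem fadd_mem defect_mem assms F_zero)+
  have B: "Q - Q0 - (0 + defect v w) \<in> F (Suc d)"
    unfolding Q_def Q0_def
    by (rule fadd_diff[of "curve u" "curve v \<boxplus> curve w" "curve u" "curve (v \<boxplus> w)" d,
          folded defect_def, unfolded diff_self])
      (intro curve_mem fadd_mem defect_mem assms F_zero)+
  have C: "L - R \<in> F (Suc d)"
    unfolding L_def R_def by (intro F_mono[OF curve_diff[OF _ _ fadd_assoc] le] fadd_mem assms)
  have D: "P0 - Q0 \<in> F (Suc d)"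
    unfolding P0_def Q0_def by (intro F_mono[OF fadd_assoc le] curve_mem assms)
  have E: "defect (u \<boxplus> v) w - defect (u + v) w \<in> F (Suc d)"
    by (intro defect_diff fadd_approx fadd_mem F_add assms) simp_all
  have G: "defect u (v \<boxplus> w) - defect u (v + w) \<in> F (Suc d)"
    by (intro defect_diff fadd_approx fadd_mem F_add assms) simp_all
  have "(L - R) - (P - P0 - (defect u v + 0)) + (Q - Q0 - (0 + defect v w)) - (P0 - Q0)
      - (defect (u \<boxplus> v) w - defect (u + v) w) + (defect u (v \<boxplus> w) - defect u (v + w)) \<in> F (Suc d)"
    by (intro F_add F.diff A B C D E G)
  then show ?thesis by (simp add: L R algebra_simps)
qed

text \<open>Telescoping: each further formal summand \<open>u\<close> contributes one defect at
  \<open>(fmult i u, u)\<close>, and in leading order \<open>fmult i u\<close> may be replaced by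
  \<open>of_nat i * u\<close>.\<close>

lemma curve_fmult:
  assumes u: "u \<in> F 1"
  shows "curve (fmult m u) - fmult m (curve u) - (\<Sum>i<m. defect (of_nat i * u) u) \<in> F (Suc d)"
proof (induction m)
  case 0
  have "curve 0 = 0" by (auto simp: curve_def power_0_left intro!: sum.neutral)
  then show ?case by simp
next
  case (Suc m)
  define W where "W = sum (\<lambda>i. defect (of_nat i * u) u) {..<m}"
  define Z where "Z = curve (fmult m u) - fmult m (curve u)"
  have IH: "Z - W \<in> F (Suc d)" using Suc by (simp add: Z_def W_def)
  have mem: "of_nat i * u \<in> F 1" for i using u by (rule F.mult)
  have "W \<in> F d" unfolding W_def by (intro F.sum defect_mem mem u)
  then have Z: "Z \<in> F d" using F_add[OF F_Suc[OF IH], of W] by simp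
  have A: "(curve (fmult m u) \<boxplus> curve u) - (fmult m (curve u) \<boxplus> curve u) - (Z + 0) \<in> F (Suc d)"
    using fadd_diff[of "fmult m (curve u)" "curve u" "curve (fmult m u)" "curve u" d] Z
    by (simp only: Z_def diff_self) (simp add: curve_mem[unfolded One_nat_def] fmult_mem[unfolded One_nat_def] u[unfolded One_nat_def])
  have B: "defect (fmult m u) u - defect (of_nat m * u) u \<in> F (Suc d)"
    by (intro defect_diff fmult_mem mem u fmult_approx) simp
  have "((curve (fmult m u) \<boxplus> curve u) - (fmult m (curve u) \<boxplus> curve u) - (Z + 0)) + (Z - W)
      + (defect (fmult m u) u - defect (of_nat m * u) u) \<in> F (Suc d)"
    by (intro F_add A B IH)
  then show ?case by (simp add: W_def defect_def algebra_simps)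
qed

end

end

section \<open>Leading coefficients of the defect\<close>

lemma total_deg_superset:
  assumes "finite A" "Poly_Mapping.keys m \<subseteq> A"
  shows "total_deg m = (\<Sum>i\<in>A. Poly_Mapping.lookup m i)"
  unfolding total_deg_def using assms by (intro sum.mono_neutral_left) (auto simp: in_keys_iff)

lemma total_deg_add: "total_deg (m + m') = total_deg m + total_deg m'"
proof -
  let ?A = "Poly_Mapping.keys m \<union> Poly_Mapping.keys m'"
  have "Poly_Mapping.keys (m + m') \<subseteq> ?A" by (rule keys_add)
  then show ?thesis
    by (simp add: total_deg_superset[of ?A] lookup_add sum.distrib)
qed

text \<open>Exponent vectors in the variables 1, 2, 3. The defect involves the first two; the third
  is there for the cocycle identity.\<close>

definition monom3 :: "nat \<Rightarrow> nat \<Rightarrow> nat \<Rightarrow> (nat \<Rightarrow>\<^sub>0 nat)" where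
  "monom3 i j k = Poly_Mapping.single 1 i + Poly_Mapping.single 2 j + Poly_Mapping.single 3 k"

lemma lookup_monom3: "Poly_Mapping.lookup (monom3 i j k) x =
    (if x = 1 then i else if x = 2 then j else if x = 3 then k else 0)"
  by (simp add: monom3_def lookup_add lookup_single when_def)

lemma monom3_inject [simp]: "monom3 i j k = monom3 i' j' k' \<longleftrightarrow> i = i' \<and> j = j' \<and> k = k'"
proof
  assume "monom3 i j k = monom3 i' j' k'"
  then have "Poly_Mapping.lookup (monom3 i j k) x = Poly_Mapping.lookup (monom3 i' j' k') x" for x
    by simp
  from this[of 1] this[of 2] this[of 3] show "i = i' \<and> j = j' \<and> k = k'"
    by (simp add: lookup_monom3)
qed simp

lemma keys_monom3: "Poly_Mapping.keys (monom3 i j k) \<subseteq> {1, 2, 3}"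
  by (auto simp: in_keys_iff lookup_monom3 split: if_splits)

lemma total_deg_monom3 [simp]: "total_deg (monom3 i j k) = i + j + k"
  by (subst total_deg_superset[OF _ keys_monom3]) (auto simp: lookup_monom3)

lemma monom3_eq:
  assumes "Poly_Mapping.keys m \<subseteq> {1, 2}"
  shows "m = monom3 (Poly_Mapping.lookup m 1) (Poly_Mapping.lookup m 2) 0"
  by (rule poly_mapping_eqI) (use assms in \<open>auto simp: lookup_monom3 in_keys_iff\<close>)

lemma mvar_power: "mvar i ^ k = Poly_Mapping.single (Poly_Mapping.single i k) 1"
  by (induction k) (auto simp: mvar_def mult_single single_add[symmetric])

lemma mconst_monom3:
  "mconst c * mvar 1 ^ i * mvar 2 ^ j * mvar 3 ^ k = Poly_Mapping.single (monom3 i j k) c"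
  by (simp add: mvar_power mconst_def mult_single monom3_def)

section \<open>Filtrations by degree and by order, relative to an ideal\<close>

definition deg_filtration :: "'a::comm_ring_1 set \<Rightarrow> nat \<Rightarrow> 'a mpoly set" where
  "deg_filtration J d = {P. \<forall>m. total_deg m < d \<longrightarrow> Poly_Mapping.lookup P m \<in> J}"

definition ord_filtration :: "'a::comm_ring_1 set \<Rightarrow> nat \<Rightarrow> 'a fps set" where
  "ord_filtration J d = {g. \<forall>i<d. fps_nth g i \<in> J}"

context type_ideal
begin

lemma mpoly_filtration: "mult_filtration mconst J (deg_filtration J)"
proof
  fix d e and x y :: "'a mpoly"
  assume x: "x \<in> deg_filtration J d" and y: "y \<in> deg_filtration J e"
  have "x * y = (\<Sum>m\<in>Poly_Mapping.keys x. \<Sum>m'\<in>Poly_Mapping.keys y.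
      Poly_Mapping.single (m + m') (Poly_Mapping.lookup x m * Poly_Mapping.lookup y m'))"
    by (subst mpoly_as_sum[of x], subst mpoly_as_sum[of y]) (simp add: sum_product mult_single)
  moreover have "Poly_Mapping.lookup (Poly_Mapping.single (m + m')
      (Poly_Mapping.lookup x m * Poly_Mapping.lookup y m')) k \<in> J" if "total_deg k < d + e" for m m' k
  proof (cases "k = m + m'")
    case True
    then have "total_deg m < d \<or> total_deg m' < e" using that by (auto simp: total_deg_add)
    then show ?thesis using x y True by (auto simp: deg_filtration_def intro: mult mult_right)
  qed (simp add: lookup_single_not_eq)
  ultimately show "x * y \<in> deg_filtration J (d + e)"
    by (simp add: deg_filtration_def lookup_sum) (blast intro: sum)
qed (auto simp: deg_filtration_def mconst_hom lookup_add add mconst_def lookup_single when_def)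

lemma fps_filtration: "mult_filtration fps_const J (ord_filtration J)"
proof
  fix d e and x y :: "'a fps"
  assume x: "x \<in> ord_filtration J d" and y: "y \<in> ord_filtration J e"
  have "fps_nth x j * fps_nth y (i - j) \<in> J" if "i < d + e" "j \<le> i" for i j
  proof -
    have "j < d \<or> i - j < e" using that by auto
    then show ?thesis using x y by (auto simp: ord_filtration_def intro: mult mult_right)
  qed
  then show "x * y \<in> ord_filtration J (d + e)"
    by (auto simp: ord_filtration_def fps_mult_nth intro!: sum)
qed (auto simp: ord_filtration_def add intro: type_homI)

end

lemma type_hom_of_nat:
  assumes "is_type_hom \<iota>" shows "\<iota> (of_nat m) = of_nat m"
  by (induction m) (auto simp: type_homD[OF assms])

lemma mvars_diff: "mvars (P - Q) \<subseteq> mvars P \<union> mvars Q"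
  using mvars_add[of P "- Q"] by simp

lemma mvars_sum: "(\<And>i. i \<in> A \<Longrightarrow> mvars (f i) \<subseteq> V) \<Longrightarrow> mvars (sum f A) \<subseteq> V"
proof (induction A rule: infinite_finite_induct)
  case (insert x A)
  then show ?case using mvars_add[of "f x" "sum f A"] by fastforce
qed auto

lemma mvars_mult_subset: "mvars P \<subseteq> V \<Longrightarrow> mvars Q \<subseteq> V \<Longrightarrow> mvars (P * Q) \<subseteq> V"
  using mvars_mult[of P Q] by blast

lemma mvars_power: "mvars P \<subseteq> V \<Longrightarrow> mvars (P ^ k) \<subseteq> V"
  by (induction k) (simp_all add: mvars_mult_subset)

lemma mvars_prod: "(\<And>i. i \<in> A \<Longrightarrow> mvars (f i) \<subseteq> V) \<Longrightarrow> mvars (prod f A) \<subseteq> V"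
  by (induction A rule: infinite_finite_induct) (simp_all add: mvars_mult_subset)

lemma mvars_aut_defect: "mvars (aut_defect \<iota> n H a) \<subseteq> {1, 2}"
proof -
  have t: "mvars (trunc_subst (\<lambda>t. mconst (\<iota> t)) n H P Q) \<subseteq> {1, 2}"
    if "mvars P \<subseteq> {1, 2}" "mvars Q \<subseteq> {1, 2}" for P Q
    unfolding trunc_subst_def using that
    by (intro mvars_sum mvars_mult_subset mvars_power) simp_all
  have c: "mvars (curve_subst n a P) \<subseteq> {1, 2}" if "mvars P \<subseteq> {1, 2}" for P
    unfolding curve_subst_def using that
    by (intro mvars_sum mvars_mult_subset mvars_power) simp_all
  have v: "mvars (mvar 1) \<subseteq> {1, 2}" "mvars (mvar 2) \<subseteq> {1, 2}"
    using mvars_mvar[of 1] mvars_mvar[of 2] by blast+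
  show ?thesis
    unfolding aut_defect_def Let_def
    by (rule order_trans[OF mvars_diff], intro Un_least t c v)
qed

lemma lookup_not_mvars: "\<not> Poly_Mapping.keys m \<subseteq> mvars P \<Longrightarrow> Poly_Mapping.lookup P m = 0"
  by (auto simp: mvars_def in_keys_iff)

context mult_filtration
begin

text \<open>After removal of the form of degree \<open>d\<close>, all coefficients of
  \<open>P\<close> up to degree \<open>d\<close> lie in \<open>J\<close>.\<close>

lemma eval_leading:
  assumes J: "0 \<in> J"
    and small: "\<And>m. total_deg m < d \<Longrightarrow> Poly_Mapping.lookup P m \<in> J"
    and P: "mvars P \<subseteq> {1, 2}" and x: "\<And>i. x i \<in> F 1"
  shows "mpoly_eval \<kappa> x P -
    (\<Sum>s\<le>d. \<kappa> (Poly_Mapping.lookup P (monom3 s (d - s) 0)) * x 1 ^ s * x 2 ^ (d - s)) \<in> F (Suc d)"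
proof -
  define c where "c s = Poly_Mapping.lookup P (monom3 s (d - s) 0)" for s
  define Q where "Q = (\<Sum>s\<le>d. mconst (c s) * mvar 1 ^ s * mvar 2 ^ (d - s))"
  have Q: "Q = (\<Sum>s\<le>d. Poly_Mapping.single (monom3 s (d - s) 0) (c s))"
    unfolding Q_def using mconst_monom3[where k = 0] by (intro sum.cong) simp_all
  have E: "is_type_hom (mpoly_eval \<kappa> x)" by (rule mpoly_eval_hom[OF hom])
  have "mpoly_eval \<kappa> x (P - Q) \<in> F (Suc d)"
  proof (rule eval_mem[OF _ x])
    fix m assume m: "total_deg m < Suc d"
    have lQ: "Poly_Mapping.lookup Q m = (\<Sum>s\<le>d. if monom3 s (d - s) 0 = m then c s else 0)"
      by (simp add: Q lookup_sum lookup_single when_def)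
    show "Poly_Mapping.lookup (P - Q) m \<in> J"
    proof (cases "total_deg m = d \<and> Poly_Mapping.keys m \<subseteq> {1, 2}")
      case True
      then obtain s t where "m = monom3 s t 0" using monom3_eq by blast
      then have st: "s \<le> d" "m = monom3 s (d - s) 0" using True by auto
      have "Poly_Mapping.lookup Q m = (\<Sum>s'\<le>d. if s' = s then c s' else 0)"
        unfolding lQ using st by (intro sum.cong) auto
      then show ?thesis using st J by (simp add: lookup_minus c_def)
    next
      case False
      have "monom3 s (d - s) 0 \<noteq> m" if "s \<le> d" for s
        using False that by (auto simp: in_keys_iff lookup_monom3 split: if_splits)
      then have "Poly_Mapping.lookup Q m = 0" unfolding lQ by (intro sum.neutral) auto
      moreover have "Poly_Mapping.lookup P m \<in> J"
      proof (cases "total_deg m < d")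
        case False
        then have "\<not> Poly_Mapping.keys m \<subseteq> {1, 2}"
          using m \<open>\<not> (total_deg m = d \<and> Poly_Mapping.keys m \<subseteq> {1, 2})\<close> by auto
        then show ?thesis using lookup_not_mvars[of m P] P J by auto
      qed (rule small)
      ultimately show ?thesis by (simp add: lookup_minus)
    qed
  qed
  then show ?thesis
    by (simp add: Q_def type_homD[OF E] type_hom_sum[OF E] type_hom_power[OF E] c_def
        mpoly_eval_mconst[OF hom] mpoly_eval_mvar[OF hom])
qed

end

context fgl_filtration
begin

abbreviation dcoeff :: "nat \<Rightarrow> nat \<Rightarrow> 'a" where
  "dcoeff d s \<equiv> Poly_Mapping.lookup (aut_defect \<iota> n H a) (monom3 s (d - s) 0)"

lemma defect_leading:
  assumes "0 \<in> J" "\<And>m. total_deg m < d \<Longrightarrow> Poly_Mapping.lookup (aut_defect \<iota> n H a) m \<in> J"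
    and "u \<in> F 1" "v \<in> F 1"
  shows "defect u v - (\<Sum>s\<le>d. \<kappa> (dcoeff d s) * u ^ s * v ^ (d - s)) \<in> F (Suc d)"
proof -
  define x where "x i = (if i = 1 then u else if i = 2 then v else 0)" for i :: nat
  have "x i \<in> F 1" for i using assms by (simp add: x_def)
  from eval_leading[where x = x, OF assms(1) assms(2) mvars_aut_defect this] show ?thesis
    unfolding eval_aut_defect by (simp add: x_def)
qed

end

lemma mconst_mult_binomial:
  "mconst b * (u + v) ^ t = (\<Sum>l\<le>t. mconst (of_nat (t choose l) * b) * u ^ l * v ^ (t - l))"
  unfolding binomial_ring sum_distrib_left
  by (simp add: type_homD[OF mconst_hom] type_hom_of_nat[OF mconst_hom] ac_simps)

section \<open>The leading form of the defect as a symmetric 2-cocycle\<close>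

context type_ideal
begin

context
  fixes \<iota> :: "'k::comm_ring_1 \<Rightarrow> 'a" and H :: "'k fps fps" and n d :: nat and a :: "nat \<Rightarrow> 'a"
    and c :: "nat \<Rightarrow> 'a"
  defines "c \<equiv> \<lambda>s. Poly_Mapping.lookup (aut_defect \<iota> n H a) (monom3 s (d - s) 0)"
  assumes \<iota>: "is_type_hom \<iota>" and H: "formal_group_law H" and n: "n \<ge> 1" and d: "d \<le> n"
    and small: "\<And>m. total_deg m < d \<Longrightarrow> Poly_Mapping.lookup (aut_defect \<iota> n H a) m \<in> J"
begin

interpretation M: mult_filtration mconst J "deg_filtration J" by (rule mpoly_filtration)
interpretation M: fgl_filtration mconst J "deg_filtration J" \<iota> H n a
  using \<iota> H n by unfold_locales

lemma mvar_mem: "mvar i \<in> deg_filtration J 1"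
  by (auto simp: deg_filtration_def mvar_def lookup_single when_def total_deg_def)

lemma defect_lookup:
  assumes "u \<in> deg_filtration J 1" "v \<in> deg_filtration J 1" "total_deg m \<le> d"
  shows "Poly_Mapping.lookup (M.defect u v) m -
    (\<Sum>s\<le>d. Poly_Mapping.lookup (mconst (c s) * u ^ s * v ^ (d - s)) m) \<in> J"
  using M.defect_leading[OF zero small assms(1,2)] assms(3)
  by (simp add: deg_filtration_def lookup_minus lookup_sum c_def)

lemma lookup_form_12: "Poly_Mapping.lookup (mconst (b::'a) * mvar 1 ^ s * mvar 2 ^ t) m =
    (if m = monom3 s t 0 then b else 0)"
  using mconst_monom3[of b s t 0] by (auto simp: lookup_single when_def)

text \<open>Setting \<open>X = 0\<close> kills the defect, and since \<open>0 ^ s = 0\<close> except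
  at \<open>s = 0\<close> it leaves only the \<open>Y ^ d\<close> term of the leading form.\<close>

lemma defect_coeff_zero: "c 0 \<in> J"
proof -
  have "Poly_Mapping.lookup (M.defect 0 (mvar 2)) (monom3 0 d 0) -
      (\<Sum>s\<le>d. Poly_Mapping.lookup (mconst (c s) * 0 ^ s * mvar 2 ^ (d - s)) (monom3 0 d 0)) \<in> J"
    by (intro defect_lookup mvar_mem M.F_zero) simp_all
  also have "(\<Sum>s\<le>d. Poly_Mapping.lookup (mconst (c s) * 0 ^ s * mvar 2 ^ (d - s)) (monom3 0 d 0)) =
      (\<Sum>s\<le>d. if s = 0 then c s else 0)"
  proof (intro sum.cong refl)
    fix s assume "s \<in> {..d}"
    show "Poly_Mapping.lookup (mconst (c s) * 0 ^ s * mvar 2 ^ (d - s)) (monom3 0 d 0) = (if s = 0 then c s else 0)"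
    proof (cases "s = 0")
      case True
      then show ?thesis using lookup_form_12[of "c 0" 0 d "monom3 0 d 0"] by simp
    qed (simp add: power_0_left)
  qed
  finally show ?thesis by (simp add: M.zero_defect)
qed

lemma defect_coeff_commute:
  assumes "s \<le> d"
  shows "c s - c (d - s) \<in> J"
proof -
  let ?m = "monom3 s (d - s) 0"
  have "Poly_Mapping.lookup (M.defect (mvar 2) (mvar 1)) ?m -
      (\<Sum>s\<le>d. Poly_Mapping.lookup (mconst (c s) * mvar 2 ^ s * mvar 1 ^ (d - s)) ?m) \<in> J"
    using assms by (intro defect_lookup mvar_mem) simp_all
  also have "(\<Sum>s\<le>d. Poly_Mapping.lookup (mconst (c s) * mvar 2 ^ s * mvar 1 ^ (d - s)) ?m) =
      (\<Sum>t\<le>d. if t = d - s then c t else 0)"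
  proof (intro sum.cong refl)
    fix t assume "t \<in> {..d}"
    have "mconst (c t) * mvar 2 ^ t * mvar 1 ^ (d - t) = mconst (c t) * mvar 1 ^ (d - t) * mvar 2 ^ t"
      by (simp add: mult_ac)
    then have "Poly_Mapping.lookup (mconst (c t) * mvar 2 ^ t * mvar 1 ^ (d - t)) ?m =
        (if ?m = monom3 (d - t) t 0 then c t else 0)"
      by (simp only: lookup_form_12)
    then show "Poly_Mapping.lookup (mconst (c t) * mvar 2 ^ t * mvar 1 ^ (d - t)) ?m =
        (if t = d - s then c t else 0)"
      using \<open>t \<in> {..d}\<close> assms by auto
  qed
  also have "\<dots> = c (d - s)" by simp
  also have "M.defect (mvar 2) (mvar 1) = M.defect (mvar 1) (mvar 2)" by (rule M.defect_commute)
  finally have 1: "Poly_Mapping.lookup (M.defect (mvar 1) (mvar 2)) ?m - c (d - s) \<in> J" .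
  have "Poly_Mapping.lookup (M.defect (mvar 1) (mvar 2)) ?m -
      (\<Sum>s\<le>d. Poly_Mapping.lookup (mconst (c s) * mvar 1 ^ s * mvar 2 ^ (d - s)) ?m) \<in> J"
    using assms by (intro defect_lookup mvar_mem) simp_all
  also have "(\<Sum>s\<le>d. Poly_Mapping.lookup (mconst (c s) * mvar 1 ^ s * mvar 2 ^ (d - s)) ?m) =
      (\<Sum>t\<le>d. if t = s then c t else 0)"
    unfolding lookup_form_12 by (intro sum.cong refl) auto
  also have "\<dots> = c s" using assms by simp
  finally show ?thesis using cong_trans[OF _ 1] diff_commute by blast
qed

text \<open>Compare the coefficients of \<open>X^i Y^(s-i) Z^(d-s)\<close> in the cocycle
  identity.\<close>

lemma defect_coeff_cocycle:
  assumes "0 < i" "i \<le> s" "s < d"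
  shows "of_nat (s choose i) * c s - of_nat ((d - i) choose (s - i)) * c i \<in> J"
proof -
  define m where "m = monom3 i (s - i) (d - s)"
  have m: "total_deg m \<le> d" using assms by (simp add: m_def)
  note [simp] = lookup_single when_def
  define T :: "'a mpoly \<Rightarrow> 'a mpoly \<Rightarrow> 'a"
    where "T u v = (\<Sum>s\<le>d. Poly_Mapping.lookup (mconst (c s) * u ^ s * v ^ (d - s)) m)" for u v
  have D: "Poly_Mapping.lookup (M.defect u v) m - T u v \<in> J"
    if "u \<in> deg_filtration J 1" "v \<in> deg_filtration J 1" for u v
    unfolding T_def using that m by (intro defect_lookup) simp_all
  \<comment> \<open>\<open>m\<close> contains \<open>Z\<close> because \<open>s < d\<close> and
    \<open>X\<close> because \<open>0 < i\<close>, so the defects at \<open>(X,Y)\<close> and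
    \<open>(Y,Z)\<close> do not contribute.\<close>
  have T12: "T (mvar 1) (mvar 2) = 0"
    unfolding T_def lookup_form_12 using assms by (intro sum.neutral) (auto simp: m_def)
  have f23: "mconst b * mvar 2 ^ t * mvar 3 ^ r = Poly_Mapping.single (monom3 0 t r) b" for b :: 'a and t r
    using mconst_monom3[of b 0 t r] by simp
  have T23: "T (mvar 2) (mvar 3) = 0"
    unfolding T_def f23 using assms by (intro sum.neutral) (auto simp: m_def)
  have e1: "Poly_Mapping.lookup (mconst (c t) * (mvar 1 + mvar 2) ^ t * mvar 3 ^ (d - t)) m =
      (if t = s then of_nat (s choose i) * c s else 0)" if "t \<le> d" for t
  proof -
    have expand: "mconst (c t) * (mvar 1 + mvar 2) ^ t * mvar 3 ^ (d - t) =
        (\<Sum>l\<le>t. mconst (of_nat (t choose l) * c t) * mvar 1 ^ l * mvar 2 ^ (t - l) * mvar 3 ^ (d - t))"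
      by (simp only: mconst_mult_binomial sum_distrib_right)
    have "Poly_Mapping.lookup (mconst (c t) * (mvar 1 + mvar 2) ^ t * mvar 3 ^ (d - t)) m =
        (\<Sum>l\<le>t. if l = i then (if t = s then of_nat (s choose i) * c s else 0) else 0)"
    proof (unfold expand lookup_sum mconst_monom3, intro sum.cong refl)
      fix l assume "l \<in> {..t}"
      have "t = s" if "d - t = d - s" using that \<open>t \<le> d\<close> assms by linarith
      then have "monom3 l (t - l) (d - t) = m \<longleftrightarrow> l = i \<and> t = s"
        unfolding m_def monom3_inject by blast
      then show "Poly_Mapping.lookup (Poly_Mapping.single (monom3 l (t - l) (d - t))
          (of_nat (t choose l) * c t)) m =
        (if l = i then (if t = s then of_nat (s choose i) * c s else 0) else 0)"
        by simp
    qed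
    also have "\<dots> = (if t = s then of_nat (s choose i) * c s else 0)" using assms by simp
    finally show ?thesis .
  qed
  have T1: "T (mvar 1 + mvar 2) (mvar 3) = of_nat (s choose i) * c s"
  proof -
    have "T (mvar 1 + mvar 2) (mvar 3) = (\<Sum>t\<le>d. if t = s then of_nat (s choose i) * c s else 0)"
      unfolding T_def by (intro sum.cong refl e1) simp
    then show ?thesis using assms by simp
  qed
  have e2: "Poly_Mapping.lookup (mconst (c t) * mvar 1 ^ t * (mvar 2 + mvar 3) ^ (d - t)) m =
      (if t = i then of_nat ((d - i) choose (s - i)) * c i else 0)" if "t \<le> d" for t
  proof -
    have expand: "mconst (c t) * mvar 1 ^ t * (mvar 2 + mvar 3) ^ (d - t) =
        (\<Sum>l\<le>d - t. mconst (of_nat ((d - t) choose l) * c t) * mvar 1 ^ t * mvar 2 ^ l * mvar 3 ^ (d - t - l))"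
      unfolding mult.assoc[of "mconst (c t)"] mult.commute[of "mvar 1 ^ t"]
      unfolding mult.assoc[symmetric] mconst_mult_binomial sum_distrib_right
      by (intro sum.cong refl) (simp only: ac_simps)
    have "Poly_Mapping.lookup (mconst (c t) * mvar 1 ^ t * (mvar 2 + mvar 3) ^ (d - t)) m =
        (\<Sum>l\<le>d - t. if l = s - i then (if t = i then of_nat ((d - i) choose (s - i)) * c i else 0) else 0)"
    proof (unfold expand lookup_sum mconst_monom3, intro sum.cong refl)
      fix l assume "l \<in> {..d - t}"
      have "d - t - l = d - s" if "t = i" "l = s - i" using that assms by linarith
      then have "monom3 t l (d - t - l) = m \<longleftrightarrow> t = i \<and> l = s - i"
        unfolding m_def monom3_inject by blast
      then show "Poly_Mapping.lookup (Poly_Mapping.single (monom3 t l (d - t - l))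
          (of_nat ((d - t) choose l) * c t)) m =
        (if l = s - i then (if t = i then of_nat ((d - i) choose (s - i)) * c i else 0) else 0)"
        by simp
    qed
    also have "\<dots> = (if t = i then of_nat ((d - i) choose (s - i)) * c i else 0)"
    proof (cases "t = i")
      case True
      have "s - i \<le> d - i" using assms by linarith
      then show ?thesis unfolding True by (simp only: sum.delta finite_atMost atMost_iff if_True simp_thms)
    next
      case False
      then show ?thesis by (simp only: if_False if_cancel sum.neutral_const)
    qed
    finally show ?thesis .
  qed
  have T2: "T (mvar 1) (mvar 2 + mvar 3) = of_nat ((d - i) choose (s - i)) * c i"
  proof -
    have "T (mvar 1) (mvar 2 + mvar 3) = (\<Sum>t\<le>d. if t = i then of_nat ((d - i) choose (s - i)) * c i else 0)"
      unfolding T_def by (intro sum.cong refl e2) simp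
    then show ?thesis using assms by simp
  qed
  define G where "G u v = Poly_Mapping.lookup (M.defect u v) m" for u v
  have K: "G (mvar 1) (mvar 2) + G (mvar 1 + mvar 2) (mvar 3) - G (mvar 2) (mvar 3)
      - G (mvar 1) (mvar 2 + mvar 3) \<in> J"
    using M.defect_cocycle[OF small d mvar_mem[of 1] mvar_mem[of 2] mvar_mem[of 3],
        unfolded deg_filtration_def mem_Collect_eq less_Suc_eq_le, rule_format, OF _ m]
    unfolding G_def lookup_add lookup_minus by blast
  have comb: "x1 + x2 - x3 - x4 - (x1 - 0) - (x2 - y) + (x3 - 0) + (x4 - z) = y - z"
    for x1 x2 x3 x4 y z :: 'a by simp
  note D = D[folded G_def]
  note D1 = D[of "mvar 1" "mvar 2", OF mvar_mem mvar_mem, unfolded T12]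
  note D2 = D[of "mvar 1 + mvar 2" "mvar 3", OF M.F_add[OF mvar_mem mvar_mem] mvar_mem, unfolded T1]
  note D3 = D[of "mvar 2" "mvar 3", OF mvar_mem mvar_mem, unfolded T23]
  note D4 = D[of "mvar 1" "mvar 2 + mvar 3", OF mvar_mem M.F_add[OF mvar_mem mvar_mem], unfolded T2]
  from add[OF add[OF diff[OF diff[OF K D1] D2] D3] D4]
  show ?thesis unfolding comb .
qed

end

end

lemma CHAR_eq_prime:
  assumes "prime p" "of_nat p = (0 :: 'a::comm_ring_1)"
  shows "CHAR('a) = p"
proof -
  have "CHAR('a) dvd p" using assms(2) of_nat_eq_0_iff_char_dvd by blast
  moreover have "CHAR('a) \<noteq> 1" by (simp add: CHAR_not_1)
  ultimately show ?thesis using assms(1) prime_nat_iff by blast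
qed

section \<open>The multiplication-by-\<open>p\<close> series\<close>

text \<open>A term with \<open>r + s > i\<close> has order above \<open>i\<close>. The truncation
  degree in \<open>fps_subst2\<close> varies with the coefficient, and this compares it with
  truncation at a fixed \<open>n\<close>.\<close>

lemma trunc_subst_fps_const_nth:
  fixes u :: "'k::comm_ring_1 fps"
  assumes "fps_nth u 0 = 0" "i \<le> n"
  shows "fps_nth (trunc_subst fps_const n H u fps_X) i = fps_nth (trunc_subst fps_const i H u fps_X) i"
proof -
  interpret type_ideal "{0::'k}" by unfold_locales auto
  interpret mult_filtration fps_const "{0::'k}" "ord_filtration {0}" by (rule fps_filtration)
  let ?S = "\<lambda>n::nat. {(r, s). r \<le> n \<and> s \<le> n - r}"
  let ?t = "\<lambda>r s. fps_nth (fps_const (fps_nth (fps_nth H r) s) * u ^ r * fps_X ^ s) i"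
  have *: "fps_nth (trunc_subst fps_const m H u fps_X) i = (\<Sum>(r, s)\<in>?S m. ?t r s)" for m
    unfolding trunc_subst_def fps_sum_nth by (subst sum.Sigma) (auto intro!: sum.cong)
  have fin: "finite (?S m)" for m
    by (rule finite_subset[of _ "{..m} \<times> {..m}"]) auto
  have **: "?t r s = 0" if "r + s > i" for r s
  proof -
    have "u \<in> ord_filtration {0} 1" "fps_X \<in> ord_filtration {0} 1"
      using assms by (auto simp: ord_filtration_def)
    then have "fps_const (fps_nth (fps_nth H r) s) * (u ^ r * fps_X ^ s) \<in> ord_filtration {0} (r + s)"
      by (intro F.mult F_mult F_power)
    then show ?thesis using that by (simp add: ord_filtration_def mult.assoc)
  qed
  have "(\<Sum>(r, s)\<in>?S n. ?t r s) = (\<Sum>(r, s)\<in>?S i. ?t r s)"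
  proof (intro sum.mono_neutral_right fin ballI)
    show "?S i \<subseteq> ?S n" using assms(2) by auto
    fix z assume z: "z \<in> ?S n - ?S i"
    then obtain r s where rs: "z = (r, s)" by (cases z)
    then have "i < r + s" using z by auto
    then show "(case z of (r, s) \<Rightarrow> ?t r s) = 0" unfolding rs prod.case by (rule **)
  qed
  then show ?thesis by (simp add: *)
qed

lemma fgl_mult_nth_0: "formal_group_law H \<Longrightarrow> fps_nth (fgl_mult H m) 0 = 0"
  by (induction H m rule: fgl_mult.induct)
    (simp_all add: fps_subst2_def trunc_subst_def formal_group_law_def)

context fgl_filtration
begin

lemma fmult_hom:
  assumes "is_type_hom E" "\<And>t. E (\<kappa> t) = \<kappa> t" "E 0 = 0"
  shows "E (fmult m u) = fmult m (E u)"
  by (induction m) (simp_all add: assms trunc_subst_hom[OF assms(1)])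

end

context
  fixes J :: "'a::idom set" and \<iota> :: "'k::comm_ring_1 \<Rightarrow> 'a" and H :: "'k fps fps" and n d p q :: nat and a :: "nat \<Rightarrow> 'a"
  assumes J: "type_ideal J" and \<iota>: "is_type_hom \<iota>" and H: "formal_group_law H" and n: "n \<ge> 1" and d: "d \<le> n" "d > 0"
    and small: "\<And>m. total_deg m < d \<Longrightarrow> Poly_Mapping.lookup (aut_defect \<iota> n H a) m \<in> J"
    and q: "q > 0" and pq: "fgl_mult H p = fps_X ^ q"
begin

interpretation type_ideal J by (rule J)
interpretation M: mult_filtration fps_const J "ord_filtration J" by (rule fps_filtration)
interpretation M: fgl_filtration fps_const J "ord_filtration J" \<iota> H n a
  using \<iota> H n by unfold_locales

text \<open>Agreement up to degree \<open>n\<close> survives sums and products, so the two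
  recursions can be followed together. The case \<open>m = 1\<close> is separate because
  \<open>fgl_mult\<close> sets it to \<open>fps_X\<close>, where \<open>fmult\<close> computes
  \<open>0 \<boxplus> fps_X\<close>.\<close>

lemma fmult_fps_X_nth: "i \<le> n \<Longrightarrow> fps_nth (M.fmult m fps_X) i = \<iota> (fps_nth (fgl_mult H m) i)"
proof (induction m arbitrary: i)
  case 0
  then show ?case by (simp add: type_homD[OF \<iota>])
next
  case (Suc m)
  show ?case
  proof (cases m)
    case 0
    then show ?thesis by (simp add: M.zero_fadd type_homD[OF \<iota>])
  next
    case (Suc m')
  define agree where "agree g g' \<longleftrightarrow> (\<forall>j\<le>n. fps_nth g j = \<iota> (fps_nth g' j))" for g g'
  have mult: "agree (g * h) (g' * h')" if "agree g g'" "agree h h'" for g h g' h'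
    using that by (auto simp: agree_def fps_mult_nth type_hom_sum[OF \<iota>] type_homD[OF \<iota>])
  have one: "agree 1 1" by (simp add: agree_def type_homD[OF \<iota>])
  have power: "agree (g ^ k) (g' ^ k)" if "agree g g'" for g g' k
    using that by (induction k) (auto intro: mult one)
  have sum: "agree (sum g A) (sum g' A)" if "\<And>x. x \<in> A \<Longrightarrow> agree (g x) (g' x)"
    for g g' and A :: "nat set"
    using that by (simp add: agree_def fps_sum_nth type_hom_sum[OF \<iota>])
  have const: "agree (fps_const (\<iota> t)) (fps_const t)" for t
    by (simp add: agree_def type_homD[OF \<iota>])
  have "agree fps_X fps_X" by (simp add: agree_def type_homD[OF \<iota>])
  moreover have "agree (M.fmult m fps_X) (fgl_mult H m)"
    using Suc.IH by (simp add: agree_def)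
  ultimately have "agree (M.fadd (M.fmult m fps_X) fps_X)
      (trunc_subst fps_const n H (fgl_mult H m) fps_X)"
    unfolding trunc_subst_def by (intro sum mult const power)
  then show ?thesis
    using Suc.prems Suc trunc_subst_fps_const_nth[OF fgl_mult_nth_0[OF H], of i n H m]
    by (simp add: agree_def fps_subst2_def)
  qed
qed

text \<open>Composition with \<open>u\<close> is a ring homomorphism fixing constants, so it
  commutes with \<open>fmult\<close> and carries \<open>[p](T) = T^q\<close>, known up to degree
  \<open>n\<close>, from \<open>T\<close> to \<open>u\<close>. The case \<open>u = f(T)\<close> is
  the one of interest.\<close>

lemma fmult_frobenius:
  assumes "fps_nth u 0 = 0"
  shows "M.fmult p u - u ^ q \<in> ord_filtration J (Suc n)"
proof -
  let ?E = "\<lambda>g. fps_compose g u"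
  have E: "is_type_hom ?E"
    using assms by (intro type_homI) (simp_all add: fps_compose_add_distrib fps_compose_mult_distrib)
  have c: "?E (fps_const t) = fps_const t" for t by simp
  have z: "?E 0 = 0" by simp
  have "fps_nth (M.fmult p fps_X - fps_X ^ q) i = 0" if "i \<le> n" for i
    using fmult_fps_X_nth[OF that, of p] by (simp add: pq type_homD[OF \<iota>])
  then have "fps_nth (?E (M.fmult p fps_X - fps_X ^ q)) i = 0" if "i \<le> n" for i
    using that by (simp add: fps_compose_nth)
  moreover have "?E (M.fmult p fps_X - fps_X ^ q) = M.fmult p u - u ^ q"
    using M.fmult_hom[OF E c z, of p fps_X]
    by (simp add: type_homD[OF E] type_hom_power[OF E] assms)
  ultimately show ?thesis by (simp add: ord_filtration_def)
qed

text \<open>By the freshman's dream \<open>f(T)^q\<close> is the sum of the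
  \<open>a_i^q T^(i q)\<close>, so it lives in the same degrees as \<open>f(T^q)\<close>.\<close>

lemma curve_frobenius:
  assumes p: "prime p" "of_nat p = (0 :: 'a)" and qp: "q = p ^ h"
  shows "fps_nth (M.curve (fps_X ^ q) - M.curve fps_X ^ q) d =
    (if q dvd d then a (d div q) - a (d div q) ^ q else 0)"
proof -
  have ch: "CHAR('a fps) = p" using CHAR_eq_prime[OF p] by simp
  have "M.curve fps_X ^ q = (\<Sum>i=1..n. (fps_const (a i) * fps_X ^ i) ^ q)"
    unfolding M.curve_def by (rule freshmans_dream_sum') (use ch p qp in auto)
  also have "\<dots> = (\<Sum>i=1..n. fps_const (a i ^ q) * fps_X ^ (i * q))"
    by (simp add: power_mult_distrib power_mult fps_const_power)
  also have "fps_nth \<dots> d = (\<Sum>i=1..n. if d = i * q then a i ^ q else 0)"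
    by (simp add: fps_sum_nth) (intro sum.cong, auto)
  finally have "fps_nth (M.curve (fps_X ^ q) - M.curve fps_X ^ q) d =
      (\<Sum>i=1..n. if d = i * q then a i - a i ^ q else 0)"
    by (simp add: M.curve_def fps_sum_nth mult.commute[of q] flip: power_mult sum_subtractf)
      (intro sum.cong, auto)
  also have "\<dots> = (if q dvd d then a (d div q) - a (d div q) ^ q else 0)"
  proof (cases "q dvd d")
    case True
    then obtain i where i: "d = i * q" by (metis dvd_mult_div_cancel mult.commute)
    then have "i \<in> {1..n}" using d q by (auto simp: Suc_le_eq intro: le_trans[of i "i * q"])
    moreover have "(\<Sum>j=1..n. if d = j * q then a j - a j ^ q else 0) =
        (\<Sum>j=1..n. if j = i then a j - a j ^ q else 0)"
      using i q by (intro sum.cong) auto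
    ultimately show ?thesis using i q by simp
  next
    case False
    then show ?thesis by (auto intro!: sum.neutral)
  qed
  finally show ?thesis .
qed

text \<open>In leading degree the defect at \<open>(i T, T)\<close> is \<open>T ^ d\<close> times
  the sum of the \<open>c s * of_nat i ^ s\<close>. Over \<open>i < p\<close> these add up to
  \<open>f([p](T)) - [p](f(T))\<close>, which is known from \<open>[p](T) = T^q\<close>.\<close>

lemma defect_coeff_power_sum:
  assumes p: "prime p" "of_nat p = (0 :: 'a)" and qp: "q = p ^ h"
  defines "c \<equiv> \<lambda>s. Poly_Mapping.lookup (aut_defect \<iota> n H a) (monom3 s (d - s) 0)"
  shows "(\<Sum>s\<le>d. c s * (\<Sum>i<p. of_nat i ^ s)) -
    (if q dvd d then a (d div q) - a (d div q) ^ q else 0) \<in> J"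
proof -
  let ?F = "ord_filtration J"
  have X: "fps_X \<in> ?F 1" by (simp add: ord_filtration_def)
  have nd: "Suc d \<le> Suc n" using d by simp
  have C0: "fps_nth (M.curve fps_X) 0 = 0" by (simp add: M.curve_def fps_sum_nth)
  have Xq: "fps_X ^ q \<in> ?F 1" using q by (simp add: ord_filtration_def)
  define S where "S = (\<Sum>i<p. M.defect (of_nat i * fps_X) fps_X)"
  have 1: "M.curve (M.fmult p fps_X) - M.fmult p (M.curve fps_X) - S \<in> ?F (Suc d)"
    unfolding S_def by (rule M.curve_fmult[OF small X])
  have 2: "M.curve (M.fmult p fps_X) - M.curve (fps_X ^ q) \<in> ?F (Suc d)"
    by (intro M.F_mono[OF M.curve_diff[OF _ _ fmult_frobenius] nd] M.fmult_mem X Xq) simp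
  have 3: "M.fmult p (M.curve fps_X) - M.curve fps_X ^ q \<in> ?F (Suc d)"
    by (rule M.F_mono[OF fmult_frobenius[OF C0] nd])
  have 4: "S - (\<Sum>i<p. \<Sum>s\<le>d. fps_const (c s) * (of_nat i * fps_X) ^ s * fps_X ^ (d - s)) \<in> ?F (Suc d)"
    unfolding S_def sum_subtractf[symmetric] c_def
    by (intro M.F.sum M.defect_leading[OF zero small] M.F.mult X)
  have 5: "(\<Sum>i<p. \<Sum>s\<le>d. fps_const (c s) * (of_nat i * fps_X) ^ s * fps_X ^ (d - s)) =
      fps_const (\<Sum>s\<le>d. c s * (\<Sum>i<p. of_nat i ^ s)) * fps_X ^ d"
  proof -
    have "(\<Sum>i<p. \<Sum>s\<le>d. fps_const (c s) * (of_nat i * fps_X) ^ s * fps_X ^ (d - s)) =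
        (\<Sum>i<p. \<Sum>s\<le>d. fps_const (c s * of_nat i ^ s) * fps_X ^ d)"
    proof (intro sum.cong refl)
      fix i s assume "s \<in> {..d}"
      then have "(fps_X :: 'a fps) ^ d = fps_X ^ s * fps_X ^ (d - s)" by (simp flip: power_add)
      then show "fps_const (c s) * (of_nat i * fps_X) ^ s * fps_X ^ (d - s) =
          fps_const (c s * of_nat i ^ s) * fps_X ^ d"
        by (simp add: power_mult_distrib fps_of_nat[symmetric] fps_const_power mult_ac
            flip: fps_const_mult)
    qed
    also have "\<dots> = (\<Sum>s\<le>d. \<Sum>i<p. fps_const (c s * of_nat i ^ s) * fps_X ^ d)"
      by (rule sum.swap)
    also have "\<dots> = fps_const (\<Sum>s\<le>d. c s * (\<Sum>i<p. of_nat i ^ s)) * fps_X ^ d"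
      by (simp add: sum_distrib_left sum_distrib_right type_hom_sum[OF M.hom])
    finally show ?thesis .
  qed
  define W where "W = (\<Sum>s\<le>d. c s * (\<Sum>i<p. of_nat i ^ s))"
  have "(M.curve (fps_X ^ q) - M.curve fps_X ^ q) - fps_const W * fps_X ^ d \<in> ?F (Suc d)"
  proof -
    have "(M.curve (M.fmult p fps_X) - M.fmult p (M.curve fps_X) - S)
      - (M.curve (M.fmult p fps_X) - M.curve (fps_X ^ q))
      + (M.fmult p (M.curve fps_X) - M.curve fps_X ^ q) + (S - fps_const W * fps_X ^ d) \<in> ?F (Suc d)"
      using M.F_add[OF M.F_add[OF M.F.diff[OF 1 2] 3] 4] unfolding 5 W_def .
    then show ?thesis by (simp add: algebra_simps)
  qed
  then have "fps_nth (M.curve (fps_X ^ q) - M.curve fps_X ^ q) d - W \<in> J"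
    by (auto simp: ord_filtration_def dest: spec[of _ d])
  then show ?thesis
    unfolding curve_frobenius[OF p qp] W_def by (rule diff_commute[THEN iffD1])
qed

end

section \<open>The equations of the automorphism scheme\<close>

context
  fixes J :: "'a::idom set"
    and \<iota> :: "'p::prime_card mod_ring \<Rightarrow> 'a" and H :: "'p mod_ring fps fps" and n p h q :: nat
    and a :: "nat \<Rightarrow> 'a"
  assumes J: "type_ideal J" and \<iota>: "is_type_hom \<iota>" and H: "formal_group_law H" and n: "n \<ge> 1"
    and p: "p = CARD('p)" and q: "q = p ^ h" and pq: "fgl_mult H p = fps_X ^ q"
begin

interpretation type_ideal J by (rule J)

abbreviation defect_poly where "defect_poly \<equiv> aut_defect \<iota> n H a"

abbreviation defect_coeff :: "nat \<Rightarrow> nat \<Rightarrow> 'a" where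
  "defect_coeff d s \<equiv> Poly_Mapping.lookup defect_poly (monom3 s (d - s) 0)"

lemma p_prime: "prime p" using prime_card p by simp

lemma of_nat_p: "of_nat p = (0::'a)"
  using type_hom_of_nat[OF \<iota>, of p] by (simp add: p type_homD[OF \<iota>])

lemma q_pos: "q > 0" using p_prime q prime_gt_0_nat by simp

context
  fixes d :: nat
  assumes d: "d \<le> n" "0 < d" and small: "\<And>m. total_deg m < d \<Longrightarrow> Poly_Mapping.lookup defect_poly m \<in> J"
begin

lemmas coeff_zero = defect_coeff_zero[OF \<iota> H n d(1) small]
lemmas coeff_commute = defect_coeff_commute[OF \<iota> H n d(1) small]
lemmas coeff_cocycle = defect_coeff_cocycle[OF \<iota> H n d(1) small]

lemma coeff_ends: "defect_coeff d 0 \<in> J" "defect_coeff d d \<in> J"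
  using coeff_zero cong_mem[OF coeff_commute[of 0]] by simp_all

lemma coeffs_vanish:
  assumes "p ^ v dvd d" "d div p ^ v > 1" "\<not> p dvd d div p ^ v \<or> d = p ^ Suc v"
    and "defect_coeff d (p ^ v) \<in> J" "s \<le> d"
  shows "defect_coeff d s \<in> J"
proof (cases "0 < s \<and> s < d")
  case True
  then show ?thesis
    by (intro symmetric_cocycle_vanishes[where c = "defect_coeff d", OF p_prime of_nat_p _ _ assms(1-4)]
        coeff_commute coeff_cocycle) simp_all
next
  case False
  then show ?thesis using assms(5) coeff_ends by (metis antisym_conv2 neq0_conv)
qed

lemma power_sum_mem:
  assumes "q dvd d \<Longrightarrow> a (d div q) - a (d div q) ^ q \<in> J"
  shows "(\<Sum>s\<le>d. defect_coeff d s * (\<Sum>i<p. of_nat i ^ s)) \<in> J"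
  using cong_mem[OF defect_coeff_power_sum[OF J \<iota> H n d small q_pos pq p_prime of_nat_p q]] assms
  by auto

lemma frobenius_fixed:
  assumes "\<And>s. s \<le> d \<Longrightarrow> defect_coeff d s \<in> J" "q dvd d"
  shows "a (d div q) - a (d div q) ^ q \<in> J"
proof -
  have "(\<Sum>s\<le>d. defect_coeff d s * (\<Sum>i<p. of_nat i ^ s)) \<in> J"
    using assms(1) by (intro sum mult_right) simp
  then show ?thesis
    using cong_mem[OF defect_coeff_power_sum[OF J \<iota> H n d small q_pos pq p_prime of_nat_p q]] assms(2)
    by simp
qed

text \<open>Only multiples \<open>s = t * p ^ k\<close> escape
  \<open>cocycle_vanishes_off_multiples\<close>, and their power sums vanish unless
  \<open>t = p - 1\<close>. Modulo \<open>J\<close> the total is thus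
  \<open>- defect_coeff d r\<close> with \<open>r = d - p ^ k\<close>; symmetry moves this to
  \<open>p ^ k\<close>, the coefficient that determines all others.\<close>

lemma coeffs_vanish_prime_power:
  assumes dk: "d = p ^ Suc k" and fix_q: "q dvd d \<Longrightarrow> a (d div q) - a (d div q) ^ q \<in> J" and "s \<le> d"
  shows "defect_coeff d s \<in> J"
proof -
  have p1: "p > 1" using p_prime prime_gt_1_nat by blast
  have pk: "p ^ k > 0" using p1 by simp
  define r where "r = (p - 1) * p ^ k"
  have r: "r + p ^ k = d" "0 < r" "r < d"
    using p1 by (auto simp: r_def dk algebra_simps diff_mult_distrib)
  have v: "p ^ k dvd d" "d div p ^ k > 1" using p1 by (simp_all add: dk)
  have summand: "defect_coeff d s * (\<Sum>i<p. of_nat i ^ s) - (if s = r then - defect_coeff d s else 0) \<in> J" if "s \<le> d" for s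
  proof (cases "0 < s \<and> s < d \<and> p ^ k dvd s")
    case True
    then obtain t where t: "s = t * p ^ k" by (metis dvd_div_mult_self)
    have "0 < t" "t < p" using True t pk by (auto simp: dk)
    have "(\<Sum>i<p. of_nat i ^ s) = (\<Sum>i=1..<p. (of_nat i :: 'a) ^ s)"
      using True p1 by (simp add: lessThan_atLeast0 sum.atLeast_Suc_lessThan)
    also have "\<dots> = \<iota> (\<Sum>i=1..<p. of_nat i ^ s)"
      by (simp add: type_hom_sum[OF \<iota>] type_hom_power[OF \<iota>] type_hom_of_nat[OF \<iota>])
    also have "\<dots> = \<iota> (if t = p - 1 then - 1 else 0)"
      using fermat_power_sum[of t k, where 'p = 'p] \<open>0 < t\<close> \<open>t < p\<close> by (simp add: t p)
    also have "\<dots> = (if s = r then - 1 else 0)"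
      using pk by (simp add: t r_def type_homD[OF \<iota>])
    finally show ?thesis by simp
  next
    case False
    have "s \<noteq> r" using False r by (auto simp: r_def)
    moreover have "defect_coeff d s \<in> J"
    proof (cases "0 < s \<and> s < d")
      case True
      then show ?thesis
        using False by (intro cocycle_vanishes_off_multiples[where c = "defect_coeff d", OF p_prime of_nat_p _ _ v]
            coeff_commute coeff_cocycle) simp_all
    next
      case False
      then show ?thesis using that coeff_ends by (metis antisym_conv2 neq0_conv)
    qed
    ultimately show ?thesis by (simp add: mult_right)
  qed
  have "(\<Sum>s\<le>d. defect_coeff d s * (\<Sum>i<p. of_nat i ^ s)) - (\<Sum>s\<le>d. if s = r then - defect_coeff d s else 0) \<in> J"
    unfolding sum_subtractf[symmetric] by (intro sum summand) simp
  then have "defect_coeff d r \<in> J"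
    using cong_mem power_sum_mem[OF fix_q] r by fastforce
  moreover have "d - r = p ^ k" using r by simp
  ultimately have "defect_coeff d (p ^ k) \<in> J"
    using cong_mem[OF coeff_commute[of r]] r by simp
  then show ?thesis using coeffs_vanish[OF v] dk \<open>s \<le> d\<close> by blast
qed

end

lemma lookup_defect_mem:
  assumes "\<And>s. s \<le> total_deg m \<Longrightarrow> defect_coeff (total_deg m) s \<in> J"
  shows "Poly_Mapping.lookup defect_poly m \<in> J"
proof (cases "Poly_Mapping.keys m \<subseteq> {1, 2}")
  case True
  then obtain s t where "m = monom3 s t 0" using monom3_eq by blast
  then show ?thesis using assms[of s] by simp
next
  case False
  then have "Poly_Mapping.lookup defect_poly m = 0"
    using mvars_aut_defect by (intro lookup_not_mvars) blast
  then show ?thesis by simp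
qed

text \<open>Strong induction on the degree: once the lower degrees lie in \<open>J\<close>, the part
  of degree \<open>d\<close> is a cocycle modulo \<open>J\<close>, and the hypotheses supply the one
  coefficient or the one Frobenius equation that decides it.\<close>

lemma defect_mem_ideal:
  assumes nonpower: "\<And>d v. d \<le> n \<Longrightarrow> p ^ v dvd d \<Longrightarrow> d div p ^ v > 1 \<Longrightarrow> \<not> p dvd d div p ^ v \<Longrightarrow>
      defect_coeff d (p ^ v) \<in> J"
    and fix_q: "\<And>k. p ^ k * q \<le> n \<Longrightarrow> a (p ^ k) - a (p ^ k) ^ q \<in> J"
    and "total_deg m \<le> n"
  shows "Poly_Mapping.lookup defect_poly m \<in> J"
  using assms(3)
proof (induction "total_deg m" arbitrary: m rule: less_induct)
  case less
  define d where "d = total_deg m"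
  have d: "d \<le> n" using less.prems by (simp add: d_def)
  have small: "Poly_Mapping.lookup defect_poly m' \<in> J" if "total_deg m' < d" for m'
    using less.hyps[of m'] that less.prems by (simp add: d_def)
  have "defect_coeff d s \<in> J" if "s \<le> d" for s
  proof (cases "d = 0")
    case True
    then show ?thesis using defect_coeff_zero[OF \<iota> H n d small] that by simp
  next
    case False
    define v where "v = multiplicity p d"
    have nu: "\<not> is_unit p" using p_prime not_prime_unit by blast
    have v: "p ^ v dvd d" "\<not> p dvd d div p ^ v"
      using False nu by (simp_all add: v_def multiplicity_dvd multiplicity_decompose)
    then have "d div p ^ v \<noteq> 0" using False by (metis dvd_0_right)
    show ?thesis
    proof (cases "d div p ^ v = 1")
      case False
      then have "d div p ^ v > 1" using \<open>d div p ^ v \<noteq> 0\<close> by simp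
      then show ?thesis
        using coeffs_vanish[OF d _ small v(1) _ _ nonpower[OF d v(1) _ v(2)] that] v \<open>d \<noteq> 0\<close> by simp
    next
      case True
      then have dv: "d = p ^ v" using v(1) by (metis dvd_div_mult_self mult_1)
      show ?thesis
      proof (cases v)
        \<comment> \<open>In degree 1 the form has only its two end coefficients.\<close>
        case 0
        then have "s = 0 \<or> s = d" using that dv by auto
        then show ?thesis using coeff_ends[OF d _ small] \<open>d \<noteq> 0\<close> by auto
      next
        case (Suc k)
        have "a (d div q) - a (d div q) ^ q \<in> J" if "q dvd d"
        proof -
          have "h \<le> v" using that p_prime dv q
            by (metis power_dvd_imp_le prime_gt_1_nat)
          then have pd: "p ^ (v - h) * q = d"
            by (simp add: dv q flip: power_add)
          then have "d div q = p ^ (v - h)" using q_pos by auto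
          then show ?thesis using fix_q[of "v - h"] d pd by simp
        qed
        then show ?thesis
          using coeffs_vanish_prime_power[OF d _ small _ _ \<open>s \<le> d\<close>, of k] \<open>d \<noteq> 0\<close> dv Suc by simp
      qed
    qed
  qed
  then show ?case unfolding d_def by (rule lookup_defect_mem)
qed

text \<open>The power sum identity in degree \<open>i * q\<close>, read backwards: if all
  coefficients lie in \<open>J\<close>, so does the right-hand side.\<close>

lemma frobenius_relation:
  assumes "\<And>m. total_deg m \<le> n \<Longrightarrow> Poly_Mapping.lookup defect_poly m \<in> J" "i * q \<le> n" "i > 0"
  shows "a i - a i ^ q \<in> J"
proof -
  have "a (i * q div q) - a (i * q div q) ^ q \<in> J"
    using assms q_pos by (intro frobenius_fixed[of "i * q"]) auto
  then show ?thesis using q_pos by simp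
qed

end

section \<open>Presented algebras\<close>

lemma type_hom_prod:
  assumes "is_type_hom \<iota>" shows "\<iota> (prod f A) = (\<Prod>i\<in>A. \<iota> (f i))"
  by (induction A rule: infinite_finite_induct) (auto simp: type_homD[OF assms])

lemma mpoly_eval_cong:
  assumes "\<And>i. i \<in> mvars P \<Longrightarrow> x i = y i"
  shows "mpoly_eval \<iota> x P = mpoly_eval \<iota> y P"
  unfolding mpoly_eval_def
  by (intro sum.cong prod.cong refl arg_cong2[where f = "(*)"] arg_cong2[where f = power] assms)
    (auto simp: mvars_def)

lemma mpoly_eval_mconst_mvar: "mpoly_eval mconst mvar P = P"
  unfolding mpoly_eval_def mpoly_single_eq[symmetric] by (rule mpoly_as_sum[symmetric])

lemma mvars_mpoly_eval:
  assumes "\<And>i. i \<in> mvars P \<Longrightarrow> mvars (x i) \<subseteq> V"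
  shows "mvars (mpoly_eval mconst x P) \<subseteq> V"
  unfolding mpoly_eval_def
  by (intro mvars_sum mvars_mult_subset mvars_prod mvars_power assms) (simp, auto simp: mvars_def)

lemma preimage_ideal:
  assumes E: "is_type_hom E" and V: "\<And>x. mvars x \<subseteq> V \<Longrightarrow> mvars (E x) \<subseteq> V'"
    and I: "ideal I (mpoly_ring V')"
  shows "ideal {x. mvars x \<subseteq> V \<and> E x \<in> I} (mpoly_ring V)"
proof -
  interpret R: cring "mpoly_ring V" by (rule mpoly_ring_cring)
  interpret I: ideal I "mpoly_ring V'" by (rule I)
  have I_zero: "0 \<in> I" using additive_subgroup.zero_closed[OF ideal.axioms(1)[OF I]] by simp
  have I_add: "x + y \<in> I" if "x \<in> I" "y \<in> I" for x y
    using additive_subgroup.a_closed[OF ideal.axioms(1)[OF I] that] by simp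
  have neg: "- x \<in> I" if "x \<in> I" for x
  proof -
    have "- 1 * x \<in> I" using I.I_l_closed[OF that, of "- 1"] by simp
    then show ?thesis by simp
  qed
  show ?thesis
  proof (rule idealI)
    show "ring (mpoly_ring V)" by (rule R.ring_axioms)
    show "subgroup {x. mvars x \<subseteq> V \<and> E x \<in> I} (add_monoid (mpoly_ring V))"
    proof
      fix x assume x: "x \<in> {x. mvars x \<subseteq> V \<and> E x \<in> I}"
      have "a_inv (mpoly_ring V) x = - x"
        using x by (intro R.minus_equality) auto
      then show "inv\<^bsub>add_monoid (mpoly_ring V)\<^esub> x \<in> {x. mvars x \<subseteq> V \<and> E x \<in> I}"
        using x neg by (simp add: a_inv_def type_homD[OF E])
    next
      fix x y assume "x \<in> {x. mvars x \<subseteq> V \<and> E x \<in> I}" "y \<in> {x. mvars x \<subseteq> V \<and> E x \<in> I}"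
      then show "x \<otimes>\<^bsub>add_monoid (mpoly_ring V)\<^esub> y \<in> {x. mvars x \<subseteq> V \<and> E x \<in> I}"
        using mvars_add[of x y] I_add[of "E x" "E y"] by (auto simp: type_homD[OF E])
    qed (use I_zero in \<open>auto simp: type_homD[OF E]\<close>)
  qed (use I.I_l_closed I.I_r_closed V in \<open>auto simp: type_homD[OF E] mvars_mult_subset\<close>)
qed

definition restrict_vars :: "nat set \<Rightarrow> 'a::comm_ring_1 mpoly \<Rightarrow> 'a mpoly" where
  "restrict_vars V = mpoly_eval mconst (\<lambda>i. if i \<in> V then mvar i else 0)"

lemma restrict_vars_hom: "is_type_hom (restrict_vars V)"
  unfolding restrict_vars_def by (rule mpoly_eval_hom[OF mconst_hom])

lemma mvars_restrict_vars: "mvars (restrict_vars V (P :: 'a::comm_ring_1 mpoly)) \<subseteq> V"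
proof -
  have "mvars (if i \<in> V then mvar i else 0 :: 'a mpoly) \<subseteq> V" for i
    using mvars_mvar[of i, where 'a = 'a] by auto
  then show ?thesis unfolding restrict_vars_def by (intro mvars_mpoly_eval)
qed

lemma restrict_vars_id:
  assumes "mvars P \<subseteq> V" shows "restrict_vars V P = P"
proof -
  have "restrict_vars V P = mpoly_eval mconst mvar P"
    unfolding restrict_vars_def using assms by (intro mpoly_eval_cong) auto
  then show ?thesis by (simp add: mpoly_eval_mconst_mvar)
qed

text \<open>An ideal of \<open>mpoly_ring V\<close> need not be closed under multiplication by
  polynomials in other variables. Its preimage under the retraction that kills those variables is,
  and it meets the polynomials in \<open>V\<close> in \<open>I\<close> itself.\<close>

lemma restrict_vars_type_ideal:
  assumes "ideal I (mpoly_ring V)"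
  shows "type_ideal {x. restrict_vars V x \<in> I}"
proof -
  interpret I: ideal I "mpoly_ring V" by (rule assms)
  show ?thesis
  proof
    show "0 \<in> {x. restrict_vars V x \<in> I}"
      using additive_subgroup.zero_closed[OF ideal.axioms(1)[OF assms]]
      by (simp add: type_homD[OF restrict_vars_hom])
    show "x + y \<in> {x. restrict_vars V x \<in> I}"
      if "x \<in> {x. restrict_vars V x \<in> I}" "y \<in> {x. restrict_vars V x \<in> I}" for x y
      using that additive_subgroup.a_closed[OF ideal.axioms(1)[OF assms],
          of "restrict_vars V x" "restrict_vars V y"]
      by (simp add: type_homD[OF restrict_vars_hom])
    show "r * x \<in> {x. restrict_vars V x \<in> I}" if "x \<in> {x. restrict_vars V x \<in> I}" for x r
      using that I.I_l_closed[of "restrict_vars V x" "restrict_vars V r"] mvars_restrict_vars[of V r]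
      by (simp add: type_homD[OF restrict_vars_hom])
  qed
qed

locale presentation =
  fixes V :: "nat set" and G :: "'a::comm_ring_1 mpoly set"
  assumes G: "G \<subseteq> carrier (mpoly_ring V)"
begin

abbreviation "J \<equiv> genideal (mpoly_ring V) G"
abbreviation "cl \<equiv> presented_class V G"
abbreviation "Q \<equiv> presented_ring V G"

sublocale R: cring "mpoly_ring V" by (rule mpoly_ring_cring)

lemma J_ideal: "ideal J (mpoly_ring V)"
  using G by (rule R.genideal_ideal)

sublocale J: ideal J "mpoly_ring V" by (rule J_ideal)

lemma generator_mem: "g \<in> G \<Longrightarrow> g \<in> J"
  using R.genideal_self[OF G] by blast

lemma zero_mem: "0 \<in> J"
  using additive_subgroup.zero_closed[OF ideal.axioms(1)[OF J_ideal]] by simp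

lemma cring_Q: "cring Q"
  unfolding presented_ring_def by (rule J.quotient_is_cring) (rule mpoly_ring_cring)

lemma carrier_Q: "carrier Q = cl ` {p. mvars p \<subseteq> V}"
  by (auto simp: presented_ring_def presented_class_def FactRing_def A_RCOSETS_def')

lemma cl_mult: "mvars p \<subseteq> V \<Longrightarrow> mvars q \<subseteq> V \<Longrightarrow> cl p \<otimes>\<^bsub>Q\<^esub> cl q = cl (p * q)"
  using J.rcoset_mult_add[of p q] by (simp add: presented_ring_def presented_class_def FactRing_def)

lemma cl_add: "mvars p \<subseteq> V \<Longrightarrow> mvars q \<subseteq> V \<Longrightarrow> cl p \<oplus>\<^bsub>Q\<^esub> cl q = cl (p + q)"
  using J.a_rcos_sum[of p q] by (simp add: presented_ring_def presented_class_def FactRing_def)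

lemma cl_one: "\<one>\<^bsub>Q\<^esub> = cl 1"
  by (simp add: presented_ring_def presented_class_def FactRing_def)

lemma cl_zero: "\<zero>\<^bsub>Q\<^esub> = cl 0"
  using J.a_rcos_const[OF zero_mem] by (simp add: presented_ring_def presented_class_def FactRing_def)

lemma cl_eq_set: "cl p = {x + p |x. x \<in> J}"
  by (simp add: presented_class_def a_r_coset_def') blast

lemma cl_eq_iff:
  assumes "mvars p \<subseteq> V" "mvars q \<subseteq> V"
  shows "cl p = cl q \<longleftrightarrow> p - q \<in> J"
proof
  assume "cl p = cl q"
  moreover have "p \<in> cl p" using zero_mem by (force simp: cl_eq_set)
  ultimately show "p - q \<in> J" by (auto simp: cl_eq_set)
next
  assume pq: "p - q \<in> J"
  have "cl (p - q) = cl 0"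
    using J.a_rcos_const[OF pq] J.a_rcos_const[OF zero_mem] by (simp add: presented_class_def)
  moreover have "mvars (p - q) \<subseteq> V" using J.a_subset pq by auto
  ultimately have "cl (p - q + q) = cl (0 + q)"
    using cl_add[of "p - q" q] cl_add[of 0 q] assms by simp
  then show "cl p = cl q" by simp
qed

lemma cl_mconst_hom: "(\<lambda>t. cl (mconst t)) \<in> Ring.ring_hom ring_of_type_algebra Q"
  by (rule ring_hom_memI)
    (auto simp: ring_of_type_algebra_def carrier_Q cl_mult cl_add cl_one mconst_1
      type_homD[OF mconst_hom])

end

lemma genideal_subset_preimage:
  assumes E: "is_type_hom E" and V: "\<And>x. mvars x \<subseteq> V \<Longrightarrow> mvars (E x) \<subseteq> V'"
    and I: "ideal I (mpoly_ring V')" and G: "G \<subseteq> carrier (mpoly_ring V)" "E ` G \<subseteq> I"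
  shows "E ` genideal (mpoly_ring V) G \<subseteq> I"
proof -
  interpret R: cring "mpoly_ring V" by (rule mpoly_ring_cring)
  have "genideal (mpoly_ring V) G \<subseteq> {x. mvars x \<subseteq> V \<and> E x \<in> I}"
    using G by (intro R.genideal_minimal preimage_ideal[OF E V I]) auto
  then show ?thesis by blast
qed

section \<open>Permuting the variables of a presentation\<close>

definition rename_vars :: "(nat \<Rightarrow> nat) \<Rightarrow> 'a::comm_ring_1 mpoly \<Rightarrow> 'a mpoly" where
  "rename_vars \<tau> = mpoly_eval mconst (\<lambda>i. mvar (\<tau> i))"

lemma rename_vars_hom: "is_type_hom (rename_vars \<tau>)"
  unfolding rename_vars_def by (rule mpoly_eval_hom[OF mconst_hom])

lemma rename_vars_mconst [simp]: "rename_vars \<tau> (mconst c) = mconst c"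
  by (simp add: rename_vars_def mpoly_eval_mconst[OF mconst_hom])

lemma rename_vars_mvar [simp]: "rename_vars \<tau> (mvar i) = mvar (\<tau> i)"
  by (simp add: rename_vars_def mpoly_eval_mvar[OF mconst_hom])

lemma mvars_rename_vars: "mvars (rename_vars \<tau> P) \<subseteq> \<tau> ` mvars P"
  unfolding rename_vars_def using mvars_mvar by (intro mvars_mpoly_eval) blast

lemma rename_vars_comp: "rename_vars \<sigma> (rename_vars \<tau> P) = rename_vars (\<lambda>i. \<sigma> (\<tau> i)) P"
  unfolding rename_vars_def[of \<tau>] rename_vars_def[of "\<lambda>i. \<sigma> (\<tau> i)"] mpoly_eval_def
  by (simp add: type_homD[OF rename_vars_hom] type_hom_sum[OF rename_vars_hom]
      type_hom_prod[OF rename_vars_hom] type_hom_power[OF rename_vars_hom])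

lemma rename_vars_id: "rename_vars (\<lambda>i. i) P = P"
  by (simp add: rename_vars_def mpoly_eval_mconst_mvar)

text \<open>The Jacobian in the definition of smoothness uses the first \<open>c\<close> variables;
  the renaming lets any \<open>c\<close> variables play that part. One chart serves every prime:
  \<open>b = 1\<close>, where a localization is just an isomorphism.\<close>

lemma smooth_of_presentation:
  fixes g :: "nat \<Rightarrow> 'k::field mpoly"
  assumes \<tau>: "\<tau> permutes {..<d + c}"
    and g: "\<And>i. i < c \<Longrightarrow> mvars (g i) \<subseteq> {..<d + c}"
    and unit: "presented_class {..<d + c} ((\<lambda>i. rename_vars \<tau> (g i)) ` {..<c})
        (jacobian_det c (\<lambda>i. rename_vars \<tau> (g i)))
      \<in> Units (presented_ring {..<d + c} ((\<lambda>i. rename_vars \<tau> (g i)) ` {..<c}))"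
  shows "smooth_of_relative_dimension (presented_ring {..<d + c} (g ` {..<c}))
    (\<lambda>t. presented_class {..<d + c} (g ` {..<c}) (mconst t)) d"
proof -
  define V where "V = {..<d + c}"
  define \<theta> :: "'k mpoly \<Rightarrow> 'k mpoly" where "\<theta> = rename_vars \<tau>"
  define \<theta>' :: "'k mpoly \<Rightarrow> 'k mpoly" where "\<theta>' = rename_vars (inv_into UNIV \<tau>)"
  define f where "f i = \<theta> (g i)" for i
  have \<theta>: "is_type_hom \<theta>" "is_type_hom \<theta>'"
    unfolding \<theta>_def \<theta>'_def by (rule rename_vars_hom)+
  have inv: "\<theta>' (\<theta> P) = P" "\<theta> (\<theta>' P) = P" for P
    unfolding \<theta>_def \<theta>'_def using permutes_inverses[OF \<tau>]
    by (simp_all add: rename_vars_comp rename_vars_id)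
  have V: "mvars (\<theta> P) \<subseteq> V" "mvars (\<theta>' P) \<subseteq> V" if "mvars P \<subseteq> V" for P
    using mvars_rename_vars[of \<tau> P] mvars_rename_vars[of "inv_into UNIV \<tau>" P] that
      permutes_image[OF \<tau>] permutes_image[OF permutes_inv[OF \<tau>]]
    unfolding \<theta>_def \<theta>'_def V_def by blast+
  interpret A: presentation V "g ` {..<c}"
    by unfold_locales (use g in \<open>auto simp: V_def\<close>)
  interpret B: presentation V "f ` {..<c}"
    by unfold_locales (use g V(1) in \<open>force simp: V_def f_def\<close>)
  have JAB: "\<theta> ` A.J \<subseteq> B.J"
    by (rule genideal_subset_preimage[OF \<theta>(1) V(1) B.J_ideal A.G])
      (use B.generator_mem in \<open>auto simp: f_def\<close>)
  have JBA: "\<theta>' ` B.J \<subseteq> A.J"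
    by (rule genideal_subset_preimage[OF \<theta>(2) V(2) A.J_ideal B.G])
      (use A.generator_mem in \<open>auto simp: f_def inv\<close>)
  have J: "\<theta> x \<in> B.J \<longleftrightarrow> x \<in> A.J" for x
    using JAB JBA inv(1)[of x] by (metis image_subset_iff)
  define \<psi> where "\<psi> = (\<lambda>S. \<theta> ` S)"
  have \<psi>: "\<psi> (A.cl p) = B.cl (\<theta> p)" for p
  proof -
    have "\<theta> ` {x + p |x. x \<in> A.J} = {x + \<theta> p |x. x \<in> B.J}"
    proof (intro equalityI subsetI)
      fix y assume "y \<in> {x + \<theta> p |x. x \<in> B.J}"
      then obtain x where x: "x \<in> B.J" "y = x + \<theta> p" by blast
      then have "\<theta>' x \<in> A.J" "y = \<theta> (\<theta>' x + p)" using JBA inv by (auto simp: type_homD[OF \<theta>(1)])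
      then show "y \<in> \<theta> ` {x + p |x. x \<in> A.J}" by blast
    qed (auto simp: type_homD[OF \<theta>(1)] J)
    then show ?thesis by (simp add: \<psi>_def A.cl_eq_set B.cl_eq_set)
  qed
  interpret AQ: cring A.Q by (rule A.cring_Q)
  interpret BQ: cring B.Q by (rule B.cring_Q)
  have carrier_cases: "\<exists>p. mvars p \<subseteq> V \<and> x = A.cl p" if "x \<in> carrier A.Q" for x
    using that A.carrier_Q by auto
  have hom: "\<psi> \<in> Ring.ring_hom A.Q B.Q"
  proof (rule ring_hom_memI)
    fix x y assume "x \<in> carrier A.Q" "y \<in> carrier A.Q"
    then obtain p q where "x = A.cl p" "y = A.cl q" "mvars p \<subseteq> V" "mvars q \<subseteq> V"
      using carrier_cases by blast
    then show "\<psi> x \<in> carrier B.Q" "\<psi> (x \<otimes>\<^bsub>A.Q\<^esub> y) = \<psi> x \<otimes>\<^bsub>B.Q\<^esub> \<psi> y"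
        "\<psi> (x \<oplus>\<^bsub>A.Q\<^esub> y) = \<psi> x \<oplus>\<^bsub>B.Q\<^esub> \<psi> y"
      using V by (auto simp: \<psi> A.cl_mult A.cl_add B.cl_mult B.cl_add B.carrier_Q type_homD[OF \<theta>(1)])
  qed (simp add: A.cl_one B.cl_one \<psi> type_homD[OF \<theta>(1)])
  have surj: "\<exists>x\<in>carrier A.Q. y = \<psi> x" if y: "y \<in> carrier B.Q" for y
  proof -
    obtain q where q: "mvars q \<subseteq> V" "y = B.cl q" using y B.carrier_Q by auto
    then have "A.cl (\<theta>' q) \<in> carrier A.Q" "y = \<psi> (A.cl (\<theta>' q))"
      using V(2) by (auto simp: A.carrier_Q \<psi> inv)
    then show ?thesis by blast
  qed
  have inj: "x = \<zero>\<^bsub>A.Q\<^esub>" if x: "x \<in> carrier A.Q" "\<psi> x = \<zero>\<^bsub>B.Q\<^esub>" for x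
  proof -
    obtain p where p: "mvars p \<subseteq> V" "x = A.cl p" using x A.carrier_Q by auto
    then have "\<theta> p \<in> B.J" using x V(1)[of p] B.cl_eq_iff[of "\<theta> p" 0] by (simp add: \<psi> B.cl_zero)
    then show ?thesis using p A.cl_eq_iff[of p 0] by (simp add: J A.cl_zero)
  qed
  have loc: "localization_away A.Q \<one>\<^bsub>A.Q\<^esub> B.Q \<psi>"
    unfolding localization_away_def
  proof (intro conjI ballI impI hom)
    show "\<psi> \<one>\<^bsub>A.Q\<^esub> \<in> Units B.Q" using ring_hom_one[OF hom] by simp
    fix y assume y: "y \<in> carrier B.Q"
    then show "\<exists>x\<in>carrier A.Q. \<exists>k::nat. y \<otimes>\<^bsub>B.Q\<^esub> (\<psi> \<one>\<^bsub>A.Q\<^esub> [^]\<^bsub>B.Q\<^esub> k) = \<psi> x"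
      using surj[OF y] ring_hom_one[OF hom] by auto
  next
    fix x assume "x \<in> carrier A.Q" "\<psi> x = \<zero>\<^bsub>B.Q\<^esub>"
    then show "\<exists>k::nat. (\<one>\<^bsub>A.Q\<^esub> [^]\<^bsub>A.Q\<^esub> k) \<otimes>\<^bsub>A.Q\<^esub> x = \<zero>\<^bsub>A.Q\<^esub>"
      using inj by auto
  qed
  have one: "\<one>\<^bsub>A.Q\<^esub> \<in> carrier A.Q - P" if "primeideal P A.Q" for P
  proof -
    interpret P: primeideal P A.Q by (rule that)
    show ?thesis using P.one_imp_carrier P.I_notcarr by auto
  qed
  have "\<forall>i<c. mvars (f i) \<subseteq> V" using B.G by auto
  moreover have "\<forall>t. \<psi> (A.cl (mconst t)) = B.cl (mconst t)" by (simp add: \<psi> \<theta>_def)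
  moreover have "B.cl (jacobian_det c f) \<in> Units B.Q"
    using unit unfolding f_def \<theta>_def V_def .
  ultimately have "\<exists>b\<in>carrier A.Q - P. \<exists>c f. \<exists>\<psi>. (\<forall>i<c. mvars (f i) \<subseteq> {..<d + c}) \<and>
      localization_away A.Q b (presented_ring {..<d + c} (f ` {..<c})) \<psi> \<and>
      (\<forall>t. \<psi> (A.cl (mconst t)) = presented_class {..<d + c} (f ` {..<c}) (mconst t)) \<and>
      presented_class {..<d + c} (f ` {..<c}) (jacobian_det c f)
        \<in> Units (presented_ring {..<d + c} (f ` {..<c}))" if "primeideal P A.Q" for P
    using one[OF that] loc unfolding V_def by blast
  then show ?thesis
    unfolding smooth_of_relative_dimension_def V_def[symmetric]
    using A.cring_Q A.cl_mconst_hom unfolding V_def by blast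
qed

section \<open>Partial derivatives\<close>

lemma mpderiv_superset:
  assumes "finite K" "Poly_Mapping.keys P \<subseteq> K"
  shows "mpderiv i P = (\<Sum>m\<in>K. Poly_Mapping.single (m - Poly_Mapping.single i 1)
    (of_nat (Poly_Mapping.lookup m i) * Poly_Mapping.lookup P m))"
  unfolding mpderiv_def using assms
  by (intro sum.mono_neutral_left) (auto simp: in_keys_iff)

lemma mpderiv_add: "mpderiv i (P + Q) = mpderiv i P + mpderiv i Q"
proof -
  let ?K = "Poly_Mapping.keys P \<union> Poly_Mapping.keys Q"
  have "Poly_Mapping.keys (P + Q) \<subseteq> ?K" by (rule keys_add)
  then show ?thesis
    by (simp add: mpderiv_superset[of ?K] lookup_add distrib_left single_add sum.distrib)
qed

lemma mpderiv_uminus: "mpderiv i (- P) = - mpderiv i P"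
proof -
  have "mpderiv i (- P) + mpderiv i P = 0"
    unfolding mpderiv_add[symmetric] by (simp add: mpderiv_def)
  then show ?thesis by (simp add: eq_neg_iff_add_eq_0)
qed

lemma mpderiv_diff: "mpderiv i (P - Q) = mpderiv i P - mpderiv i Q"
  using mpderiv_add[of i P "- Q"] by (simp add: mpderiv_uminus)

lemma mpderiv_single: "mpderiv i (Poly_Mapping.single m c) =
    Poly_Mapping.single (m - Poly_Mapping.single i 1) (of_nat (Poly_Mapping.lookup m i) * c)"
  by (subst mpderiv_superset[of "{m}"]) auto

lemma mpderiv_not_mvars: "i \<notin> mvars P \<Longrightarrow> mpderiv i P = 0"
  unfolding mpderiv_def by (intro sum.neutral) (auto simp: mvars_def in_keys_iff)

lemma mpderiv_mvar_power: "mpderiv i (mvar i ^ k) = of_nat k * mvar i ^ (k - 1)"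
proof -
  have "Poly_Mapping.single i k - Poly_Mapping.single i 1 = (Poly_Mapping.single i (k - 1) :: nat \<Rightarrow>\<^sub>0 nat)"
    by (rule poly_mapping_eqI) (auto simp: lookup_minus lookup_single when_def)
  then have "mpderiv i (mvar i ^ k) = mconst (of_nat k) * mvar i ^ (k - 1)"
    by (simp add: mvar_power mpderiv_single mconst_def mult_single del: single_of_nat)
  then show ?thesis by (simp add: type_hom_of_nat[OF mconst_hom])
qed

lemma mpderiv_mconst_mult_mvar: "mpderiv i (mconst c * mvar i) = mconst c"
proof -
  have "mconst c * mvar i = Poly_Mapping.single (Poly_Mapping.single i 1) c"
    by (simp add: mvar_def mconst_def mult_single)
  then show ?thesis by (simp add: mpderiv_single mconst_def)
qed

lemma mpderiv_mvar_mult_mvar: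
  assumes "i \<noteq> j" shows "mpderiv i (mvar i * mvar j) = mvar j"
proof -
  have eq: "mvar i * mvar j = Poly_Mapping.single (Poly_Mapping.single i 1 + Poly_Mapping.single j 1) 1"
    by (simp add: mvar_def mult_single)
  show ?thesis
    unfolding eq using assms by (simp add: mpderiv_single mvar_def lookup_add lookup_single)
qed

section \<open>A presentation of the automorphism scheme\<close>

lemma aut_defect_mpoly:
  fixes \<iota> :: "'k::comm_ring_1 \<Rightarrow> 'a::comm_ring_1" and J :: "'a set"
  assumes "mult_filtration mconst J F" "is_type_hom \<iota>" "formal_group_law H" "n \<ge> 1"
  shows "aut_defect \<iota> n H a = fgl_filtration.defect mconst \<iota> H n a (mvar 1) (mvar 2)"
proof -
  interpret mult_filtration mconst J F by (rule assms)
  interpret fgl_filtration mconst J F \<iota> H n a by unfold_locales (rule assms)+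
  show ?thesis by (simp add: aut_defect_def Let_def defect_def curve_def curve_subst_def)
qed

text \<open>Up to degree \<open>i\<close> the curves differ by \<open>a i * u ^ i\<close>, and on
  such a difference the formal sum acts linearly. So the defects differ by \<open>a i\<close> times
  \<open>(X+Y)^i - X^i - Y^i\<close>; the bounds on \<open>j\<close> exclude the pure
  powers.\<close>

lemma aut_defect_top_coeff:
  fixes a a' :: "nat \<Rightarrow> 'a::comm_ring_1"
  assumes \<iota>: "is_type_hom \<iota>" and H: "formal_group_law H" and i: "i \<le> n" and j: "1 \<le> j" "j < i"
    and a': "\<And>l. a' l = (if 1 \<le> l \<and> l < i then a l else 0)"
  shows "Poly_Mapping.lookup (aut_defect \<iota> n H a) (monom3 j (i - j) 0) =
    of_nat (i choose j) * a i + Poly_Mapping.lookup (aut_defect \<iota> n H a') (monom3 j (i - j) 0)"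
proof -
  let ?F = "deg_filtration {0::'a}"
  let ?m = "monom3 j (i - j) 0"
  have n: "n \<ge> 1" using i j by simp
  interpret type_ideal "{0::'a}" by unfold_locales auto
  interpret M: mult_filtration mconst "{0::'a}" ?F by (rule mpoly_filtration)
  interpret A: fgl_filtration mconst "{0::'a}" ?F \<iota> H n a using \<iota> H n by unfold_locales
  interpret A': fgl_filtration mconst "{0::'a}" ?F \<iota> H n a' using \<iota> H n by unfold_locales
  have v: "mvar l \<in> ?F 1" for l
    by (auto simp: deg_filtration_def mvar_def lookup_single when_def total_deg_def)
  have curve: "A.curve u - A'.curve u - mconst (a i) * u ^ i \<in> ?F (Suc i)" if u: "u \<in> ?F 1" for u
  proof -
    have "A.curve u - A'.curve u = (\<Sum>l=1..n. mconst (a l - a' l) * u ^ l)"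
      by (simp add: A.curve_def A'.curve_def sum_subtractf left_diff_distrib type_homD[OF mconst_hom])
    also have "\<dots> = mconst (a i - a' i) * u ^ i + (\<Sum>l\<in>{1..n} - {i}. mconst (a l - a' l) * u ^ l)"
      using i j by (intro sum.remove) auto
    finally have "A.curve u - A'.curve u - mconst (a i) * u ^ i =
        (\<Sum>l\<in>{1..n} - {i}. mconst (a l - a' l) * u ^ l)"
      by (simp add: a')
    also have "\<dots> \<in> ?F (Suc i)"
    proof (rule M.F.sum)
      fix l assume l: "l \<in> {1..n} - {i}"
      show "mconst (a l - a' l) * u ^ l \<in> ?F (Suc i)"
      proof (cases "l < i")
        case True
        then show ?thesis using l by (simp add: a' type_homD[OF mconst_hom] M.F_zero)
      next
        case False
        then show ?thesis using l by (intro M.F.mult M.F_mono[OF M.F_power[OF u]]) auto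
      qed
    qed
    finally show ?thesis .
  qed
  have curve': "A.curve u - A'.curve u \<in> ?F i" if u: "u \<in> ?F 1" for u
    using M.F_add[OF M.F_Suc[OF curve[OF u]] M.F.mult[OF M.F_power[OF u], where r = "mconst (a i)"]] by simp
  define W where "W = A.fadd (mvar 1) (mvar 2)"
  have W: "W \<in> ?F 1" "W - (mvar 1 + mvar 2) \<in> ?F (Suc 1)"
    using A.fadd_mem[OF v v] A.fadd_approx[OF v v] by (simp_all add: W_def numeral_2_eq_2)
  have 1: "A.curve W - A'.curve W - mconst (a i) * W ^ i \<in> ?F (Suc i)"
    by (rule curve[OF W(1)])
  have 2: "mconst (a i) * W ^ i - mconst (a i) * (mvar 1 + mvar 2) ^ i \<in> ?F (Suc i)"
    using M.F.mult[OF M.F_power_diff[OF W(1) M.F_add[OF v v] W(2)], where r = "mconst (a i)"]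
    by (simp add: right_diff_distrib)
  have 3: "A.fadd (A.curve (mvar 1)) (A.curve (mvar 2)) - A.fadd (A'.curve (mvar 1)) (A'.curve (mvar 2))
      - ((A.curve (mvar 1) - A'.curve (mvar 1)) + (A.curve (mvar 2) - A'.curve (mvar 2))) \<in> ?F (Suc i)"
    by (intro A.fadd_diff A.curve_mem A'.curve_mem curve' v)
  have comb: "(cw - cw' - aw) + (aw - axy) - (s - s' - ((cx - cx') + (cy - cy'))) - (cx - cx' - ax) - (cy - cy' - ay)
      = (cw - s) - (cw' - s') - (axy - ax - ay)" for cw cw' aw axy s s' cx cx' cy cy' ax ay :: "'a mpoly"
    by simp
  have "A.defect (mvar 1) (mvar 2) - A'.defect (mvar 1) (mvar 2) -
      (mconst (a i) * (mvar 1 + mvar 2) ^ i - mconst (a i) * mvar 1 ^ i - mconst (a i) * mvar 2 ^ i)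
      \<in> ?F (Suc i)"
    using M.F.diff[OF M.F.diff[OF M.F.diff[OF M.F_add[OF 1 2] 3] curve[OF v[of 1]]] curve[OF v[of 2]]]
    unfolding comb A.defect_def A'.defect_def W_def .
  moreover have "total_deg ?m < Suc i" using j by simp
  ultimately have "Poly_Mapping.lookup (A.defect (mvar 1) (mvar 2)) ?m =
      Poly_Mapping.lookup (A'.defect (mvar 1) (mvar 2)) ?m +
      (Poly_Mapping.lookup (mconst (a i) * (mvar 1 + mvar 2) ^ i) ?m
       - Poly_Mapping.lookup (mconst (a i) * mvar 1 ^ i) ?m
       - Poly_Mapping.lookup (mconst (a i) * mvar 2 ^ i) ?m)"
    unfolding deg_filtration_def mem_Collect_eq
    by (simp only: lookup_minus singleton_iff) (simp add: algebra_simps)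
  moreover have form: "Poly_Mapping.lookup (mconst b * mvar 1 ^ s * mvar 2 ^ t) m =
      (if m = monom3 s t 0 then b else 0)" for b :: 'a and s t m
    using mconst_monom3[of b s t 0] by (auto simp: lookup_single when_def)
  moreover have "Poly_Mapping.lookup (mconst (a i) * mvar 1 ^ i) ?m = 0"
    using form[of "a i" i 0 ?m] j by simp
  moreover have "Poly_Mapping.lookup (mconst (a i) * mvar 2 ^ i) ?m = 0"
    using form[of "a i" 0 i ?m] j by simp
  moreover have "Poly_Mapping.lookup (mconst (a i) * (mvar 1 + mvar 2) ^ i) ?m = of_nat (i choose j) * a i"
  proof -
    have "Poly_Mapping.lookup (mconst (a i) * (mvar 1 + mvar 2) ^ i) ?m =
        (\<Sum>l\<le>i. if l = j then of_nat (i choose l) * a i else 0)"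
      unfolding mconst_mult_binomial lookup_sum form using j by (intro sum.cong) auto
    then show ?thesis using j by simp
  qed
  ultimately show ?thesis
    using aut_defect_mpoly[OF M.mult_filtration_axioms \<iota> H n] by simp
qed

context
  fixes H :: "'p::prime_card mod_ring fps fps" and p h n q :: nat
  assumes p: "p = CARD('p)" and n: "n \<ge> 1" and H: "formal_group_law H"
    and q: "q = p ^ h" and pq: "fgl_mult H p = fps_X ^ q"
begin

abbreviation univ_defect :: "'p mod_ring mpoly mpoly" where
  "univ_defect \<equiv> aut_defect mconst n H mvar"

text \<open>For \<open>i\<close> not a power of \<open>p\<close>, the binomial coefficient of \<open>i\<close> over \<open>p ^ multiplicity p i\<close> is
  nonzero modulo \<open>p\<close>, so the corresponding coefficient of the defect expresses \<open>a\<^sub>i\<close> through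
  \<open>a\<^sub>1, \<dots>, a\<^bsub>i-1\<^esub>\<close>.\<close>
definition aut_gen :: "nat \<Rightarrow> 'p mod_ring mpoly" where
  "aut_gen i =
    (if i = 0 then mvar 0 * mvar 1 - 1
     else if \<exists>k. i = p ^ k then mvar i ^ q - mvar i
     else Poly_Mapping.lookup univ_defect
       (monom3 (p ^ multiplicity p i) (i - p ^ multiplicity p i) 0))"

text \<open>Indices with an equation of their own; the rest of \<open>{1..n}\<close> gives the free
  coordinates.\<close>

definition determined :: "nat set" where
  "determined = {i \<in> {1..n}. (\<exists>k. i = p ^ k) \<longrightarrow> i * q \<le> n}"

lemma prime_p: "prime p" using prime_card p by simp

lemma not_unit_p: "\<not> is_unit p" using prime_p not_prime_unit by blast

lemma nonpower_multiplicity: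
  assumes "i > 0" "\<nexists>k. i = p ^ k"
  defines "v \<equiv> multiplicity p i"
  shows "p ^ v dvd i" "\<not> p dvd i div p ^ v" "1 < i div p ^ v" "p ^ v < i"
proof -
  show v: "p ^ v dvd i" "\<not> p dvd i div p ^ v"
    using assms(1) not_unit_p by (simp_all add: v_def multiplicity_dvd multiplicity_decompose)
  have "i div p ^ v \<noteq> 0" using v(2) by (metis dvd_0_right)
  moreover have "i div p ^ v \<noteq> 1" using v(1) assms(2) by (metis dvd_div_mult_self mult_1)
  ultimately show "1 < i div p ^ v" by simp
  show "p ^ v < i" using dvd_imp_le[OF v(1) assms(1)] assms(2) by (metis le_neq_implies_less)
qed

text \<open>Translates the exponent \<open>v\<close> of \<open>defect_mem_ideal\<close> into the
  multiplicity that \<open>aut_gen\<close> uses.\<close>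

lemma nonpower_unique:
  assumes "p ^ v dvd d" "1 < d div p ^ v" "\<not> p dvd d div p ^ v"
  shows "(\<nexists>k. d = p ^ k) \<and> multiplicity p d = v \<and> d > 0"
proof -
  have d: "d = p ^ v * (d div p ^ v)" using assms(1) by simp
  have "multiplicity p d = v"
  proof (rule multiplicity_eqI[OF assms(1)])
    show "\<not> p ^ Suc v dvd d"
    proof
      assume "p ^ Suc v dvd d"
      then have "p ^ v * p dvd p ^ v * (d div p ^ v)" using d by (simp add: mult.commute)
      then show False using assms(3) prime_gt_0_nat[OF prime_p] by simp
    qed
  qed
  moreover have "d \<noteq> p ^ k" for k
  proof
    assume "d = p ^ k"
    then have "k = v" using \<open>multiplicity p d = v\<close> prime_p by simp
    then show False using assms(2) \<open>d = p ^ k\<close> prime_gt_0_nat[OF prime_p] by simp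
  qed
  moreover have "d > 0" using assms(2) by (cases d) auto
  ultimately show ?thesis by blast
qed

lemma aut_gen_nonpower:
  assumes "1 \<le> i" "i \<le> n" "\<nexists>k. i = p ^ k"
  shows "\<exists>e r. e \<noteq> 0 \<and> mvars r \<subseteq> {1..<i} \<and> aut_gen i = mconst e * mvar i + r"
proof -
  define v where "v = multiplicity p i"
  define a' :: "nat \<Rightarrow> 'p mod_ring mpoly" where "a' l = (if 1 \<le> l \<and> l < i then mvar l else 0)" for l
  define m where "m = monom3 (p ^ v) (i - p ^ v) 0"
  define r where "r = Poly_Mapping.lookup (aut_defect mconst n H a') m"
  have nm: "\<not> p dvd i div p ^ v" "p ^ v < i"
    using nonpower_multiplicity[of i] assms by (simp_all add: v_def)
  have j: "1 \<le> p ^ v" using prime_gt_0_nat[OF prime_p] by simp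
  have "aut_gen i = Poly_Mapping.lookup univ_defect m"
    using assms by (simp add: aut_gen_def m_def v_def)
  also have "\<dots> = of_nat (i choose p ^ v) * mvar i + r"
    unfolding m_def r_def
    by (rule aut_defect_top_coeff[OF mconst_hom H assms(2) j nm(2)]) (simp add: a'_def)
  also have "of_nat (i choose p ^ v) = (mconst (of_nat (i choose p ^ v)) :: 'p mod_ring mpoly)"
    by (simp add: type_hom_of_nat[OF mconst_hom])
  finally have "aut_gen i = mconst (of_nat (i choose p ^ v)) * mvar i + r" .
  moreover have "(of_nat (i choose p ^ v) :: 'p mod_ring) \<noteq> 0"
    using of_nat_0_mod_ring_dvd[of "i choose p ^ v", where 'a = 'p] prime_dvd_choose_iff[OF prime_p] nm
    by (auto simp flip: p)
  moreover have "mvars r \<subseteq> {1..<i}"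
  proof -
    let ?E = "mpoly_eval mconst a'"
    have E: "is_type_hom ?E" by (rule mpoly_eval_hom[OF mconst_hom])
    \<comment> \<open>\<open>r\<close> is the universal coefficient specialized to
      \<open>a_l = 0\<close> for \<open>l \<ge> i\<close>, so only variables below \<open>i\<close>
      occur.\<close>
    have "r = ?E (Poly_Mapping.lookup univ_defect m)"
      unfolding r_def using aut_defect_hom[OF E, of mconst n H mvar m]
      by (simp add: mpoly_eval_mconst[OF mconst_hom] mpoly_eval_mvar[OF mconst_hom])
    moreover have "mvars (a' l) \<subseteq> {1..<i}" for l
      using mvars_mvar[of l, where 'a = "'p mod_ring"] by (auto simp: a'_def)
    ultimately show ?thesis using mvars_mpoly_eval by metis
  qed
  ultimately show ?thesis by blast
qed

lemma mvars_aut_gen: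
  assumes "i \<in> determined"
  shows "mvars (aut_gen i) \<subseteq> {1..i}"
proof (cases "\<exists>k. i = p ^ k")
  case True
  have "mvars (mvar i ^ q :: 'p mod_ring mpoly) \<subseteq> {i}" by (intro mvars_power mvars_mvar)
  then have "mvars (mvar i ^ q - mvar i :: 'p mod_ring mpoly) \<subseteq> {i}"
    using mvars_diff[of "mvar i ^ q" "mvar i :: 'p mod_ring mpoly"]
      mvars_mvar[of i, where 'a = "'p mod_ring"] by blast
  then show ?thesis using True assms by (auto simp: aut_gen_def determined_def)
next
  case False
  then obtain e r where r: "mvars r \<subseteq> {1..<i}" "aut_gen i = mconst e * mvar i + r"
    using aut_gen_nonpower[of i] assms by (auto simp: determined_def)
  have i: "1 \<le> i" using assms by (simp add: determined_def)
  have "mvars (mconst e * mvar i :: 'p mod_ring mpoly) \<subseteq> {i}"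
    by (intro mvars_mult_subset mvars_mvar) simp
  then have "mvars (aut_gen i) \<subseteq> {i} \<union> {1..<i}"
    unfolding r(2) using r(1) mvars_add[of "mconst e * mvar i" r] by blast
  then show ?thesis using i by auto
qed

lemma mvars_aut_gen_0: "mvars (aut_gen 0) \<subseteq> {0, 1}"
proof -
  have "mvars (mvar 0 * mvar 1 :: 'p mod_ring mpoly) \<subseteq> {0, 1}"
    by (intro mvars_mult_subset order_trans[OF mvars_mvar]) auto
  then show ?thesis
    using mvars_diff[of "mvar 0 * mvar 1" "1 :: 'p mod_ring mpoly"] by (simp add: aut_gen_def)
qed

lemma aut_gen_carrier: "aut_gen ` insert 0 determined \<subseteq> carrier (mpoly_ring {0..n})"
proof -
  have "mvars (aut_gen i) \<subseteq> {0..n}" if "i \<in> determined" for i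
    using mvars_aut_gen[OF that] that by (force simp: determined_def)
  moreover have "mvars (aut_gen 0) \<subseteq> {0..n}" using mvars_aut_gen_0 n by force
  ultimately show ?thesis by auto
qed

text \<open>Both inclusions concern the universal curve with coefficients \<open>mvar\<close>:
  \<open>defect_mem_ideal\<close> is used modulo the chosen equations,
  \<open>frobenius_relation\<close> modulo the relations. For a nonpower index the chosen equation
  is itself a relation.\<close>

lemma aut_relations_genideal:
  "genideal (mpoly_ring {0..n}) (aut_relations n H) =
   genideal (mpoly_ring {0..n}) (aut_gen ` insert 0 determined)"
proof -
  interpret A: presentation "{0..n}" "aut_relations n H"
    by unfold_locales (rule aut_relations_carrier[OF n])
  interpret B: presentation "{0..n}" "aut_gen ` insert 0 determined"
    by unfold_locales (rule aut_gen_carrier)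
  let ?\<rho> = "restrict_vars {0..n}"
  note equations = defect_mem_ideal[OF restrict_vars_type_ideal mconst_hom H n p q pq, where a = mvar]
  have 1: "aut_relations n H \<subseteq> B.J"
  proof
    fix g assume g: "g \<in> aut_relations n H"
    then have gV: "?\<rho> g = g" using A.G by (intro restrict_vars_id) auto
    consider "g = aut_gen 0" | m where "total_deg m \<le> n" "g = Poly_Mapping.lookup univ_defect m"
      using g by (auto simp: aut_relations_def aut_gen_def)
    then show "g \<in> B.J"
    proof cases
      case 1
      then show ?thesis using B.generator_mem by blast
    next
      case (2 m)
      have "Poly_Mapping.lookup univ_defect m \<in> {x. ?\<rho> x \<in> B.J}"
      proof (rule equations[OF B.J_ideal _ _ 2(1)])
        fix d v assume *: "d \<le> n" "p ^ v dvd d" "1 < d div p ^ v" "\<not> p dvd d div p ^ v"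
        from nonpower_unique[OF *(2-4)] have d: "\<nexists>k. d = p ^ k" "multiplicity p d = v" "d > 0" by auto
        then have "d \<in> determined" using *(1) by (auto simp: determined_def)
        then have "aut_gen d \<in> B.J" "?\<rho> (aut_gen d) = aut_gen d"
          using B.generator_mem B.G by (auto intro!: restrict_vars_id)
        moreover have "aut_gen d = Poly_Mapping.lookup univ_defect (monom3 (p ^ v) (d - p ^ v) 0)"
          using d by (simp add: aut_gen_def)
        ultimately show "Poly_Mapping.lookup univ_defect (monom3 (p ^ v) (d - p ^ v) 0) \<in> {x. ?\<rho> x \<in> B.J}"
          by simp
      next
        fix k assume k: "p ^ k * q \<le> n"
        interpret K: type_ideal "{x. ?\<rho> x \<in> B.J}" by (rule restrict_vars_type_ideal[OF B.J_ideal])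
        have pos: "p ^ k > 0" "q > 0" using prime_gt_0_nat[OF prime_p] by (simp_all add: q)
        then have "p ^ k \<le> p ^ k * q" by simp
        with k have "p ^ k \<le> n" by (rule order_trans[rotated])
        then have "p ^ k \<in> determined" using k pos by (auto simp: determined_def)
        then have "aut_gen (p ^ k) \<in> B.J" "?\<rho> (aut_gen (p ^ k)) = aut_gen (p ^ k)"
          using B.generator_mem B.G by (auto intro!: restrict_vars_id)
        moreover have "aut_gen (p ^ k) = mvar (p ^ k) ^ q - mvar (p ^ k)"
          using pos by (auto simp: aut_gen_def)
        ultimately have "mvar (p ^ k) ^ q - mvar (p ^ k) \<in> {x. ?\<rho> x \<in> B.J}" by simp
        then show "mvar (p ^ k) - mvar (p ^ k) ^ q \<in> {x. ?\<rho> x \<in> B.J}"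
          by (rule K.diff_commute[THEN iffD1])
      qed
      then show ?thesis using 2 gV by simp
    qed
  qed
  have 2: "aut_gen ` insert 0 determined \<subseteq> A.J"
  proof
    fix g assume g: "g \<in> aut_gen ` insert 0 determined"
    then obtain i where i: "i \<in> insert 0 determined" "g = aut_gen i" by blast
    have gV: "?\<rho> g = g" using g B.G by (intro restrict_vars_id) auto
    have defect: "Poly_Mapping.lookup univ_defect m \<in> A.J" if "total_deg m \<le> n" for m
      using that by (intro A.generator_mem) (auto simp: aut_relations_def)
    have "i = 0 \<or> i \<in> determined \<and> i > 0" using i by auto
    then consider "i = 0" | k where "i \<in> determined" "i = p ^ k" "i > 0"
      | "i \<in> determined" "\<nexists>k. i = p ^ k" "i > 0"
      by (cases "\<exists>k. i = p ^ k") auto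
    then show "g \<in> A.J"
    proof cases
      case 1
      then show ?thesis using i by (intro A.generator_mem) (simp add: aut_relations_def aut_gen_def)
    next
      case (2 k)
      interpret K: type_ideal "{x. ?\<rho> x \<in> A.J}" by (rule restrict_vars_type_ideal[OF A.J_ideal])
      have "mvar i - mvar i ^ q \<in> {x. ?\<rho> x \<in> A.J}"
      proof (rule frobenius_relation[OF K.type_ideal_axioms mconst_hom H n p q pq])
        fix m assume m: "total_deg m \<le> n"
        then have "mvars (Poly_Mapping.lookup univ_defect m) \<subseteq> {0..n}"
          using A.G by (auto simp: aut_relations_def)
        then show "Poly_Mapping.lookup univ_defect m \<in> {x. ?\<rho> x \<in> A.J}"
          using defect[OF m] by (simp add: restrict_vars_id)
      qed (use 2 in \<open>auto simp: determined_def\<close>)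
      then have "mvar i ^ q - mvar i \<in> {x. ?\<rho> x \<in> A.J}"
        by (rule K.diff_commute[THEN iffD1])
      moreover have "g = mvar i ^ q - mvar i" using 2 i by (auto simp: aut_gen_def)
      ultimately show ?thesis using gV by simp
    next
      case 3
      have "p ^ multiplicity p i < i" "i \<le> n"
        using nonpower_multiplicity[of i] 3 by (auto simp: determined_def)
      then show ?thesis using 3 i by (auto simp: aut_gen_def intro!: defect)
    qed
  qed
  show ?thesis
    using A.R.genideal_minimal[OF B.J_ideal 1] A.R.genideal_minimal[OF A.J_ideal 2] by blast
qed


text \<open>If \<open>p ^ m \<le> n < p ^ (m + 1)\<close>, the free indices are the
  \<open>p ^ k\<close> with \<open>m - h < k \<le> m\<close>, and there are \<open>h\<close> of them
  because \<open>h \<le> m\<close>. Index 0, for the inverse of \<open>a_1\<close>, adds one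
  variable and one equation, whence \<open>Suc n\<close>.\<close>

lemma card_determined:
  assumes "n \<ge> p ^ h"
  shows "h + card (insert 0 determined) = Suc n"
proof -
  have p2: "p \<ge> 2" using prime_p prime_ge_2_nat by blast
  obtain m where m: "p ^ m \<le> n" "n < p ^ (m + 1)" using ex_power_ivl1[OF p2 n] by blast
  have mono: "p ^ k \<le> p ^ l \<longleftrightarrow> k \<le> l" "p ^ k < p ^ l \<longleftrightarrow> k < l" for k l
    using p2 by simp_all
  have le: "p ^ k \<le> n \<longleftrightarrow> k \<le> m" for k
  proof
    assume "p ^ k \<le> n"
    then have "p ^ k < p ^ (m + 1)" using m by simp
    then show "k \<le> m" by (simp only: mono less_Suc_eq_le Suc_eq_plus1[symmetric])
  next
    assume "k \<le> m"
    then show "p ^ k \<le> n" using m mono by (meson le_trans)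
  qed
  have hm: "h \<le> m" using assms le by simp
  have "{1..n} - determined = (\<lambda>k. p ^ k) ` {m - h<..m}"
  proof (intro equalityI subsetI)
    fix i assume "i \<in> {1..n} - determined"
    then obtain k where k: "i = p ^ k" "i \<le> n" "\<not> i * q \<le> n"
      unfolding determined_def by auto
    then have "p ^ k \<le> n" "\<not> p ^ (k + h) \<le> n" by (simp_all add: q power_add)
    with k(1) have "k \<le> m" "\<not> k + h \<le> m" "i = p ^ k" unfolding le by simp_all
    then have "k \<in> {m - h<..m}" "i = p ^ k" using hm by auto
    then show "i \<in> (\<lambda>k. p ^ k) ` {m - h<..m}" by blast
  next
    fix i assume "i \<in> (\<lambda>k. p ^ k) ` {m - h<..m}"
    then obtain k where k: "i = p ^ k" "k \<le> m" "\<not> k + h \<le> m" using hm by auto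
    then have "p ^ k \<le> n" "\<not> p ^ (k + h) \<le> n" unfolding le by simp_all
    moreover have "1 \<le> p ^ k" using p2 by simp
    ultimately show "i \<in> {1..n} - determined"
      using k(1) unfolding determined_def by (auto simp: q power_add)
  qed
  moreover have "inj_on (\<lambda>k. p ^ k) {m - h<..m}" using p2 by (auto intro!: inj_onI)
  ultimately have card_free: "card ({1..n} - determined) = h" using hm by (simp add: card_image)
  have sub: "determined \<subseteq> {1..n}" by (auto simp: determined_def)
  have "n - card determined = h"
    using card_free card_Diff_subset[OF finite_subset[OF sub] sub] by simp
  moreover have "card determined \<le> n" using card_mono[OF _ sub] by simp
  moreover have "card (insert 0 determined) = Suc (card determined)"
    using sub finite_subset[OF sub] by (subst card_insert_disjoint) auto
  ultimately show ?thesis by simp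
qed

lemma mpderiv_rename_aut_gen:
  assumes \<tau>: "inj \<tau>" and i: "i \<in> determined" and "h \<ge> 1"
  shows "\<exists>e. e \<noteq> 0 \<and> mpderiv (\<tau> i) (rename_vars \<tau> (aut_gen i)) = mconst e"
proof (cases "\<exists>k. i = p ^ k")
  case True
  \<comment> \<open>Here \<open>h \<ge> 1\<close> enters: \<open>q\<close> is divisible by
    \<open>p\<close>, so the power has derivative zero.\<close>
  have "of_nat q = (0 :: 'p mod_ring)" using \<open>h \<ge> 1\<close> by (cases h) (simp_all add: q p)
  then have "of_nat q = (0 :: 'p mod_ring mpoly)"
    unfolding type_hom_of_nat[OF mconst_hom, symmetric] by (simp add: type_homD[OF mconst_hom])
  moreover have "aut_gen i = mvar i ^ q - mvar i" using True i by (auto simp: aut_gen_def determined_def)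
  ultimately have "mpderiv (\<tau> i) (rename_vars \<tau> (aut_gen i)) = - 1"
    using mpderiv_mvar_power[of "\<tau> i" 1, where 'a = "'p mod_ring"]
    by (simp add: type_homD[OF rename_vars_hom] type_hom_power[OF rename_vars_hom] mpderiv_diff
        mpderiv_mvar_power)
  also have "\<dots> = mconst (- 1)" by (simp add: type_homD[OF mconst_hom])
  finally show ?thesis by (intro exI[of _ "- 1"]) simp
next
  case False
  then obtain e r where r: "e \<noteq> 0" "mvars r \<subseteq> {1..<i}" "aut_gen i = mconst e * mvar i + r"
    using aut_gen_nonpower[of i] i by (auto simp: determined_def)
  have "\<tau> i \<notin> mvars (rename_vars \<tau> r)"
  proof
    assume "\<tau> i \<in> mvars (rename_vars \<tau> r)"
    then obtain l where "l \<in> {1..<i}" "\<tau> i = \<tau> l" using mvars_rename_vars[of \<tau> r] r(2) by blast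
    then show False using injD[OF \<tau>] by force
  qed
  then have "mpderiv (\<tau> i) (rename_vars \<tau> (aut_gen i)) = mconst e"
    by (simp add: r(3) type_homD[OF rename_vars_hom] mpderiv_add mpderiv_mconst_mult_mvar mpderiv_not_mvars)
  then show ?thesis using r(1) by blast
qed

end

section \<open>Units in a presentation and the triangular Jacobian\<close>

lemma (in presentation) unit_cl_prod_list:
  assumes "\<And>x. x \<in> set xs \<Longrightarrow> mvars x \<subseteq> V \<and> cl x \<in> Units Q"
  shows "mvars (prod_list xs) \<subseteq> V \<and> cl (prod_list xs) \<in> Units Q"
proof -
  interpret Q: cring Q by (rule cring_Q)
  show ?thesis using assms
  proof (induction xs)
    case Nil
    then show ?case using Q.Units_one_closed by (simp add: cl_one)
  next
    case (Cons x xs)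
    then have IH: "mvars (prod_list xs) \<subseteq> V" "cl (prod_list xs) \<in> Units Q" by auto
    have x: "mvars x \<subseteq> V" "cl x \<in> Units Q" using Cons.prems by auto
    then have "cl (x * prod_list xs) \<in> Units Q"
      using Q.Units_m_closed[OF x(2) IH(2)] IH by (simp add: cl_mult)
    then show ?case using x IH mvars_mult_subset[OF x(1) IH(1)] by simp
  qed
qed

lemma (in presentation) unit_clI:
  assumes "mvars x \<subseteq> V" "mvars y \<subseteq> V" "x * y - 1 \<in> J"
  shows "cl x \<in> Units Q"
proof -
  interpret Q: cring Q by (rule cring_Q)
  have "cl (x * y) = cl 1" using assms by (subst cl_eq_iff) (simp_all add: mvars_mult_subset)
  then have "cl x \<otimes>\<^bsub>Q\<^esub> cl y = \<one>\<^bsub>Q\<^esub>" using assms by (simp add: cl_mult cl_one)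
  moreover have "cl x \<in> carrier Q" "cl y \<in> carrier Q" using assms by (auto simp: carrier_Q)
  ultimately show ?thesis using Q.m_comm unfolding Units_def by fastforce
qed

text \<open>With the variables ordered as the determined \<open>a\<^sub>i\<close>, then \<open>a\<^sub>1\<inverse>\<close>, then the free \<open>a\<^sub>i\<close>, the
  Jacobian matrix is lower triangular.\<close>
theorem corollary3p7p4:
  fixes H :: "'p::prime_card mod_ring fps fps" and p h n :: nat
  assumes "p = CARD('p)"
    and "h \<ge> 1"
    and "n \<ge> p ^ (h + 1)"
    and "formal_group_law H"
    and "fgl_mult H p = fps_X ^ (p ^ h)"
  shows "smooth_of_relative_dimension (aut_ring n H) (\<lambda>t. aut_class n H (mconst t)) h"
proof -
  have p1: "p > 1" using prime_card[where 'a = 'p] assms(1) prime_gt_1_nat by blast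
  have "p ^ h \<le> p ^ (h + 1)" using p1 by simp
  then have nh: "n \<ge> p ^ h" using assms(3) by linarith
  moreover have "p ^ h \<ge> 1" using p1 by simp
  ultimately have n: "n \<ge> 1" by linarith
  note fgl = assms(1) n assms(4) refl[of "p ^ h"] assms(5)
  define gen where "gen = aut_gen H p n (p ^ h)"
  define S where "S = determined p n (p ^ h)"
  note S_sub = determined_def[OF fgl, folded S_def]
  define c where "c = card (insert 0 S)"
  have hc: "h + c = Suc n" unfolding c_def S_def by (rule card_determined[OF fgl nh])
  have finS: "finite S" and S1: "S \<subseteq> {1..n}" unfolding S_sub by auto
  have c: "c = Suc (card S)" using finS S1 by (auto simp: c_def card_insert_if)
  \<comment> \<open>Index 0 follows the determined ones because its equation also involves
    \<open>a_1\<close>, whose column therefore has to stand further left.\<close>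
  define L where "L = sorted_list_of_set S @ [0] @ sorted_list_of_set ({1..n} - S)"
  have L: "distinct L" "set L = {..<h + c}" using finS S1 by (auto simp: L_def hc)
  have lenL: "length L = h + c" using distinct_card[OF L(1)] L(2) by simp
  have lenS: "length (sorted_list_of_set S) = c - 1" using c by simp
  define \<sigma> where "\<sigma> i = (if i < h + c then L ! i else i)" for i
  have "bij_betw (\<lambda>i. L ! i) {..<h + c} {..<h + c}"
    by (rule bij_betw_nth[OF L(1)]) (simp_all add: lenL L(2))
  then have "bij_betw \<sigma> {..<h + c} {..<h + c}"
    by (rule bij_betw_cong[THEN iffD1, rotated]) (simp add: \<sigma>_def)
  then have \<sigma>: "\<sigma> permutes {..<h + c}"
    by (rule bij_imp_permutes) (simp add: \<sigma>_def)
  \<comment> \<open>\<open>\<sigma>\<close> takes positions to variable indices; renaming by its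
    inverse turns variable \<open>\<sigma> i\<close> into variable \<open>i\<close>.\<close>
  define \<tau> where "\<tau> = inv_into UNIV \<sigma>"
  have \<tau>: "\<tau> permutes {..<h + c}" unfolding \<tau>_def by (rule permutes_inv[OF \<sigma>])
  have \<tau>\<sigma>: "\<tau> (\<sigma> i) = i" for i unfolding \<tau>_def using permutes_inverses(2)[OF \<sigma>] .
  have inj\<tau>: "inj \<tau>" using permutes_inj[OF \<tau>] .
  have \<sigma>S: "\<sigma> i = sorted_list_of_set S ! i" if "i < c - 1" for i
  proof -
    have "i < h + c" "i < length (sorted_list_of_set S)" using that lenS by linarith+
    then show ?thesis by (simp add: \<sigma>_def L_def nth_append)
  qed
  have \<sigma>S_mem: "\<sigma> i \<in> S" if "i < c - 1" for i
    using that lenS finS nth_mem[of i "sorted_list_of_set S"] by (simp add: \<sigma>S)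
  have \<sigma>c: "\<sigma> (c - 1) = 0"
    using c lenS by (simp add: \<sigma>_def L_def nth_append)
  have \<sigma>_mono: "\<sigma> i < \<sigma> j" if "i < j" "j < c - 1" for i j
    using that lenS sorted_wrt_nth_less[OF strict_sorted_list_of_set[of S], of i j] by (simp add: \<sigma>S)
  have img: "\<sigma> ` {..<c} = insert 0 S"
  proof -
    have "{..<c} = insert (c - 1) {..<c - 1}" using c by auto
    moreover have "\<sigma> ` {..<c - 1} = set (sorted_list_of_set S)"
      using lenS by (auto simp: \<sigma>S set_conv_nth image_def)
    ultimately show ?thesis using finS \<sigma>c by simp
  qed
  define g where "g i = gen (\<sigma> i)" for i
  define f where "f i = rename_vars \<tau> (g i)" for i
  have gG: "g ` {..<c} = gen ` insert 0 S"
    unfolding g_def img[symmetric] by (simp add: image_image)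
  have V: "{0..n} = {..<h + c}" using hc by auto
  have gV: "mvars (g i) \<subseteq> {..<h + c}" if "i < c" for i
  proof -
    have "g i \<in> gen ` insert 0 S" using gG that by blast
    then show ?thesis
      using aut_gen_carrier[OF fgl, folded gen_def S_def, unfolded V] by auto
  qed
  have fV: "mvars (f i) \<subseteq> {..<h + c}" if "i < c" for i
    using mvars_rename_vars[of \<tau> "g i"] gV[OF that] permutes_image[OF \<tau>] unfolding f_def by blast
  interpret B: presentation "{..<h + c}" "f ` {..<c}"
    by unfold_locales (use fV in auto)
  define M where "M = mat c c (\<lambda>(i, j). mpderiv j (f i))"
  have M: "M \<in> carrier_mat c c" by (simp add: M_def)
  have lower: "M $$ (i, j) = 0" if ij: "i < j" "j < c" for i j
  proof -
    have i: "i < c - 1" using ij by simp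
    \<comment> \<open>A column to the right belongs to a larger determined index or to index 0,
      while the equation for \<open>\<sigma> i\<close> has its variables in
      \<open>{1..\<sigma> i}\<close>.\<close>
    have "\<sigma> j \<notin> {1..\<sigma> i}"
    proof (cases "j < c - 1")
      case True
      then show ?thesis using \<sigma>_mono[OF ij(1)] by simp
    next
      case False
      then have "j = c - 1" using ij by simp
      then show ?thesis using \<sigma>c by simp
    qed
    moreover have "mvars (f i) \<subseteq> \<tau> ` {1..\<sigma> i}"
      using mvars_rename_vars[of \<tau> "g i"]
        mvars_aut_gen[OF fgl \<sigma>S_mem[OF i, unfolded S_def], folded gen_def]
      unfolding f_def g_def by blast
    ultimately have "j \<notin> mvars (f i)" using \<tau>\<sigma>[of j] injD[OF inj\<tau>] by (metis imageE subsetD)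
    then show ?thesis using ij by (simp add: M_def mpderiv_not_mvars)
  qed
  have diag: "mvars (M $$ (i, i)) \<subseteq> {..<h + c} \<and> B.cl (M $$ (i, i)) \<in> Units B.Q" if i: "i < c" for i
  proof (cases "i < c - 1")
    case True
    obtain e where e: "e \<noteq> 0" "mpderiv (\<tau> (\<sigma> i)) (rename_vars \<tau> (gen (\<sigma> i))) = mconst e"
      using mpderiv_rename_aut_gen[OF fgl inj\<tau> \<sigma>S_mem[OF True, unfolded S_def] assms(2)]
      unfolding gen_def by blast
    then have Mi: "M $$ (i, i) = mconst e" using i by (simp add: M_def f_def g_def \<tau>\<sigma>)
    have "mconst e * mconst (inverse e) - 1 \<in> B.J"
      using e(1) B.zero_mem by (simp add: mconst_1 flip: type_homD(2)[OF mconst_hom])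
    then show ?thesis unfolding Mi by (auto intro!: B.unit_clI[of _ "mconst (inverse e)"])
  next
    case False
    then have ic: "i = c - 1" using i by simp
    have "\<tau> 1 \<noteq> i" using \<tau>\<sigma>[of i] \<sigma>c ic injD[OF inj\<tau>, of 1 0] by auto
    have "\<tau> 0 = i" using \<tau>\<sigma>[of i] \<sigma>c ic by simp
    have fi: "f i = mvar i * mvar (\<tau> 1) - 1"
      using \<sigma>c \<open>\<tau> 0 = i\<close>
      by (simp add: f_def g_def ic gen_def aut_gen_def[OF fgl] type_homD[OF rename_vars_hom])
    have "(1 :: 'p mod_ring mpoly) = mconst 1" by (simp add: mconst_1)
    then have "mpderiv i (1 :: 'p mod_ring mpoly) = 0" by (simp add: mpderiv_not_mvars)
    then have Mi: "M $$ (i, i) = mvar (\<tau> 1)"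
      using i \<open>\<tau> 1 \<noteq> i\<close> by (simp add: M_def fi mpderiv_diff mpderiv_mvar_mult_mvar)
    have "\<tau> 1 < h + c" using permutes_in_image[OF \<tau>, of 1] hc n by simp
    then have v: "mvars (mvar (\<tau> 1) :: 'p mod_ring mpoly) \<subseteq> {..<h + c}" "mvars (mvar i :: 'p mod_ring mpoly) \<subseteq> {..<h + c}"
      using mvars_mvar[of "\<tau> 1", where 'a = "'p mod_ring"] mvars_mvar[of i, where 'a = "'p mod_ring"] i by auto
    \<comment> \<open>The diagonal entry is the renamed \<open>a_1\<close>, and the equation of this
      row exhibits its inverse.\<close>
    have "mvar (\<tau> 1) * mvar i - 1 \<in> B.J"
    proof -
      have "f i \<in> B.J" using i by (intro B.generator_mem) simp
      then show ?thesis by (simp add: fi mult.commute)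
    qed
    then show ?thesis unfolding Mi using v B.unit_clI[OF v] by blast
  qed
  have "jacobian_det c f = prod_list (diag_mat M)"
    unfolding jacobian_det_def M_def[symmetric] by (rule det_lower_triangular[OF lower M])
  moreover have "B.cl (prod_list (diag_mat M)) \<in> Units B.Q"
  proof (rule conjunct2[OF B.unit_cl_prod_list])
    fix x assume "x \<in> set (diag_mat M)"
    then obtain i where "i < c" "x = M $$ (i, i)" using M by (auto simp: diag_mat_def)
    then show "mvars x \<subseteq> {..<h + c} \<and> B.cl x \<in> Units B.Q" using diag by simp
  qed
  ultimately have unit: "B.cl (jacobian_det c f) \<in> Units B.Q" by simp
  have "smooth_of_relative_dimension (presented_ring {..<h + c} (g ` {..<c}))
      (\<lambda>t. presented_class {..<h + c} (g ` {..<c}) (mconst t)) h"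
    by (rule smooth_of_presentation[OF \<tau> gV]) (use unit in \<open>simp_all add: f_def[abs_def]\<close>)
  \<comment> \<open>Quotient ring and classes depend only on the ideal, so equal ideals transfer
    smoothness verbatim.\<close>
  moreover have "genideal (mpoly_ring {..<h + c}) (g ` {..<c}) =
      genideal (mpoly_ring {..<h + c}) (aut_relations n H)"
    using aut_relations_genideal[OF fgl, folded gen_def S_def] gG unfolding V by simp
  ultimately show ?thesis
    unfolding aut_ring_def aut_class_def presented_ring_def presented_class_def V by simp
qed

end
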